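(* Let $A,B\subset\mathbb{R}^m$ be closed sets, let $K\subset\mathbb{R}^m$ be compact and $T>0$. Assume either (a) the smooth transverse setting (see context) holds on an open neighborhood of $K$; or (b) $A$ and $B$ are finite, and the Filippov solution $x(\cdot)$ intersects only finitely many two-cell interfaces on $[0,T]$ and satisfies $\mathrm{dist}(x(t),\mathcal J)\ge\delta_0>0$ for all $t\in[0,T]$, where $\mathcal J$ denotes the set of multiway junctions. Then there exist $\varepsilon_0>0$ and $C=C(K,T)>0$ such that for all $x_0\in K$ and $0<\varepsilon\le\varepsilon_0$, $$\sup_{t\in[0,T]}\|x^\varepsilon(t)-x(t)\|\le C\,\varepsilon ,$$ where $x(\cdot)$ is the Carath\'eodory solution (in case (a)), respectively the Filippov solution (in case (b)), of $\dot x=v(x)$ with $x(0)=x_0$.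
   Context: For closed sets $A,B\subset\mathbb{R}^m$ let $P_A,P_B$ be the metric (nearest-point) projections, $R_A:=2P_A-\mathrm{Id}$, and $v(x):=P_B(R_Ax)-P_Ax$ (the RRR flow field). For $\varepsilon>0$ and $x_0\in\mathbb{R}^m$ the RRR iterates are $x_{k+1}=x_k+\varepsilon v(x_k)$, and $x^\varepsilon(\cdot)$ is the piecewise-linear interpolation with $x^\varepsilon(k\varepsilon)=x_k$. Smooth transverse setting: $A$ and $B$ are $C^2$ embedded submanifolds of $\mathbb{R}^m$ that intersect transversally at a point $x^*\in A\cap B$; in a sufficiently small neighborhood of $x^*$, $P_A$ and $P_B$ are single-valued and $C^1$, with derivatives at $x^*$ the orthogonal projectors onto $T_{x^*}A$, $T_{x^*}B$; $M:=A\cap B$ is a $C^2$ submanifold and $P_A,P_B$ restrict to the identity on $M$ near $x^*$. "Holds on an open neighborhood of $K$" means that the neighborhood of $x^*$ on which these regularity properties hold contains an open neighborhood of $K$. Finite case: for $(a,b)\in A\times B$, $W(a,b):=\{x: P_A(x)=a,\ P_B(R_Ax)=b\}$ (W-domain), on which $v\equiv b-a$. Up to a null set the W-domains partition $\mathbb{R}^m$. A two-cell interface is a (smooth) portion of the common boundary of two W-domains; $\mathcal J$ is the set of points where three or more W-domains meet. Filippov solutions: $\mathcal F(x)$ is the closed convex hull of all essential values of $v$ near $x$; a Filippov solution is an absolutely continuous curve with $\dot x(t)\in\mathcal F(x(t))$ for almost every $t$.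
   Formalization: In (a) it is also assumed that P_B is single-valued and C^1 on an open set containing the neighborhood and its image under R_A, and that the Carathéodory solution from each x_0 in K exists on [0,T] inside the neighborhood; in (b) the Filippov solution is assumed unique on [0,T]. *)

theory Defs
  imports "HOL-Analysis.Analysis"
begin

section \<open>Metric projections and the RRR flow\<close>

definition nearest_points :: "'a::euclidean_space set \<Rightarrow> 'a \<Rightarrow> 'a set" where
  "nearest_points S x = {s \<in> S. \<forall>s'\<in>S. dist x s \<le> dist x s'}"

text \<open>A metric projection onto a nonconvex set has ties. \<open>p\<close> is any function choosing a nearest
  point everywhere (\<^const>\<open>closest_point\<close> is one); single-valuedness is a separate property.\<close>

definition metric_projection :: "'a::euclidean_space set \<Rightarrow> ('a \<Rightarrow> 'a) \<Rightarrow> bool" where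
  "metric_projection S p \<longleftrightarrow> (\<forall>x. p x \<in> nearest_points S x)"

definition single_valued_on :: "'a::euclidean_space set \<Rightarrow> 'a set \<Rightarrow> bool" where
  "single_valued_on S U \<longleftrightarrow> (\<forall>x\<in>U. \<exists>!s. s \<in> nearest_points S x)"

definition reflector :: "('a::euclidean_space \<Rightarrow> 'a) \<Rightarrow> 'a \<Rightarrow> 'a" where
  "reflector p x = 2 *\<^sub>R p x - x"

definition rrr_field :: "('a::euclidean_space \<Rightarrow> 'a) \<Rightarrow> ('a \<Rightarrow> 'a) \<Rightarrow> 'a \<Rightarrow> 'a" where
  "rrr_field pA pB x = pB (reflector pA x) - pA x"

primrec euler_iterate :: "('a::euclidean_space \<Rightarrow> 'a) \<Rightarrow> real \<Rightarrow> 'a \<Rightarrow> nat \<Rightarrow> 'a" where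
  "euler_iterate v \<epsilon> x0 0 = x0"
| "euler_iterate v \<epsilon> x0 (Suc k) =
     euler_iterate v \<epsilon> x0 k + \<epsilon> *\<^sub>R v (euler_iterate v \<epsilon> x0 k)"

definition euler_interp :: "('a::euclidean_space \<Rightarrow> 'a) \<Rightarrow> real \<Rightarrow> 'a \<Rightarrow> real \<Rightarrow> 'a" where
  "euler_interp v \<epsilon> x0 t =
     (let k = nat \<lfloor>t / \<epsilon>\<rfloor>; xk = euler_iterate v \<epsilon> x0 k; xk' = euler_iterate v \<epsilon> x0 (Suc k)
      in xk + (t / \<epsilon> - real k) *\<^sub>R (xk' - xk))"

lemma euler_interp_grid:
  "\<epsilon> > 0 \<Longrightarrow> euler_interp v \<epsilon> x0 (real k * \<epsilon>) = euler_iterate v \<epsilon> x0 k"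
  by (simp add: euler_interp_def)


section \<open>Submanifolds and the smooth transverse setting\<close>

definition C1_on :: "('a::euclidean_space \<Rightarrow> 'b::real_normed_vector) \<Rightarrow> 'a set \<Rightarrow> bool" where
  "C1_on f U \<longleftrightarrow> (\<exists>f' :: 'a \<Rightarrow> 'a \<Rightarrow>\<^sub>L 'b.
     (\<forall>x\<in>U. (f has_derivative blinfun_apply (f' x)) (at x)) \<and> continuous_on U f')"

definition C2_on :: "('a::euclidean_space \<Rightarrow> 'b::real_normed_vector) \<Rightarrow> 'a set \<Rightarrow> bool" where
  "C2_on f U \<longleftrightarrow> (\<exists>f' :: 'a \<Rightarrow> 'a \<Rightarrow>\<^sub>L 'b.
     (\<forall>x\<in>U. (f has_derivative blinfun_apply (f' x)) (at x)) \<and> C1_on f' U)"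

text \<open>Embedded submanifolds by straightening charts, of the same dimension at all points.\<close>

definition C2_submanifold :: "'a::euclidean_space set \<Rightarrow> bool" where
  "C2_submanifold S \<longleftrightarrow> (\<exists>d. \<forall>p\<in>S. \<exists>N V \<phi> \<psi> L.
     open N \<and> p \<in> N \<and> open (V :: 'a set) \<and> homeomorphism N V \<phi> \<psi> \<and> C2_on \<phi> N \<and> C2_on \<psi> V \<and>
     subspace L \<and> dim L = d \<and> \<phi> ` (S \<inter> N) = V \<inter> L)"

definition tangent_space :: "'a::euclidean_space set \<Rightarrow> 'a \<Rightarrow> 'a set" where
  "tangent_space S p = {w. \<exists>\<gamma> r. r > 0 \<and> \<gamma> C1_differentiable_on {-r<..<r} \<and>
     \<gamma> ` {-r<..<r} \<subseteq> S \<and> \<gamma> 0 = p \<and> (\<gamma> has_vector_derivative w) (at (0::real))}"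

definition transversal_at :: "'a::euclidean_space set \<Rightarrow> 'a set \<Rightarrow> 'a \<Rightarrow> bool" where
  "transversal_at A B p \<longleftrightarrow> {u + w | u w. u \<in> tangent_space A p \<and> w \<in> tangent_space B p} = UNIV"

definition orthogonal_projector :: "'a::euclidean_space set \<Rightarrow> ('a \<Rightarrow> 'a) \<Rightarrow> bool" where
  "orthogonal_projector L P \<longleftrightarrow> (\<forall>u. P u \<in> L \<and> (\<forall>w\<in>L. orthogonal (u - P u) w))"

text \<open>\<open>U\<close> is the neighbourhood of \<open>p\<close> on which the regularity properties hold. The field evaluates
  \<open>P_B\<close> at \<open>R_A x\<close>, which may lie outside \<open>U\<close>; so the regularity of \<open>P_B\<close> is required on an open
  set \<open>V\<close> containing \<open>U\<close> and also \<open>R_A U\<close>.\<close>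

definition smooth_transverse_on ::
    "'a::euclidean_space set \<Rightarrow> 'a set \<Rightarrow> ('a \<Rightarrow> 'a) \<Rightarrow> ('a \<Rightarrow> 'a) \<Rightarrow> 'a \<Rightarrow> 'a set \<Rightarrow> bool" where
  "smooth_transverse_on A B pA pB p U \<longleftrightarrow>
     C2_submanifold A \<and> C2_submanifold B \<and> p \<in> A \<inter> B \<and> transversal_at A B p \<and>
     open U \<and> p \<in> U \<and>
     single_valued_on A U \<and> C1_on pA U \<and>
     (\<exists>V. open V \<and> U \<subseteq> V \<and> reflector pA ` U \<subseteq> V \<and> single_valued_on B V \<and> C1_on pB V) \<and>
     (\<exists>D. (pA has_derivative D) (at p) \<and> orthogonal_projector (tangent_space A p) D) \<and>
     (\<exists>D. (pB has_derivative D) (at p) \<and> orthogonal_projector (tangent_space B p) D) \<and>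
     (\<exists>N. open N \<and> p \<in> N \<and> N \<subseteq> U \<and> C2_submanifold (A \<inter> B \<inter> N) \<and>
          (\<forall>x \<in> A \<inter> B \<inter> N. pA x = x \<and> pB x = x))"


section \<open>Caratheodory and Filippov solutions\<close>

text \<open>The classical definition of absolute continuity; a finite family of non-overlapping
  compact intervals is a division of its union.\<close>

definition abs_continuous_on :: "real \<Rightarrow> real \<Rightarrow> (real \<Rightarrow> 'a::euclidean_space) \<Rightarrow> bool" where
  "abs_continuous_on a b x \<longleftrightarrow> (\<forall>e>0. \<exists>d>0. \<forall>\<D>.
     \<D> division_of \<Union>\<D> \<and> \<Union>\<D> \<subseteq> {a..b} \<and> (\<Sum>I\<in>\<D>. Sup I - Inf I) < d \<longrightarrow>
     (\<Sum>I\<in>\<D>. norm (x (Sup I) - x (Inf I))) < e)"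

text \<open>Solutions on \<open>[0,T]\<close> of the ODE posed on the state domain \<open>U\<close>.\<close>

definition caratheodory_solution ::
    "'a::euclidean_space set \<Rightarrow> ('a \<Rightarrow> 'a) \<Rightarrow> real \<Rightarrow> 'a \<Rightarrow> (real \<Rightarrow> 'a) \<Rightarrow> bool" where
  "caratheodory_solution U v T x0 x \<longleftrightarrow> x 0 = x0 \<and> x ` {0..T} \<subseteq> U \<and> abs_continuous_on 0 T x \<and>
     (AE t in lebesgue. t \<in> {0..T} \<longrightarrow>
        (x has_vector_derivative v (x t)) (at t within {0..T}))"

definition essential_values :: "('a::euclidean_space \<Rightarrow> 'a) \<Rightarrow> 'a \<Rightarrow> 'a set" where
  "essential_values v x =
     {w. \<forall>\<delta>>0. \<forall>\<eta>>0. \<not> negligible {y \<in> ball x \<delta>. v y \<in> ball w \<eta>}}"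

definition filippov_map :: "('a::euclidean_space \<Rightarrow> 'a) \<Rightarrow> 'a \<Rightarrow> 'a set" where
  "filippov_map v x = closure (convex hull (essential_values v x))"

definition filippov_solution ::
    "('a::euclidean_space \<Rightarrow> 'a) \<Rightarrow> real \<Rightarrow> 'a \<Rightarrow> (real \<Rightarrow> 'a) \<Rightarrow> bool" where
  "filippov_solution v T x0 x \<longleftrightarrow> x 0 = x0 \<and> abs_continuous_on 0 T x \<and>
     (AE t in lebesgue. t \<in> {0..T} \<longrightarrow>
        (\<exists>w \<in> filippov_map v (x t). (x has_vector_derivative w) (at t within {0..T})))"

text \<open>Filippov solutions need not be unique (a field pointing away from an interface on both sides),
  so \<^emph>\<open>the\<close> Filippov solution is the one that all others agree with on \<open>[0,T]\<close>.\<close>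

definition the_filippov_solution ::
    "('a::euclidean_space \<Rightarrow> 'a) \<Rightarrow> real \<Rightarrow> 'a \<Rightarrow> (real \<Rightarrow> 'a) \<Rightarrow> bool" where
  "the_filippov_solution v T x0 x \<longleftrightarrow> filippov_solution v T x0 x \<and>
     (\<forall>y. filippov_solution v T x0 y \<longrightarrow> (\<forall>t\<in>{0..T}. y t = x t))"


section \<open>W-domains of finite sets\<close>

definition W_domain :: "('a::euclidean_space \<Rightarrow> 'a) \<Rightarrow> ('a \<Rightarrow> 'a) \<Rightarrow> 'a \<times> 'a \<Rightarrow> 'a set" where
  "W_domain pA pB = (\<lambda>(a, b). {x. pA x = a \<and> pB (reflector pA x) = b})"

text \<open>Domains meet at \<open>x\<close> when \<open>x\<close> is in their closures. This includes lower-dimensional domains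
  that a choice at ties may produce.\<close>

definition junctions ::
    "'a::euclidean_space set \<Rightarrow> 'a set \<Rightarrow> ('a \<Rightarrow> 'a) \<Rightarrow> ('a \<Rightarrow> 'a) \<Rightarrow> 'a set" where
  "junctions A B pA pB = {x. card {q \<in> A \<times> B. x \<in> closure (W_domain pA pB q)} \<ge> 3}"

text \<open>The portions of a common boundary are taken to be the connected components of what remains
  after the junctions are removed. They are flat, since the domains of finite sets
  are convex polyhedra up to the choice at ties.\<close>

definition two_cell_interfaces ::
    "'a::euclidean_space set \<Rightarrow> 'a set \<Rightarrow> ('a \<Rightarrow> 'a) \<Rightarrow> ('a \<Rightarrow> 'a) \<Rightarrow> 'a set set" where
  "two_cell_interfaces A B pA pB =
     (\<Union>q \<in> A \<times> B. \<Union>q' \<in> A \<times> B - {q}.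
        components (frontier (W_domain pA pB q) \<inter> frontier (W_domain pA pB q')
                    - junctions A B pA pB))"

end

theory Submission
  imports Defs
begin

text \<open>In the smooth case the field is \<open>C\<^sup>1\<close> on a neighbourhood of each solution, so the usual discrete
  Gronwall estimate holds near it; the compactness of \<open>K\<close> makes the constants uniform.

  In the finite case the field takes at most two values \<open>u\<close>, \<open>w\<close> near a point that is not a junction, and
  they are separated by a hyperplane with normal \<open>n\<close>, pointing to the side of \<open>w\<close>. Unless \<open>u \<noteq> w\<close> and
  \<open>n \<bullet> u \<le> 0 \<le> n \<bullet> w\<close>, exact solutions and Euler polygons depend Lipschitz continuously on their initial
  point up to an error of order \<open>\<epsilon>\<close>: if \<open>n \<bullet> u > n \<bullet> w\<close> the normal coordinates contract, and in a
  crossing a piecewise linear map straightens the flow. In the exceptional case \<open>x + t u\<close> and \<open>x + t w\<close>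
  both solve the inclusion for short times from a point \<open>x\<close> of the interface. They extend to \<open>[0, T]\<close>, by
  Zorn's lemma and a Kakutani type fixed point argument for the direction of continuation, so a unique
  solution cannot start at \<open>x\<close>. Since the field does not point towards such an interface, the solution
  cannot reach it later either. Compactness of the trajectory then yields a tube of good
  neighbourhoods.\<close>

section \<open>Absolutely continuous curves\<close>

text \<open>On an interface the field takes whatever value the choice at ties gives it, so no
  Lipschitz bound is at hand there. The finite case therefore works with increments: secant slopes
  of a Filippov solution lie in every closed convex set that contains the admissible velocities, and
  those of an Euler polygon are averages of the field over its cells. Both become instances of one
  notion, and the error estimate is the stability of that notion under a parameter \<eta>, which is
  0 for exact solutions and of order \<epsilon> for polygons. Uniqueness is assumed of solutions on
  the whole interval, whereas branching shows itself for short times only. A continuation may run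
  into junctions, where two values no longer describe the field, so existence is proved for all
  piecewise constant fields on polyhedra, from every point. Constants found along the solution from
  x0 also serve solutions and polygons from nearby initial points; this lets the compactness of K
  finish both cases in the same way.\<close>

text \<open>A gauge argument as for the Henstock integral: intervals tagged at points of
  differentiability contribute at least (\<beta> - e norm w) times their length, while those tagged
  in the null set lie in an open set of small measure, where absolute continuity bounds the sum of
  their increments by e.\<close>

lemma abs_continuous_on_increment_inner_ge:
  fixes x :: "real \<Rightarrow> 'a::euclidean_space" and w :: 'a
  assumes ac: "abs_continuous_on a b x" and "a \<le> s" "s \<le> t" "t \<le> b"
    and deriv: "AE r in lebesgue. s < r \<and> r < t \<longrightarrow>
      (\<exists>d. (x has_vector_derivative d) (at r within {a..b}) \<and> \<beta> \<le> w \<bullet> d)"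
  shows "\<beta> * (t - s) \<le> w \<bullet> (x t - x s)"
proof (rule field_le_epsilon)
  fix e0 :: real assume "e0 > 0"
  \<comment> \<open>The denominator collects the losses: linear approximation on the good intervals,
    \<bar>\<beta>\<bar> times the length of the bad ones, and the increments over the bad ones; the
    1 keeps it positive.\<close>
  define e where "e = e0 / (norm w * (t - s) + \<bar>\<beta>\<bar> + norm w + 1)"
  have den: "norm w * (t - s) + \<bar>\<beta>\<bar> + norm w + 1 > 0"
    using assms(3) by (intro add_nonneg_pos add_nonneg_nonneg mult_nonneg_nonneg) auto
  have "e > 0" using \<open>e0 > 0\<close> den by (simp add: e_def)
  have e_total: "e * norm w * (t - s) + \<bar>\<beta>\<bar> * e + e * norm w \<le> e0"
  proof -
    have "e * (norm w * (t - s) + \<bar>\<beta>\<bar> + norm w + 1) = e0"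
      using den by (simp add: e_def)
    then show ?thesis using \<open>e > 0\<close> by (simp add: algebra_simps)
  qed
  obtain d0 where "d0 > 0" and d0: "\<And>\<D>. \<D> division_of \<Union>\<D> \<Longrightarrow> \<Union>\<D> \<subseteq> {a..b} \<Longrightarrow>
      (\<Sum>I\<in>\<D>. Sup I - Inf I) < d0 \<Longrightarrow> (\<Sum>I\<in>\<D>. norm (x (Sup I) - x (Inf I))) < e"
    using ac \<open>e > 0\<close> unfolding abs_continuous_on_def by meson
  obtain N where N: "N \<in> null_sets lebesgue"
    "\<And>r. r \<notin> N \<Longrightarrow> s < r \<Longrightarrow> r < t \<Longrightarrow>
      \<exists>d. (x has_vector_derivative d) (at r within {a..b}) \<and> \<beta> \<le> w \<bullet> d"
  proof -
    from deriv obtain N where "N \<in> null_sets lebesgue"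
      "{r \<in> space lebesgue. \<not> (s < r \<and> r < t \<longrightarrow>
        (\<exists>d. (x has_vector_derivative d) (at r within {a..b}) \<and> \<beta> \<le> w \<bullet> d))} \<subseteq> N"
      unfolding eventually_ae_filter by blast
    then show ?thesis by (intro that[of N]) auto
  qed
  \<comment> \<open>The hypothesis speaks of interior times only, so tags at the endpoints are
    treated like tags in the null set.\<close>
  define N' where "N' = N \<union> {s, t}"
  have neg: "N' \<in> null_sets lebesgue"
    using N(1) unfolding N'_def by (metis negligible_Un negligible_finite negligible_iff_null_sets
      finite.emptyI finite.insertI)
  \<comment> \<open>\<open>d0\<close> makes absolute continuity applicable to the bad intervals,
    \<open>e\<close> bounds their total length.\<close>
  define d1 where "d1 = min d0 e"
  have "d1 > 0" using \<open>d0 > 0\<close> \<open>e > 0\<close> by (simp add: d1_def)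
  obtain Ob where Ob: "open Ob" "N' \<subseteq> Ob" "Ob - N' \<in> lmeasurable" "emeasure lebesgue (Ob - N') < ennreal d1"
    using sets_lebesgue_outer_open[of N' d1] neg \<open>d1 > 0\<close> by blast
  have Obm: "Ob \<in> lmeasurable" "measure lebesgue Ob < d1"
  proof -
    have "emeasure lebesgue Ob = emeasure lebesgue ((Ob - N') \<union> N')"
      using Ob(2) by (simp add: Un_absorb2)
    also have "\<dots> = emeasure lebesgue (Ob - N')"
      using neg Ob(3) by (intro emeasure_Un_null_set) auto
    finally have *: "emeasure lebesgue Ob < ennreal d1" using Ob(4) by simp
    then show "Ob \<in> lmeasurable" using Ob(1)
      by (intro fmeasurableI) (auto intro: order.strict_trans)
    then show "measure lebesgue Ob < d1"
      using * \<open>d1 > 0\<close> by (simp add: emeasure_eq_measure2 ennreal_less_iff)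
  qed
  have "\<exists>\<rho>>0. (r \<in> N' \<longrightarrow> ball r \<rho> \<subseteq> Ob) \<and> (r \<notin> N' \<longrightarrow> s < r \<longrightarrow> r < t \<longrightarrow>
      (\<forall>u v. s \<le> u \<and> u \<le> r \<and> r \<le> v \<and> v \<le> t \<and> u \<in> ball r \<rho> \<and> v \<in> ball r \<rho> \<longrightarrow>
        \<beta> * (v - u) - e * norm w * (v - u) \<le> w \<bullet> (x v - x u)))" for r
  proof (cases "r \<in> N' \<or> \<not> (s < r \<and> r < t)")
    case True
    show ?thesis
    proof (cases "r \<in> N'")
      case True
      then show ?thesis using Ob(1,2) by (meson open_contains_ball subsetD)
    qed (use True in \<open>auto intro: zero_less_one\<close>)
  next
    case False
    then have r: "r \<notin> N" "s < r" "r < t" by (auto simp: N'_def)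
    from N(2)[OF this] obtain d where d: "(x has_vector_derivative d) (at r within {a..b})" "\<beta> \<le> w \<bullet> d"
      by blast
    have "\<exists>\<rho>>0. \<forall>y\<in>{a..b}. norm (y - r) < \<rho> \<longrightarrow>
        norm (x y - x r - (y - r) *\<^sub>R d) \<le> e * norm (y - r)"
      using d(1) \<open>e > 0\<close> unfolding has_vector_derivative_def has_derivative_within_alt by simp
    then obtain \<rho> where \<rho>: "\<rho> > 0" "\<And>y. y \<in> {a..b} \<Longrightarrow> \<bar>y - r\<bar> < \<rho> \<Longrightarrow>
        norm (x y - x r - (y - r) *\<^sub>R d) \<le> e * \<bar>y - r\<bar>" by auto
    have "\<beta> * (v - u) - e * norm w * (v - u) \<le> w \<bullet> (x v - x u)"
      if uv: "s \<le> u" "u \<le> r" "r \<le> v" "v \<le> t" "u \<in> ball r \<rho>" "v \<in> ball r \<rho>" for u v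
    proof -
      have 1: "norm (x v - x r - (v - r) *\<^sub>R d) \<le> e * (v - r)"
        using \<rho>(2)[of v] uv assms by (auto simp: dist_real_def)
      have 2: "norm (x u - x r - (u - r) *\<^sub>R d) \<le> e * (r - u)"
        using \<rho>(2)[of u] uv assms by (auto simp: dist_real_def)
      have eq: "x v - x u - (v - u) *\<^sub>R d
          = (x v - x r - (v - r) *\<^sub>R d) - (x u - x r - (u - r) *\<^sub>R d)"
        by (simp add: algebra_simps)
      have "norm (x v - x u - (v - u) *\<^sub>R d) \<le> e * (v - u)"
        unfolding eq using 1 2 norm_triangle_ineq4[of "x v - x r - (v - r) *\<^sub>R d" "x u - x r - (u - r) *\<^sub>R d"]
        by (simp add: algebra_simps)
      then have "norm w * norm (x v - x u - (v - u) *\<^sub>R d) \<le> norm w * (e * (v - u))"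
        by (intro mult_left_mono) auto
      moreover have "\<bar>w \<bullet> (x v - x u - (v - u) *\<^sub>R d)\<bar> \<le> norm w * norm (x v - x u - (v - u) *\<^sub>R d)"
        by (rule Cauchy_Schwarz_ineq2)
      moreover have "w \<bullet> (x v - x u - (v - u) *\<^sub>R d) = w \<bullet> (x v - x u) - (v - u) * (w \<bullet> d)"
        by (simp add: inner_diff_right)
      moreover have "\<beta> * (v - u) \<le> (v - u) * (w \<bullet> d)"
        using mult_left_mono[OF d(2), of "v - u"] uv by (simp add: mult.commute)
      ultimately show ?thesis by (simp add: mult.assoc mult.left_commute)
    qed
    then show ?thesis using \<rho>(1) False by blast
  qed
  then obtain \<rho> where \<rho>: "\<And>r. \<rho> r > 0" "\<And>r. r \<in> N' \<Longrightarrow> ball r (\<rho> r) \<subseteq> Ob"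
    "\<And>r u v. r \<notin> N' \<Longrightarrow> s < r \<Longrightarrow> r < t \<Longrightarrow> s \<le> u \<Longrightarrow> u \<le> r \<Longrightarrow> r \<le> v \<Longrightarrow> v \<le> t \<Longrightarrow>
      u \<in> ball r (\<rho> r) \<Longrightarrow> v \<in> ball r (\<rho> r) \<Longrightarrow>
        \<beta> * (v - u) - e * norm w * (v - u) \<le> w \<bullet> (x v - x u)"
    by metis
  have "gauge (\<lambda>r. ball r (\<rho> r))" using \<rho>(1) by (simp add: gauge_def)
  then obtain p where p: "p tagged_division_of {s..t}" "(\<lambda>r. ball r (\<rho> r)) fine p"
    by (rule fine_division_exists_real)
  have fin: "finite p" using p(1) by blast
  define p1 where "p1 = {(r, I) \<in> p. r \<in> N'}"
  define p2 where "p2 = {(r, I) \<in> p. r \<notin> N'}"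
  have p12: "p = p1 \<union> p2" "p1 \<inter> p2 = {}" "finite p1" "finite p2"
    using fin by (auto simp: p1_def p2_def intro: finite_subset[OF _ fin])
  define len where "len = (\<lambda>I::real set. Sup I - Inf I)"
  define inc where "inc = (\<lambda>I::real set. w \<bullet> (x (Sup I) - x (Inf I)))"
  have elem: "\<exists>u v. I = {u..v} \<and> s \<le> u \<and> u \<le> r \<and> r \<le> v \<and> v \<le> t \<and> u \<in> ball r (\<rho> r) \<and> v \<in> ball r (\<rho> r)
      \<and> I \<subseteq> ball r (\<rho> r)" if "(r, I) \<in> p" for r I
  proof -
    from tagged_division_ofD(2,3,4)[OF p(1) that] obtain u v where *: "r \<in> I" "I \<subseteq> {s..t}" "I = {u..v}"
      by (metis box_real(2))
    moreover have "I \<subseteq> ball r (\<rho> r)" using p(2) that by (auto simp: fine_def)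
    ultimately show ?thesis by (intro exI[of _ u] exI[of _ v]) (auto simp del: mem_ball)
  qed
  have tot: "(\<Sum>(r, I)\<in>p. inc I) = w \<bullet> (x t - x s)"
    using additive_tagged_division_1[OF assms(3) p(1), of "\<lambda>r. w \<bullet> x r"]
    by (simp add: inc_def inner_diff_right)
  have totlen: "(\<Sum>(r, I)\<in>p. len I) = t - s"
    using additive_tagged_division_1[OF assms(3) p(1), of "\<lambda>r. r"] by (simp add: len_def)
  have good: "(\<Sum>(r, I)\<in>p2. inc I) \<ge> (\<Sum>(r, I)\<in>p2. (\<beta> - e * norm w) * len I)"
  proof (rule sum_mono, clarify)
    fix r I assume rI: "(r, I) \<in> p2"
    then obtain u v where *: "I = {u..v}" "s \<le> u" "u \<le> r" "r \<le> v" "v \<le> t" "u \<in> ball r (\<rho> r)" "v \<in> ball r (\<rho> r)"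
      using elem unfolding p2_def by blast
    moreover have r: "r \<notin> N'" using rI by (simp add: p2_def)
    then have "s < r" "r < t" using * by (auto simp: N'_def)
    ultimately show "(\<beta> - e * norm w) * len I \<le> inc I"
      using \<rho>(3)[of r u v] r by (simp add: inc_def len_def algebra_simps)
  qed
  have tp: "p1 tagged_partial_division_of {s..t}"
    using p(1) p12(1) by (metis Un_upper1 tagged_division_of_def tagged_partial_division_subset)
  define \<D> where "\<D> = snd ` p1"
  have div: "\<D> division_of \<Union>\<D>"
    unfolding \<D>_def by (rule partial_division_of_tagged_division[OF tp])
  have D: "\<Union>\<D> \<subseteq> {a..b}" "\<Union>\<D> \<subseteq> Ob"
  proof -
    show "\<Union>\<D> \<subseteq> {a..b}" using elem assms(2,4) unfolding \<D>_def p1_def by fastforce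
    show "\<Union>\<D> \<subseteq> Ob"
    proof clarify
      fix y I assume "y \<in> I" "I \<in> \<D>"
      then obtain r where "(r, I) \<in> p" "r \<in> N'" by (auto simp: \<D>_def p1_def)
      then show "y \<in> Ob" using elem[of r I] \<rho>(2)[of r] \<open>y \<in> I\<close> by blast
    qed
  qed
  have "(\<Sum>I\<in>\<D>. len I) = (\<Sum>I\<in>\<D>. measure lebesgue I)"
  proof (rule sum.cong[OF refl])
    fix I assume "I \<in> \<D>"
    then obtain r where "(r, I) \<in> p" by (auto simp: \<D>_def p1_def)
    then show "len I = measure lebesgue I" using elem[of r I] by (auto simp: len_def)
  qed
  also have "\<dots> = measure lebesgue (\<Union>\<D>)" by (rule content_division[OF div])
  also have "\<dots> \<le> measure lebesgue Ob"
    using D(2) Obm(1) div by (intro measure_mono_fmeasurable) (auto intro!: fmeasurableD lmeasurable_division)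
  finally have lenD: "(\<Sum>I\<in>\<D>. len I) < d1" using Obm(2) by simp
  then have "(\<Sum>I\<in>\<D>. norm (x (Sup I) - x (Inf I))) < e"
    using d0[OF div D(1)] by (simp add: len_def d1_def)
  \<comment> \<open>\<^term>\<open>Sup {} - Inf {}\<close> is an unspecified real, so the empty interval is treated separately.\<close>
  have over: "(\<Sum>(r, I)\<in>p1. f I) = (\<Sum>I\<in>\<D>. f I)" if f: "\<And>c. f {c} = 0" for f :: "real set \<Rightarrow> real"
  proof -
    define g where "g = (\<lambda>I. if I = {} then 0 else f I)"
    have ne: "I \<noteq> {}" if "(r, I) \<in> p1" for r I
      using elem[of r I] that by (auto simp: p1_def)
    have "(\<Sum>(r, I)\<in>p1. f I) = (\<Sum>(r, I)\<in>p1. g I)"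
      using ne by (intro sum.cong refl) (auto simp: g_def)
    also have "\<dots> = (\<Sum>I\<in>\<D>. g I)"
      unfolding \<D>_def
    proof (rule sum.over_tagged_division_lemma[OF tagged_partial_division_of_Union_self[OF tp]])
      fix u v :: real assume "box u v = {}"
      then have "v \<le> u" by (simp add: box_eq_empty)
      then have "cbox u v = {} \<or> cbox u v = {u}" by auto
      then show "g (cbox u v) = 0" using f by (auto simp: g_def)
    qed
    also have "\<dots> = (\<Sum>I\<in>\<D>. f I)"
      using ne by (intro sum.cong refl) (force simp: g_def \<D>_def)
    finally show ?thesis .
  qed
  have bad: "(\<Sum>(r, I)\<in>p1. inc I) \<ge> - (e * norm w)"
  proof -
    have "\<bar>\<Sum>(r, I)\<in>p1. inc I\<bar> \<le> (\<Sum>(r, I)\<in>p1. norm w * norm (x (Sup I) - x (Inf I)))"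
      by (rule order_trans[OF sum_abs]) (auto intro!: sum_mono simp: inc_def Cauchy_Schwarz_ineq2)
    also have "\<dots> = (\<Sum>I\<in>\<D>. norm w * norm (x (Sup I) - x (Inf I)))"
      by (rule over) auto
    also have "\<dots> = norm w * (\<Sum>I\<in>\<D>. norm (x (Sup I) - x (Inf I)))" by (simp add: sum_distrib_left)
    also have "\<dots> \<le> norm w * e" using \<open>(\<Sum>I\<in>\<D>. norm (x (Sup I) - x (Inf I))) < e\<close>
      by (intro mult_left_mono) auto
    finally show ?thesis by (simp add: mult.commute abs_le_iff)
  qed
  have len1: "0 \<le> (\<Sum>(r, I)\<in>p1. len I)" "(\<Sum>(r, I)\<in>p1. len I) \<le> e"
  proof -
    show "0 \<le> (\<Sum>(r, I)\<in>p1. len I)"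
    proof (rule sum_nonneg, clarify)
      fix r I assume "(r, I) \<in> p1"
      then show "0 \<le> len I" using elem[of r I] by (auto simp: p1_def len_def)
    qed
    have "(\<Sum>(r, I)\<in>p1. len I) = (\<Sum>I\<in>\<D>. len I)"
      by (rule over) (auto simp: len_def)
    then show "(\<Sum>(r, I)\<in>p1. len I) \<le> e" using lenD by (simp add: d1_def)
  qed
  define \<Lambda> where "\<Lambda> = (\<Sum>(r, I)\<in>p1. len I)"
  have l2: "(\<Sum>(r, I)\<in>p2. len I) = (t - s) - \<Lambda>"
    using totlen sum.union_disjoint[OF p12(3,4,2), of "\<lambda>(r, I). len I"] p12(1) by (simp add: \<Lambda>_def)
  have g2: "(\<Sum>(r, I)\<in>p2. (\<beta> - e * norm w) * len I) = (\<beta> - e * norm w) * ((t - s) - \<Lambda>)"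
    unfolding l2[symmetric] by (simp add: sum_distrib_left case_prod_unfold)
  have tot2: "w \<bullet> (x t - x s) = (\<Sum>(r, I)\<in>p1. inc I) + (\<Sum>(r, I)\<in>p2. inc I)"
    using tot sum.union_disjoint[OF p12(3,4,2), of "\<lambda>(r, I). inc I"] p12(1) by simp
  have L: "0 \<le> \<Lambda>" "\<Lambda> \<le> e" using len1 by (auto simp: \<Lambda>_def)
  have "\<beta> * \<Lambda> \<le> \<bar>\<beta>\<bar> * e"
    using L by (intro mult_mono) auto
  moreover have "0 \<le> e * norm w * \<Lambda>" using L \<open>e > 0\<close> by simp
  moreover have "w \<bullet> (x t - x s) \<ge> - (e * norm w) + (\<beta> - e * norm w) * ((t - s) - \<Lambda>)"
    using tot2 bad good g2 by linarith
  ultimately have "w \<bullet> (x t - x s) \<ge> \<beta> * (t - s) - e * norm w * (t - s) - \<bar>\<beta>\<bar> * e - e * norm w"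
    by (simp add: algebra_simps)
  then show "\<beta> * (t - s) \<le> w \<bullet> (x t - x s) + e0" using e_total by linarith
qed

text \<open>A secant slope outside Q would be strictly separated from Q by a hyperplane, against the
  scalar inequality in the normal direction. All later uses of the almost everywhere differential
  conditions go through this form.\<close>

lemma abs_continuous_on_increment:
  fixes x :: "real \<Rightarrow> 'a::euclidean_space"
  assumes "abs_continuous_on a b x" "a \<le> s" "s < t" "t \<le> b" "convex Q" "closed Q"
    and deriv: "AE r in lebesgue. s < r \<and> r < t \<longrightarrow>
      (\<exists>d\<in>Q. (x has_vector_derivative d) (at r within {a..b}))"
  shows "\<exists>q\<in>Q. x t - x s = (t - s) *\<^sub>R q"
proof -
  define z where "z = (x t - x s) /\<^sub>R (t - s)"
  have z: "x t - x s = (t - s) *\<^sub>R z" using \<open>s < t\<close> by (simp add: z_def)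
  have "z \<in> Q"
  proof (rule ccontr)
    assume "z \<notin> Q"
    then obtain w \<beta> where w: "w \<bullet> z < \<beta>" "\<And>q. q \<in> Q \<Longrightarrow> w \<bullet> q > \<beta>"
      using separating_hyperplane_closed_point[OF assms(5,6)] by blast
    have "\<beta> * (t - s) \<le> w \<bullet> (x t - x s)"
    proof (rule abs_continuous_on_increment_inner_ge[OF assms(1,2) less_imp_le[OF assms(3)] assms(4)])
      show "AE r in lebesgue. s < r \<and> r < t \<longrightarrow>
        (\<exists>d. (x has_vector_derivative d) (at r within {a..b}) \<and> \<beta> \<le> w \<bullet> d)"
        using deriv by eventually_elim (use w(2) in force)
    qed
    then have "(t - s) * \<beta> \<le> (t - s) * (w \<bullet> z)" unfolding z by (simp add: mult.commute)
    then show False using w(1) \<open>s < t\<close> by simp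
  qed
  then show ?thesis using z by blast
qed

lemma abs_continuous_on_imp_continuous_on:
  fixes x :: "real \<Rightarrow> 'a::euclidean_space"
  assumes "abs_continuous_on a b x"
  shows "continuous_on {a..b} x"
proof -
  have key: "\<exists>d>0. \<forall>s\<in>{a..b}. \<forall>t\<in>{a..b}. s \<le> t \<and> t - s < d \<longrightarrow> dist (x t) (x s) < e" if "e > 0" for e
  proof -
    obtain d where "d > 0" and d: "\<And>\<D>. \<D> division_of \<Union>\<D> \<Longrightarrow> \<Union>\<D> \<subseteq> {a..b} \<Longrightarrow>
        (\<Sum>I\<in>\<D>. Sup I - Inf I) < d \<Longrightarrow> (\<Sum>I\<in>\<D>. norm (x (Sup I) - x (Inf I))) < e"
      using assms \<open>e > 0\<close> unfolding abs_continuous_on_def by meson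
    have "dist (x t) (x s) < e" if "s \<in> {a..b}" "t \<in> {a..b}" "s \<le> t" "t - s < d" for s t
    proof -
      have "{{s..t}} division_of \<Union>{{s..t}}"
        using division_of_self[of s t] that by (simp add: cbox_interval)
      from d[OF this] show ?thesis using that by (simp add: dist_norm)
    qed
    then show ?thesis using \<open>d > 0\<close> by blast
  qed
  show ?thesis
    unfolding continuous_on_iff
  proof (intro ballI allI impI)
    fix s e :: real assume s: "s \<in> {a..b}" and "e > 0"
    from key[OF \<open>e > 0\<close>] obtain d where d: "d > 0"
      "\<And>s t. s \<in> {a..b} \<Longrightarrow> t \<in> {a..b} \<Longrightarrow> s \<le> t \<Longrightarrow> t - s < d \<Longrightarrow> dist (x t) (x s) < e"
      by blast
    have "dist (x t) (x s) < e" if "t \<in> {a..b}" "dist t s < d" for t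
      using d(2)[of s t] d(2)[of t s] s that by (cases "s \<le> t") (auto simp: dist_real_def dist_commute)
    then show "\<exists>d>0. \<forall>t\<in>{a..b}. dist t s < d \<longrightarrow> dist (x t) (x s) < e"
      using d(1) by blast
  qed
qed

lemma lipschitz_on_imp_abs_continuous_on:
  fixes x :: "real \<Rightarrow> 'a::euclidean_space"
  assumes "M-lipschitz_on {a..b} x"
  shows "abs_continuous_on a b x"
  unfolding abs_continuous_on_def
proof (intro allI impI)
  fix e :: real assume "e > 0"
  have M: "M \<ge> 0" using assms lipschitz_on_nonneg by blast
  define d where "d = e / (M + 1)"
  have "(\<Sum>I\<in>\<D>. norm (x (Sup I) - x (Inf I))) < e"
    if \<D>: "\<D> division_of \<Union>\<D>" "\<Union>\<D> \<subseteq> {a..b}" "(\<Sum>I\<in>\<D>. Sup I - Inf I) < d" for \<D>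
  proof -
    have el: "0 \<le> Sup I - Inf I \<and> norm (x (Sup I) - x (Inf I)) \<le> M * (Sup I - Inf I)" if "I \<in> \<D>" for I
    proof -
      from division_ofD(3,4)[OF \<D>(1) that] obtain u v where I: "I = {u..v}" "u \<le> v"
        by (metis atLeastatMost_empty_iff box_real(2))
      moreover have "I \<subseteq> {a..b}" using \<D>(2) that by blast
      then have "u \<in> {a..b}" "v \<in> {a..b}" using I by auto
      ultimately show ?thesis using lipschitz_onD[OF assms, of v u] by (auto simp: dist_norm)
    qed
    have "(\<Sum>I\<in>\<D>. norm (x (Sup I) - x (Inf I))) \<le> (\<Sum>I\<in>\<D>. M * (Sup I - Inf I))"
      using el by (intro sum_mono) blast
    also have "\<dots> = M * (\<Sum>I\<in>\<D>. Sup I - Inf I)" by (simp add: sum_distrib_left)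
    also have "\<dots> \<le> M * d" using \<D>(3) M by (intro mult_left_mono) auto
    also have "\<dots> < (M + 1) * d" using \<open>e > 0\<close> M by (simp add: d_def field_simps add_pos_nonneg)
    also have "\<dots> = e" using M by (simp add: d_def)
    finally show ?thesis .
  qed
  moreover have "d > 0" using \<open>e > 0\<close> M by (simp add: d_def)
  ultimately show "\<exists>d>0. \<forall>\<D>. \<D> division_of \<Union> \<D> \<and> \<Union> \<D> \<subseteq> {a..b} \<and> (\<Sum>I\<in>\<D>. Sup I - Inf I) < d \<longrightarrow>
      (\<Sum>I\<in>\<D>. norm (x (Sup I) - x (Inf I))) < e" by blast
qed

section \<open>The smooth case\<close>

text \<open>Finitely many of the local balls cover K, and the least range of \<epsilon> and the
  largest constant then serve all of K. The inserted 1 covers an empty K and makes the constant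
  positive.\<close>

lemma compact_uniform_linear_bound:
  fixes K :: "'a::metric_space set" and G :: "'a \<Rightarrow> real \<Rightarrow> 't \<Rightarrow> real"
  assumes "compact K"
    and loc: "\<And>x. x \<in> K \<Longrightarrow> \<exists>r>0. \<exists>e>0. \<exists>C. \<forall>y\<in>K. dist x y < r \<longrightarrow>
      (\<forall>\<epsilon>. 0 < \<epsilon> \<and> \<epsilon> \<le> e \<longrightarrow> (\<forall>t\<in>S. G y \<epsilon> t \<le> C * \<epsilon>))"
  shows "\<exists>e>0. \<exists>C>0. \<forall>y\<in>K. \<forall>\<epsilon>. 0 < \<epsilon> \<and> \<epsilon> \<le> e \<longrightarrow> (\<forall>t\<in>S. G y \<epsilon> t \<le> C * \<epsilon>)"
proof -
  from loc obtain r e C where *: "\<And>x. x \<in> K \<Longrightarrow> r x > 0" "\<And>x. x \<in> K \<Longrightarrow> e x > (0::real)"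
    "\<And>x y \<epsilon> t. x \<in> K \<Longrightarrow> y \<in> K \<Longrightarrow> dist x y < r x \<Longrightarrow> 0 < \<epsilon> \<Longrightarrow> \<epsilon> \<le> e x \<Longrightarrow> t \<in> S \<Longrightarrow> G y \<epsilon> t \<le> C x * \<epsilon>"
    by metis
  have "K \<subseteq> (\<Union>x\<in>K. ball x (r x))" using *(1) by force
  then obtain D where D: "D \<subseteq> K" "finite D" "K \<subseteq> (\<Union>x\<in>D. ball x (r x))"
    using compactE_image[OF \<open>compact K\<close>, of K "\<lambda>x. ball x (r x)"] by auto
  define e' where "e' = Min (insert 1 (e ` D))"
  define C' where "C' = Max (insert 1 (C ` D))"
  have e': "e' > 0" using D(1,2) *(2) by (auto simp: e'_def)
  have C': "C' > 0" using D(2) by (auto simp: C'_def Max_gr_iff)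
  have "G y \<epsilon> t \<le> C' * \<epsilon>" if "y \<in> K" "0 < \<epsilon>" "\<epsilon> \<le> e'" "t \<in> S" for y \<epsilon> t
  proof -
    obtain x where x: "x \<in> D" "dist x y < r x" using D(3) \<open>y \<in> K\<close> by (auto simp: mem_ball)
    have "e' \<le> e x" using x(1) D(2) by (auto simp: e'_def)
    then have "G y \<epsilon> t \<le> C x * \<epsilon>" using that x D(1) by (intro *(3)[of x y]) auto
    also have "\<dots> \<le> C' * \<epsilon>" using x(1) D(2) \<open>0 < \<epsilon>\<close> by (intro mult_right_mono) (auto simp: C'_def)
    finally show ?thesis .
  qed
  then show ?thesis using e' C' by blast
qed

lemma caratheodory_solution_deriv_AE:
  assumes "caratheodory_solution U v T x0 x" "0 \<le> s" "t \<le> T"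
    and "\<And>r. s < r \<Longrightarrow> r < t \<Longrightarrow> v (x r) \<in> Q"
  shows "AE r in lebesgue. s < r \<and> r < t \<longrightarrow> (\<exists>d\<in>Q. (x has_vector_derivative d) (at r within {0..T}))"
proof -
  have "AE r in lebesgue. r \<in> {0..T} \<longrightarrow> (x has_vector_derivative v (x r)) (at r within {0..T})"
    using assms(1) by (simp add: caratheodory_solution_def)
  then show ?thesis by eventually_elim (use assms(2-4) in auto)
qed

lemma caratheodory_solution_increment:
  fixes v :: "'a::euclidean_space \<Rightarrow> 'a"
  assumes "caratheodory_solution U v T x0 x" "0 \<le> s" "s \<le> t" "t \<le> T" "convex Q" "closed Q" "Q \<noteq> {}"
    and "\<And>r. s < r \<Longrightarrow> r < t \<Longrightarrow> v (x r) \<in> Q"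
  shows "\<exists>q\<in>Q. x t - x s = (t - s) *\<^sub>R q"
proof (cases "s = t")
  case False
  then show ?thesis using assms
    by (intro abs_continuous_on_increment[where a=0 and b=T] caratheodory_solution_deriv_AE[OF assms(1)])
       (auto simp: caratheodory_solution_def)
qed (use assms(7) in auto)

section \<open>Discrete Gronwall estimates for Lipschitz fields\<close>

text \<open>The initial points may differ, so that the bound also serves to compare two exact
  solutions. The field is Lipschitz only within \<rho> of the solution; \<open>small\<close> keeps
  the iterates there, by the same induction that proves the bound.\<close>

lemma euler_iterate_error:
  fixes v :: "'a::euclidean_space \<Rightarrow> 'a"
  assumes x: "caratheodory_solution U v T x0 x"
    and lip: "\<And>t y. t \<in> {0..T} \<Longrightarrow> norm (y - x t) < \<rho> \<Longrightarrow> norm (v y - v (x t)) \<le> L * norm (y - x t)"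
    and bd: "\<And>t. t \<in> {0..T} \<Longrightarrow> norm (v (x t)) \<le> M"
    and LM: "0 \<le> L" "0 \<le> M" and "0 < \<epsilon>" "M * \<epsilon> < \<rho>"
    and small: "exp (L * T) * (norm (z0 - x0) + L * M * T * \<epsilon>) < \<rho>"
    and kT: "real k * \<epsilon> \<le> T"
  shows "norm (euler_iterate v \<epsilon> z0 k - x (real k * \<epsilon>)) \<le> exp (L * T) * (norm (z0 - x0) + L * M * T * \<epsilon>)"
proof -
  \<comment> \<open>One step multiplies the error by 1 + L \<epsilon> and adds a local error of
    \<open>L * M * \<epsilon>\<^sup>2\<close>; each local error is charged the full growth
    factor.\<close>
  define B where "B k = (1 + L * \<epsilon>) ^ k * (norm (z0 - x0) + real k * (L * M * \<epsilon>\<^sup>2))" for k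
  have B: "B k \<le> exp (L * T) * (norm (z0 - x0) + L * M * T * \<epsilon>)" if "real k * \<epsilon> \<le> T" for k
  proof -
    have "(1 + L * \<epsilon>) ^ k \<le> exp (L * \<epsilon>) ^ k"
      using LM \<open>0 < \<epsilon>\<close> by (intro power_mono) (auto simp: exp_ge_add_one_self)
    also have "\<dots> = exp (L * (real k * \<epsilon>))" by (simp add: exp_of_nat_mult[symmetric] mult_ac)
    also have "\<dots> \<le> exp (L * T)" using that LM by (simp add: mult_left_mono)
    finally have 1: "(1 + L * \<epsilon>) ^ k \<le> exp (L * T)" .
    have "real k * (L * M * \<epsilon>\<^sup>2) = (L * M * \<epsilon>) * (real k * \<epsilon>)" by (simp add: power2_eq_square)
    also have "\<dots> \<le> (L * M * \<epsilon>) * T" using that LM \<open>0 < \<epsilon>\<close> by (intro mult_left_mono) auto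
    finally have 2: "real k * (L * M * \<epsilon>\<^sup>2) \<le> L * M * T * \<epsilon>" by (simp add: mult_ac)
    show ?thesis unfolding B_def using 1 2 LM \<open>0 < \<epsilon>\<close>
      by (intro mult_mono) auto
  qed
  have "real k * \<epsilon> \<le> T \<Longrightarrow> norm (euler_iterate v \<epsilon> z0 k - x (real k * \<epsilon>)) \<le> B k"
  proof (induction k)
    case 0
    then show ?case using x by (simp add: B_def caratheodory_solution_def)
  next
    case (Suc k)
    let ?s = "real k * \<epsilon>" and ?t = "real (Suc k) * \<epsilon>" and ?z = "euler_iterate v \<epsilon> z0 k"
    have st: "0 \<le> ?s" "?s \<le> ?t" "?t \<le> T" "?t - ?s = \<epsilon>"
      using Suc.prems \<open>0 < \<epsilon>\<close> by (auto simp: algebra_simps)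
    have IH: "norm (?z - x ?s) \<le> B k" using Suc.IH st by simp
    then have "norm (?z - x ?s) < \<rho>" using B[of k] small st by simp
    then have vz: "norm (v ?z - v (x ?s)) \<le> L * norm (?z - x ?s)" using st by (intro lip) auto
    \<comment> \<open>Within one step the solution moves at most M \<epsilon>, so its velocity, and
      with it the secant slope, stays within L M \<epsilon> of the velocity at the left grid
      point.\<close>
    have "\<exists>q\<in>cball (v (x ?s)) (L * (M * \<epsilon>)). x ?t - x ?s = (?t - ?s) *\<^sub>R q"
    proof (rule caratheodory_solution_increment[OF x st(1-3)])
      fix r assume r: "?s < r" "r < ?t"
      have "\<exists>q\<in>cball 0 M. x r - x ?s = (r - ?s) *\<^sub>R q"
      proof (rule caratheodory_solution_increment[OF x st(1)])
        show "v (x r') \<in> cball 0 M" if "?s < r'" "r' < r" for r'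
          using bd[of r'] that st r by simp
      qed (use st r LM in auto)
      then obtain q where q: "norm q \<le> M" "x r - x ?s = (r - ?s) *\<^sub>R q" by auto
      have "norm (x r - x ?s) = (r - ?s) * norm q" using q(2) r by simp
      also have "\<dots> \<le> \<epsilon> * M" using q(1) r st(4) LM \<open>0 < \<epsilon>\<close> by (intro mult_mono) auto
      finally have *: "norm (x r - x ?s) \<le> M * \<epsilon>" by (simp add: mult.commute)
      then have "norm (v (x r) - v (x ?s)) \<le> L * norm (x r - x ?s)"
        using \<open>M * \<epsilon> < \<rho>\<close> st by (intro lip) auto
      also have "\<dots> \<le> L * (M * \<epsilon>)" using * LM by (intro mult_left_mono) auto
      finally show "v (x r) \<in> cball (v (x ?s)) (L * (M * \<epsilon>))" by (simp add: dist_norm norm_minus_commute)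
    next
      have "0 \<le> L * (M * \<epsilon>)" using LM \<open>0 < \<epsilon>\<close> by simp
      then show "cball (v (x ?s)) (L * (M * \<epsilon>)) \<noteq> {}" by simp
    qed auto
    then obtain q where q: "norm (v (x ?s) - q) \<le> L * (M * \<epsilon>)" "x ?t - x ?s = \<epsilon> *\<^sub>R q"
      unfolding st(4) by (auto simp: dist_norm)
    have "euler_iterate v \<epsilon> z0 (Suc k) - x ?t
        = (?z - x ?s) + \<epsilon> *\<^sub>R ((v ?z - v (x ?s)) + (v (x ?s) - q))"
      using q(2) by (simp add: algebra_simps)
    then have "norm (euler_iterate v \<epsilon> z0 (Suc k) - x ?t)
        \<le> norm (?z - x ?s) + norm (\<epsilon> *\<^sub>R ((v ?z - v (x ?s)) + (v (x ?s) - q)))"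
      by (simp only: norm_triangle_ineq)
    also have "norm (\<epsilon> *\<^sub>R ((v ?z - v (x ?s)) + (v (x ?s) - q))) \<le> \<epsilon> * (L * norm (?z - x ?s) + L * (M * \<epsilon>))"
      using vz q(1) \<open>0 < \<epsilon>\<close> norm_triangle_ineq[of "v ?z - v (x ?s)" "v (x ?s) - q"] by simp
    also have "norm (?z - x ?s) + \<epsilon> * (L * norm (?z - x ?s) + L * (M * \<epsilon>))
        = (1 + L * \<epsilon>) * norm (?z - x ?s) + L * M * \<epsilon>\<^sup>2"
      by (simp add: algebra_simps power2_eq_square)
    also have "\<dots> \<le> (1 + L * \<epsilon>) * B k + L * M * \<epsilon>\<^sup>2"
      using IH LM \<open>0 < \<epsilon>\<close> by (intro add_right_mono mult_left_mono) auto
    also have "\<dots> \<le> (1 + L * \<epsilon>) * B k + (1 + L * \<epsilon>) ^ Suc k * (L * M * \<epsilon>\<^sup>2)"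
    proof -
      have "1 * (L * M * \<epsilon>\<^sup>2) \<le> (1 + L * \<epsilon>) ^ Suc k * (L * M * \<epsilon>\<^sup>2)"
        using LM \<open>0 < \<epsilon>\<close> by (intro mult_right_mono one_le_power) auto
      then show ?thesis by simp
    qed
    also have "\<dots> = B (Suc k)" by (simp add: B_def algebra_simps)
    finally show ?case by simp
  qed
  then show ?thesis using B[OF kT] kT by simp
qed

text \<open>To the error at the last grid point before t are added at most \<epsilon> M for the
  solution and \<epsilon> (M + L \<rho>) for the polygon, whose velocity there differs from that of
  the solution by at most L \<rho>.\<close>

lemma euler_interp_error:
  fixes v :: "'a::euclidean_space \<Rightarrow> 'a"
  assumes x: "caratheodory_solution U v T x0 x"
    and lip: "\<And>t y. t \<in> {0..T} \<Longrightarrow> norm (y - x t) < \<rho> \<Longrightarrow> norm (v y - v (x t)) \<le> L * norm (y - x t)"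
    and bd: "\<And>t. t \<in> {0..T} \<Longrightarrow> norm (v (x t)) \<le> M"
    and LM: "0 \<le> L" "0 \<le> M" and "0 < \<epsilon>" "M * \<epsilon> < \<rho>"
    and small: "exp (L * T) * (norm (z0 - x0) + L * M * T * \<epsilon>) < \<rho>"
    and t: "t \<in> {0..T}"
  shows "norm (euler_interp v \<epsilon> z0 t - x t)
    \<le> exp (L * T) * (norm (z0 - x0) + L * M * T * \<epsilon>) + (2 * M + L * \<rho>) * \<epsilon>"
proof -
  define k where "k = nat \<lfloor>t / \<epsilon>\<rfloor>"
  let ?z = "euler_iterate v \<epsilon> z0 k" and ?s = "real k * \<epsilon>" and ?E = "exp (L * T) * (norm (z0 - x0) + L * M * T * \<epsilon>)"
  have k: "real k \<le> t / \<epsilon>" "t / \<epsilon> < real k + 1"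
    using t \<open>0 < \<epsilon>\<close> unfolding k_def by (auto simp: of_nat_nat zero_le_floor)
  then have s: "?s \<le> t" "t - ?s \<le> \<epsilon>" "0 \<le> ?s"
    using \<open>0 < \<epsilon>\<close> by (auto simp: field_simps)
  have err: "norm (?z - x ?s) \<le> ?E"
    using euler_iterate_error[OF x lip bd LM \<open>0 < \<epsilon>\<close> \<open>M * \<epsilon> < \<rho>\<close> small, of k] s t by auto
  then have "norm (v ?z - v (x ?s)) \<le> L * norm (?z - x ?s)" using small s t by (intro lip) auto
  also have "\<dots> \<le> L * \<rho>" using err small LM by (intro mult_left_mono) auto
  finally have vz: "norm (v ?z) \<le> M + L * \<rho>"
    using bd[of ?s] s t norm_triangle_sub[of "v ?z" "v (x ?s)"] by auto
  have "\<exists>q\<in>cball 0 M. x t - x ?s = (t - ?s) *\<^sub>R q"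
  proof (rule caratheodory_solution_increment[OF x s(3,1)])
    show "v (x r) \<in> cball 0 M" if "?s < r" "r < t" for r
      using bd[of r] that s t by simp
  qed (use t LM in auto)
  then obtain q where q: "norm q \<le> M" "x t - x ?s = (t - ?s) *\<^sub>R q" by auto
  have xt: "norm (x t - x ?s) \<le> \<epsilon> * M" using q s LM \<open>0 < \<epsilon>\<close> by (auto intro!: mult_mono)
  have y: "euler_interp v \<epsilon> z0 t = ?z + ((t / \<epsilon> - real k) * \<epsilon>) *\<^sub>R v ?z"
    by (simp add: euler_interp_def k_def[symmetric] Let_def)
  have "\<bar>(t / \<epsilon> - real k) * \<epsilon>\<bar> \<le> 1 * \<epsilon>" unfolding abs_mult
    using k \<open>0 < \<epsilon>\<close> by (intro mult_mono) auto
  then have "norm (((t / \<epsilon> - real k) * \<epsilon>) *\<^sub>R v ?z) \<le> \<epsilon> * (M + L * \<rho>)"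
    using vz \<open>0 < \<epsilon>\<close> by (auto intro!: mult_mono)
  moreover have "euler_interp v \<epsilon> z0 t - x t = (?z - x ?s) + ((t / \<epsilon> - real k) * \<epsilon>) *\<^sub>R v ?z - (x t - x ?s)"
    using y by simp
  ultimately have "norm (euler_interp v \<epsilon> z0 t - x t) \<le> ?E + \<epsilon> * (M + L * \<rho>) + \<epsilon> * M"
    using err xt norm_triangle_ineq[of "?z - x ?s" "((t / \<epsilon> - real k) * \<epsilon>) *\<^sub>R v ?z"]
      norm_triangle_ineq4[of "(?z - x ?s) + ((t / \<epsilon> - real k) * \<epsilon>) *\<^sub>R v ?z" "x t - x ?s"]
    by (simp only:)
  then show ?thesis by (simp add: algebra_simps)
qed

text \<open>Stated at every y of the tube and not on \<Gamma> alone, so that the same constants hold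
  along other solutions in the tube. The mean value bound needs a convex set: y is within e/4 of g
  and y' within e/4 of y, so both lie in \<open>cball g (e/2)\<close>.\<close>

lemma C1_on_compact_tube:
  fixes v :: "'a::euclidean_space \<Rightarrow> 'a"
  assumes "C1_on v U" "open U" "compact \<Gamma>" "\<Gamma> \<subseteq> U"
  shows "\<exists>\<rho>>0. \<exists>L\<ge>0. \<exists>M\<ge>0. \<forall>g\<in>\<Gamma>. \<forall>y. norm (y - g) \<le> \<rho> \<longrightarrow> norm (v y) \<le> M \<and>
    (\<forall>y'. norm (y' - y) < \<rho> \<longrightarrow> norm (v y' - v y) \<le> L * norm (y' - y))"
proof -
  obtain v' where v': "\<And>x. x \<in> U \<Longrightarrow> (v has_derivative blinfun_apply (v' x)) (at x)" "continuous_on U v'"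
    using assms(1) unfolding C1_on_def by blast
  obtain e where e: "e > 0" "(\<Union>x\<in>\<Gamma>. ball x e) \<subseteq> U"
    using compact_subset_open_imp_ball_epsilon_subset[OF assms(3,2,4)] by blast
  define N where "N = (\<Union>x\<in>\<Gamma>. cball x (e/2))"
  have N: "compact N" unfolding N_def by (rule compact_minkowski_sum_cball[OF assms(3)])
  have "N \<subseteq> U"
  proof
    fix y assume "y \<in> N"
    then obtain x where "x \<in> \<Gamma>" "dist x y \<le> e / 2" by (auto simp: N_def)
    then have "y \<in> ball x e" using e(1) by simp
    then show "y \<in> U" using \<open>x \<in> \<Gamma>\<close> e(2) by blast
  qed
  have "continuous_on U v"
    using v'(1) has_derivative_continuous by (metis continuous_at_imp_continuous_on)
  then have "bounded (v ` N)" "bounded (v' ` N)"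
    using N \<open>N \<subseteq> U\<close> v'(2) by (auto intro!: compact_imp_bounded compact_continuous_image intro: continuous_on_subset)
  then obtain M L where M: "\<And>y. y \<in> N \<Longrightarrow> norm (v y) \<le> M" "M > 0" and L: "\<And>y. y \<in> N \<Longrightarrow> norm (v' y) \<le> L" "L > 0"
    unfolding bounded_pos by auto
  have "norm (v y) \<le> M \<and> (\<forall>y'. norm (y' - y) < e/4 \<longrightarrow> norm (v y' - v y) \<le> L * norm (y' - y))"
    if "g \<in> \<Gamma>" "norm (y - g) \<le> e/4" for g y
  proof (intro conjI allI impI)
    have sub: "cball g (e/2) \<subseteq> N" using \<open>g \<in> \<Gamma>\<close> by (auto simp: N_def)
    have y: "y \<in> cball g (e/2)" using that e(1) by (simp add: dist_norm norm_minus_commute)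
    then show "norm (v y) \<le> M" using M sub by blast
    fix y' assume "norm (y' - y) < e/4"
    then have y': "y' \<in> cball g (e/2)" using that norm_triangle_ineq[of "y' - y" "y - g"] e(1)
      by (simp add: dist_norm norm_minus_commute)
    show "norm (v y' - v y) \<le> L * norm (y' - y)"
    proof (rule differentiable_bound[of "cball g (e/2)"])
      fix x assume "x \<in> cball g (e/2)"
      then have "x \<in> N" using sub by blast
      then show "(v has_derivative blinfun_apply (v' x)) (at x within cball g (e/2))"
        using v'(1) \<open>N \<subseteq> U\<close> has_derivative_at_withinI by blast
      show "onorm (blinfun_apply (v' x)) \<le> L" using L(1)[OF \<open>x \<in> N\<close>] by (simp add: norm_blinfun.rep_eq)
    qed (use y y' in auto)
  qed
  then show ?thesis using e(1) M(2) L(2)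
    by (intro exI[of _ "e/4"] conjI exI[of _ L] exI[of _ M]) auto
qed

lemma C1_on_imp_continuous_on: "C1_on f U \<Longrightarrow> continuous_on U f"
  unfolding C1_on_def by (metis continuous_at_imp_continuous_on has_derivative_continuous)

lemma C1_on_rrr_field:
  assumes A: "C1_on pA U" and B: "C1_on pB V" and sub: "reflector pA ` U \<subseteq> V"
  shows "C1_on (rrr_field pA pB) U"
proof -
  obtain A' where A': "\<And>x. x \<in> U \<Longrightarrow> (pA has_derivative blinfun_apply (A' x)) (at x)" "continuous_on U A'"
    using A unfolding C1_on_def by blast
  obtain B' where B': "\<And>x. x \<in> V \<Longrightarrow> (pB has_derivative blinfun_apply (B' x)) (at x)" "continuous_on V B'"
    using B unfolding C1_on_def by blast
  define R' where "R' x = 2 *\<^sub>R A' x - id_blinfun" for x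
  have R: "(reflector pA has_derivative blinfun_apply (R' x)) (at x)" if "x \<in> U" for x
    unfolding reflector_def[abs_def] R'_def
    by (auto intro!: derivative_eq_intros A'(1)[OF that] simp: blinfun.bilinear_simps fun_eq_iff)
  define v' where "v' x = (B' (reflector pA x) o\<^sub>L R' x) - A' x" for x
  have "(rrr_field pA pB has_derivative blinfun_apply (v' x)) (at x)" if "x \<in> U" for x
  proof -
    have "reflector pA x \<in> V" using that sub by blast
    then have "(pB \<circ> reflector pA has_derivative blinfun_apply (B' (reflector pA x)) \<circ> blinfun_apply (R' x)) (at x)"
      by (intro diff_chain_at R that B'(1))
    then have "((\<lambda>x. (pB \<circ> reflector pA) x - pA x) has_derivative
        (\<lambda>h. (blinfun_apply (B' (reflector pA x)) \<circ> blinfun_apply (R' x)) h - blinfun_apply (A' x) h)) (at x)"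
      by (intro has_derivative_diff A'(1)[OF that])
    then show ?thesis by (simp add: rrr_field_def[abs_def] v'_def blinfun.bilinear_simps[abs_def] o_def
      minus_blinfun.rep_eq blinfun_compose.rep_eq)
  qed
  moreover have "continuous_on U v'"
  proof -
    have "continuous_on U (reflector pA)"
      unfolding reflector_def[abs_def] by (intro continuous_intros C1_on_imp_continuous_on[OF A])
    then have "continuous_on U (\<lambda>x. B' (reflector pA x))"
      using continuous_on_compose2[OF B'(2)] sub by blast
    moreover have "continuous_on U R'" unfolding R'_def[abs_def] by (intro continuous_intros A'(2))
    ultimately show ?thesis unfolding v'_def[abs_def]
      by (intro continuous_intros A'(2) bounded_bilinear.continuous_on[OF bounded_bilinear_blinfun_compose])
  qed
  ultimately show ?thesis unfolding C1_on_def by blast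
qed

lemma caratheodory_solution_compact_image:
  assumes "caratheodory_solution U v T x0 x"
  shows "compact (x ` {0..T})" "x ` {0..T} \<subseteq> U"
  using assms abs_continuous_on_imp_continuous_on
  by (auto simp: caratheodory_solution_def intro!: compact_continuous_image)

text \<open>The Euler polygons starting at \<open>y0\<close> approach both solutions, up to the distance of the initial
  points for the second one. This replaces Gronwall's inequality in continuous time.\<close>

lemma caratheodory_solutions_close:
  fixes v :: "'a::euclidean_space \<Rightarrow> 'a"
  assumes C1: "C1_on v U" "open U" and y: "caratheodory_solution U v T y0 y"
    and x: "caratheodory_solution U v T x0 x"
    and lip: "\<And>t y. t \<in> {0..T} \<Longrightarrow> norm (y - x t) < \<rho> \<Longrightarrow> norm (v y - v (x t)) \<le> L * norm (y - x t)"
    and bd: "\<And>t. t \<in> {0..T} \<Longrightarrow> norm (v (x t)) \<le> M"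
    and LM: "0 \<le> L" "0 \<le> M" and small: "exp (L * T) * norm (y0 - x0) < \<rho>"
    and t: "t \<in> {0..T}"
  shows "norm (y t - x t) \<le> exp (L * T) * norm (y0 - x0)"
proof (cases "t = 0")
  case True
  have "0 \<le> L * T" using LM t by auto
  then have "1 * norm (y0 - x0) \<le> exp (L * T) * norm (y0 - x0)"
    by (intro mult_right_mono) auto
  then show ?thesis using True x y by (simp add: caratheodory_solution_def)
next
  case False
  then have "t > 0" using t by simp
  have T: "0 \<le> T" using t by simp
  obtain \<rho>' L' M' where c': "\<rho>' > 0" "L' \<ge> 0" "M' \<ge> 0" and
    c: "\<And>t z. t \<in> {0..T} \<Longrightarrow> norm (z - y t) \<le> \<rho>' \<Longrightarrow> norm (v z) \<le> M' \<and>
      (\<forall>z'. norm (z' - z) < \<rho>' \<longrightarrow> norm (v z' - v z) \<le> L' * norm (z' - z))"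
    using C1_on_compact_tube[OF C1 caratheodory_solution_compact_image[OF y]] by auto
  have bd': "norm (v (y t)) \<le> M'" if "t \<in> {0..T}" for t using c[OF that, of "y t"] c' by simp
  have lip': "norm (v z - v (y t)) \<le> L' * norm (z - y t)" if "t \<in> {0..T}" "norm (z - y t) < \<rho>'" for t z
    using c[OF that(1), of "y t"] c' that(2) by simp
  \<comment> \<open>With these step sizes t is itself a grid point, the one of index n + 1.\<close>
  define \<epsilon> where "\<epsilon> n = t / real (Suc n)" for n
  have \<epsilon>: "\<epsilon> n > 0" "real (Suc n) * \<epsilon> n = t" for n using \<open>t > 0\<close> by (auto simp: \<epsilon>_def)
  have lim: "\<epsilon> \<longlonglongrightarrow> 0" unfolding \<epsilon>_def by (rule LIMSEQ_Suc[OF lim_const_over_n])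
  define E where "E n = exp (L * T) * (norm (y0 - x0) + L * M * T * \<epsilon> n)" for n
  \<comment> \<open>Relative to y the polygon starts without error, so this bound tends to
    0.\<close>
  define E' where "E' n = exp (L' * T) * (norm (y0 - y0) + L' * M' * T * \<epsilon> n)" for n
  have limE: "E \<longlonglongrightarrow> exp (L * T) * (norm (y0 - x0) + L * M * T * 0)" unfolding E_def by (intro tendsto_intros lim)
  have limE': "E' \<longlonglongrightarrow> exp (L' * T) * (norm (y0 - y0) + L' * M' * T * 0)" unfolding E'_def by (intro tendsto_intros lim)
  have limM: "(\<lambda>n. M * \<epsilon> n) \<longlonglongrightarrow> M * 0" "(\<lambda>n. M' * \<epsilon> n) \<longlonglongrightarrow> M' * 0" by (intro tendsto_intros lim)+
  have "\<rho> > 0" using small by (meson exp_ge_zero le_less_trans mult_nonneg_nonneg norm_ge_zero)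
  have "eventually (\<lambda>n. E n < \<rho>) sequentially" "eventually (\<lambda>n. E' n < \<rho>') sequentially"
    "eventually (\<lambda>n. M * \<epsilon> n < \<rho>) sequentially" "eventually (\<lambda>n. M' * \<epsilon> n < \<rho>') sequentially"
    using order_tendstoD(2)[OF limE, of \<rho>] order_tendstoD(2)[OF limE', of \<rho>'] order_tendstoD(2)[OF limM(1), of \<rho>]
      order_tendstoD(2)[OF limM(2), of \<rho>'] small c' \<open>\<rho> > 0\<close> by auto
  then have "eventually (\<lambda>n. norm (y t - x t) \<le> E n + E' n) sequentially"
  proof eventually_elim
    case (elim n)
    have kT: "real (Suc n) * \<epsilon> n \<le> T" using \<epsilon>(2)[of n] t by (simp only: atLeastAtMost_iff)
    have "norm (euler_iterate v (\<epsilon> n) y0 (Suc n) - x (real (Suc n) * \<epsilon> n)) \<le> E n"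
      unfolding E_def
      by (rule euler_iterate_error[OF x _ _ LM \<epsilon>(1) _ _ kT, where \<rho> = \<rho>])
        (use lip bd elim in \<open>auto simp: E_def\<close>)
    moreover have "norm (euler_iterate v (\<epsilon> n) y0 (Suc n) - y (real (Suc n) * \<epsilon> n)) \<le> E' n"
      unfolding E'_def
      by (rule euler_iterate_error[OF y _ _ c'(2,3) \<epsilon>(1) _ _ kT, where \<rho> = \<rho>'])
        (use lip' bd' elim in \<open>auto simp: E'_def\<close>)
    moreover have "y t - x t = (euler_iterate v (\<epsilon> n) y0 (Suc n) - x t) - (euler_iterate v (\<epsilon> n) y0 (Suc n) - y t)"
      by simp
    ultimately show ?case unfolding \<epsilon>(2) by (metis add_mono norm_triangle_ineq4 order_trans)
  qed
  moreover have "(\<lambda>n. E n + E' n) \<longlonglongrightarrow> exp (L * T) * norm (y0 - x0)"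
    using tendsto_add[OF limE limE'] by simp
  ultimately show ?thesis
    by (intro tendsto_lowerbound[of "\<lambda>n. E n + E' n" _ sequentially]) auto
qed

lemma euler_interp_linear_error_smooth:
  fixes v :: "'a::euclidean_space \<Rightarrow> 'a" and X :: "'a \<Rightarrow> real \<Rightarrow> 'a"
  assumes C1: "C1_on v U" "open U" and "compact K" and "T > 0"
    and X: "\<And>x0. x0 \<in> K \<Longrightarrow> caratheodory_solution U v T x0 (X x0)"
  shows "\<exists>\<epsilon>0>0. \<exists>C>0. \<forall>x0\<in>K. \<forall>\<epsilon>. 0 < \<epsilon> \<and> \<epsilon> \<le> \<epsilon>0 \<longrightarrow>
           (\<forall>t\<in>{0..T}. norm (euler_interp v \<epsilon> x0 t - X x0 t) \<le> C * \<epsilon>)"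
proof (rule compact_uniform_linear_bound[OF \<open>compact K\<close>])
  fix x0 assume "x0 \<in> K"
  note x = X[OF this]
  obtain \<rho> L M where LM: "L \<ge> 0" "M \<ge> 0" and "\<rho> > 0" and
    c: "\<And>t z. t \<in> {0..T} \<Longrightarrow> norm (z - X x0 t) \<le> \<rho> \<Longrightarrow> norm (v z) \<le> M \<and>
      (\<forall>z'. norm (z' - z) < \<rho> \<longrightarrow> norm (v z' - v z) \<le> L * norm (z' - z))"
    using C1_on_compact_tube[OF C1 caratheodory_solution_compact_image[OF x]] by auto
  \<comment> \<open>A gap grows by at most the factor exp (L T), so solutions from within r of x0
    stay in the \<rho>-tube, where the constants of x0 hold.\<close>
  define r where "r = \<rho> / exp (L * T)"
  \<comment> \<open>Q dominates both coefficients of \<epsilon> whose products with \<epsilon> must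
    stay below \<rho>; taking half of \<rho> / Q below makes the inequalities strict.\<close>
  define Q where "Q = M + exp (L * T) * (L * M * T) + 1"
  define e where "e = \<rho> / Q / 2"
  have Q: "Q > 0" using LM \<open>T > 0\<close> by (auto simp: Q_def intro!: add_nonneg_pos add_nonneg_nonneg)
  have "r > 0" "e > 0" using \<open>\<rho> > 0\<close> Q by (auto simp: r_def e_def)
  have "norm (euler_interp v \<epsilon> y t - X y t) \<le> (exp (L * T) * (L * M * T) + (2 * M + L * \<rho>)) * \<epsilon>"
    if y: "y \<in> K" "dist x0 y < r" and \<epsilon>: "0 < \<epsilon>" "\<epsilon> \<le> e" and t: "t \<in> {0..T}" for y \<epsilon> t
  proof -
    have *: "exp (L * T) * norm (y - x0) < \<rho>"
      using y(2) by (simp add: r_def dist_norm norm_minus_commute field_simps)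
    have near: "norm (X y t - X x0 t) \<le> \<rho>" if "t \<in> {0..T}" for t
    proof -
      have "norm (X y t - X x0 t) \<le> exp (L * T) * norm (y - x0)"
      proof (rule caratheodory_solutions_close[OF C1 X[OF y(1)] x _ _ LM * that])
        show "norm (v z - v (X x0 t)) \<le> L * norm (z - X x0 t)" if "t \<in> {0..T}" "norm (z - X x0 t) < \<rho>" for t z
          using c[OF that(1), of "X x0 t"] \<open>\<rho> > 0\<close> that(2) by simp
        show "norm (v (X x0 t)) \<le> M" if "t \<in> {0..T}" for t using c[OF that, of "X x0 t"] \<open>\<rho> > 0\<close> by simp
      qed
      then show ?thesis using * by simp
    qed
    have "\<epsilon> * Q \<le> e * Q" using \<epsilon> Q by (intro mult_right_mono) auto
    also have "\<dots> < \<rho>" using Q \<open>\<rho> > 0\<close> by (simp add: e_def)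
    finally have "\<epsilon> * Q < \<rho>" .
    moreover have "\<epsilon> * Q = M * \<epsilon> + exp (L * T) * (L * M * T * \<epsilon>) + \<epsilon>" by (simp add: Q_def algebra_simps)
    moreover have "0 \<le> M * \<epsilon>" "0 \<le> exp (L * T) * (L * M * T * \<epsilon>)" using LM \<epsilon> \<open>T > 0\<close> by auto
    ultimately have small: "M * \<epsilon> < \<rho>" "exp (L * T) * (norm (y - y) + L * M * T * \<epsilon>) < \<rho>"
      using \<epsilon>(1) unfolding diff_self norm_zero add_0_left by linarith+
    have "norm (euler_interp v \<epsilon> y t - X y t)
      \<le> exp (L * T) * (norm (y - y) + L * M * T * \<epsilon>) + (2 * M + L * \<rho>) * \<epsilon>"
    proof (rule euler_interp_error[OF X[OF y(1)] _ _ LM \<epsilon>(1) small t])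
      show "norm (v z - v (X y t)) \<le> L * norm (z - X y t)" if "t \<in> {0..T}" "norm (z - X y t) < \<rho>" for t z
        using c[OF that(1) near[OF that(1)]] that(2) by simp
      show "norm (v (X y t)) \<le> M" if "t \<in> {0..T}" for t using c[OF that near[OF that]] by simp
    qed
    then show ?thesis by (simp add: algebra_simps)
  qed
  then show "\<exists>r>0. \<exists>e>0. \<exists>C. \<forall>y\<in>K. dist x0 y < r \<longrightarrow> (\<forall>\<epsilon>. 0 < \<epsilon> \<and> \<epsilon> \<le> e \<longrightarrow>
      (\<forall>t\<in>{0..T}. norm (euler_interp v \<epsilon> y t - X y t) \<le> C * \<epsilon>))"
    using \<open>r > 0\<close> \<open>e > 0\<close> by blast
qed

section \<open>Curves of a field with two values\<close>

text \<open>A derivative-free form of the differential inclusion for a field equal to \<open>u\<close> below the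
  hyperplane \<open>n \<bullet> x = c\<close> and to \<open>w\<close> above it. It is also satisfied by Euler polygons, with \<open>\<eta>\<close>
  proportional to the step size.\<close>

definition switching_curve ::
    "'a::euclidean_space \<Rightarrow> real \<Rightarrow> 'a \<Rightarrow> 'a \<Rightarrow> real \<Rightarrow> real \<Rightarrow> real \<Rightarrow> (real \<Rightarrow> 'a) \<Rightarrow> bool" where
  "switching_curve n c u w \<eta> a b y \<longleftrightarrow> (\<forall>s t. a \<le> s \<and> s \<le> t \<and> t \<le> b \<longrightarrow>
     (\<exists>l\<in>{0..t - s}. y t - y s = l *\<^sub>R u + (t - s - l) *\<^sub>R w) \<and>
     ((\<forall>r. s < r \<and> r < t \<longrightarrow> n \<bullet> y r < c - \<eta>) \<longrightarrow> y t - y s = (t - s) *\<^sub>R u) \<and>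
     ((\<forall>r. s < r \<and> r < t \<longrightarrow> n \<bullet> y r > c + \<eta>) \<longrightarrow> y t - y s = (t - s) *\<^sub>R w))"

lemma switching_curveD:
  assumes "switching_curve n c u w \<eta> a b y" "a \<le> s" "s \<le> t" "t \<le> b"
  shows "\<exists>l\<in>{0..t - s}. y t - y s = l *\<^sub>R u + (t - s - l) *\<^sub>R w"
    and "(\<And>r. s < r \<Longrightarrow> r < t \<Longrightarrow> n \<bullet> y r < c - \<eta>) \<Longrightarrow> y t - y s = (t - s) *\<^sub>R u"
    and "(\<And>r. s < r \<Longrightarrow> r < t \<Longrightarrow> n \<bullet> y r > c + \<eta>) \<Longrightarrow> y t - y s = (t - s) *\<^sub>R w"
  using assms unfolding switching_curve_def by blast+

lemma switching_curve_mono: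
  assumes "switching_curve n c u w \<eta> a b y" "\<eta> \<le> \<eta>'"
  shows "switching_curve n c u w \<eta>' a b y"
  unfolding switching_curve_def
proof (intro allI impI, elim conjE, intro conjI impI)
  fix s t assume st: "a \<le> s" "s \<le> t" "t \<le> b"
  note D = switching_curveD[OF assms(1) st]
  show "\<exists>l\<in>{0..t - s}. y t - y s = l *\<^sub>R u + (t - s - l) *\<^sub>R w" by (rule D(1))
  show "y t - y s = (t - s) *\<^sub>R u" if "\<forall>r. s < r \<and> r < t \<longrightarrow> n \<bullet> y r < c - \<eta>'"
    using that assms(2) by (intro D(2)) force
  show "y t - y s = (t - s) *\<^sub>R w" if "\<forall>r. s < r \<and> r < t \<longrightarrow> n \<bullet> y r > c + \<eta>'"
    using that assms(2) by (intro D(3)) force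
qed

text \<open>Reversing the normal exchanges the two sides, so downward crossings and curves above the
  hyperplane reduce to their mirror images.\<close>

lemma switching_curve_flip:
  assumes "switching_curve n c u w \<eta> a b y"
  shows "switching_curve (- n) (- c) w u \<eta> a b y"
  unfolding switching_curve_def
proof (intro allI impI, elim conjE, intro conjI impI)
  fix s t assume st: "a \<le> s" "s \<le> t" "t \<le> b"
  note D = switching_curveD[OF assms(1) st]
  obtain l where "l \<in> {0..t - s}" "y t - y s = l *\<^sub>R u + (t - s - l) *\<^sub>R w" using D(1) by blast
  then show "\<exists>l\<in>{0..t - s}. y t - y s = l *\<^sub>R w + (t - s - l) *\<^sub>R u"
    by (intro bexI[of _ "t - s - l"]) (auto simp: algebra_simps)
  show "y t - y s = (t - s) *\<^sub>R w" if "\<forall>r. s < r \<and> r < t \<longrightarrow> - n \<bullet> y r < - c - \<eta>"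
    using that by (intro D(3)) force
  show "y t - y s = (t - s) *\<^sub>R u" if "\<forall>r. s < r \<and> r < t \<longrightarrow> - n \<bullet> y r > - c + \<eta>"
    using that by (intro D(2)) force
qed

lemma switching_curve_speed:
  assumes "switching_curve n c u w \<eta> a b y" "a \<le> s" "s \<le> t" "t \<le> b"
  shows "norm (y t - y s) \<le> (t - s) * (norm u + norm w)"
proof -
  obtain l where l: "l \<in> {0..t - s}" "y t - y s = l *\<^sub>R u + (t - s - l) *\<^sub>R w"
    using switching_curveD(1)[OF assms] by blast
  have "norm (y t - y s) \<le> norm (l *\<^sub>R u) + norm ((t - s - l) *\<^sub>R w)"
    unfolding l(2) by (rule norm_triangle_ineq)
  also have "\<dots> \<le> (t - s) * norm u + (t - s) * norm w"
    using l(1) by (intro add_mono) (auto intro!: mult_right_mono)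
  finally show ?thesis by (simp add: algebra_simps)
qed

lemma switching_curve_continuous_on:
  assumes "switching_curve n c u w \<eta> a b y"
  shows "continuous_on {a..b} y"
proof -
  have "(norm u + norm w)-lipschitz_on {a..b} y"
  proof (rule lipschitz_onI)
    fix s t assume st: "s \<in> {a..b}" "t \<in> {a..b}"
    show "dist (y s) (y t) \<le> (norm u + norm w) * dist s t"
    proof (cases "s \<le> t")
      case True
      then show ?thesis using switching_curve_speed[OF assms, of s t] st
        by (simp add: dist_norm norm_minus_commute mult.commute)
    next
      case False
      then show ?thesis using switching_curve_speed[OF assms, of t s] st
        by (simp add: dist_norm norm_minus_commute mult.commute)
    qed
  qed auto
  then show ?thesis by (rule lipschitz_on_continuous_on)
qed

section \<open>Stability of switching curves with respect to the initial point\<close>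

text \<open>For a level l between the bound and D t, consider the last time r before t with D at
  most l. Continuity gives D r = l > \<beta>, and the hypothesis keeps D at most l a little longer.
  The hypothesis compares with D r only, since a curve may switch its velocity arbitrarily
  often.\<close>

lemma barrier_principle:
  fixes D :: "real \<Rightarrow> real"
  assumes cont: "continuous_on {a..b} D" and t: "t \<in> {a..b}"
    and loc: "\<And>r. r \<in> {a..<b} \<Longrightarrow> D r > \<beta> \<Longrightarrow> \<exists>d>0. \<forall>r'\<in>{a..b}. r < r' \<and> r' < r + d \<longrightarrow> D r' \<le> D r"
  shows "D t \<le> max (D a) \<beta>"
proof (rule ccontr)
  assume "\<not> ?thesis"
  then obtain l where l: "max (D a) \<beta> < l" "l < D t" using dense[of "max (D a) \<beta>" "D t"] by force
  define S where "S = {r \<in> {a..t}. D r \<le> l}"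
  have ct: "continuous_on {a..t} D" using cont t by (auto intro: continuous_on_subset)
  have "closed S" unfolding S_def
    by (intro continuous_on_closed_Collect_le[OF ct] continuous_intros)
  then have S: "compact S"
    by (metis (no_types, lifting) S_def bounded_closed_interval bounded_subset compact_eq_bounded_closed mem_Collect_eq subsetI)
  have "a \<in> S" using l t by (auto simp: S_def)
  obtain r where r: "r \<in> S" "\<And>r'. r' \<in> S \<Longrightarrow> r' \<le> r"
    using compact_attains_sup[OF S] \<open>a \<in> S\<close> by blast
  have rt: "a \<le> r" "r < t" "D r \<le> l" using r(1) l by (auto simp: S_def less_le)
  have "D r = l"
  proof (rule ccontr)
    assume "D r \<noteq> l"
    then have "D r < l" using rt by simp
    moreover have "continuous_on {r..t} D" using ct rt by (auto intro: continuous_on_subset)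
    ultimately obtain q where "r \<le> q" "q \<le> t" "D q = l" using IVT'[of D r l t] rt l by auto
    then have "q \<in> S" using rt by (auto simp: S_def)
    then show False using r(2)[of q] \<open>r \<le> q\<close> \<open>D q = l\<close> \<open>D r < l\<close> by auto
  qed
  then obtain d where d: "d > 0" "\<And>r'. r' \<in> {a..b} \<Longrightarrow> r < r' \<Longrightarrow> r' < r + d \<Longrightarrow> D r' \<le> l"
    using loc[of r] rt t l by auto
  define r' where "r' = min t (r + d / 2)"
  have "r < r'" "r' \<le> t" "r' < r + d" using d(1) rt by (auto simp: r'_def)
  then have "r' \<in> S" using d(2)[of r'] rt t by (auto simp: S_def)
  then show False using r(2)[of r'] \<open>r < r'\<close> by simp
qed

text \<open>When the gap exceeds 2 \<eta>, either y is above the band, moving with the least normal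
  speed n \<bullet> w, or z is below it, moving with the greatest, n \<bullet> u. Either way the gap
  does not grow.\<close>

lemma switching_curves_contract:
  assumes y: "switching_curve n c u w \<eta> a b y" and z: "switching_curve n c u w \<eta> a b z"
    and uw: "n \<bullet> w \<le> n \<bullet> u" and t: "t \<in> {a..b}"
  shows "n \<bullet> y t - n \<bullet> z t \<le> max (n \<bullet> y a - n \<bullet> z a) (2 * \<eta>)"
proof (rule barrier_principle[where D = "\<lambda>t. n \<bullet> y t - n \<bullet> z t" and b = b, OF _ t])
  have cont: "continuous_on {a..b} (\<lambda>t. n \<bullet> y t)" "continuous_on {a..b} (\<lambda>t. n \<bullet> z t)"
    by (intro continuous_intros switching_curve_continuous_on[OF y] switching_curve_continuous_on[OF z])+
  then show "continuous_on {a..b} (\<lambda>t. n \<bullet> y t - n \<bullet> z t)" by (rule continuous_on_diff)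
  fix r assume r: "r \<in> {a..<b}" "n \<bullet> y r - n \<bullet> z r > 2 * \<eta>"
  have rng: "(t - s) * (n \<bullet> w) \<le> n \<bullet> (x t - x s) \<and> n \<bullet> (x t - x s) \<le> (t - s) * (n \<bullet> u)"
    if x: "switching_curve n c u w \<eta> a b x" "a \<le> s" "s \<le> t" "t \<le> b" for x s t
  proof -
    obtain l where l: "l \<in> {0..t - s}" "x t - x s = l *\<^sub>R u + (t - s - l) *\<^sub>R w"
      using switching_curveD(1)[OF x] by blast
    have "n \<bullet> (x t - x s) = l * (n \<bullet> u) + (t - s - l) * (n \<bullet> w)"
      by (simp add: l(2) inner_add_right)
    moreover have "l * (n \<bullet> w) \<le> l * (n \<bullet> u)" "(t - s - l) * (n \<bullet> w) \<le> (t - s - l) * (n \<bullet> u)"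
      using l(1) uw by (auto intro: mult_left_mono)
    ultimately show ?thesis by (simp add: algebra_simps)
  qed
  have persist: "\<exists>d>0. \<forall>r'\<in>{a..b}. r < r' \<and> r' < r + d \<longrightarrow> f r' > k"
    if f: "continuous_on {a..b} f" "f r > k" for f :: "real \<Rightarrow> real" and k
  proof -
    have "r \<in> {a..b}" "f r - k > 0" using r(1) f(2) by auto
    then obtain d where "d > 0" "\<forall>r'\<in>{a..b}. dist r' r < d \<longrightarrow> dist (f r') (f r) < f r - k"
      using f(1) unfolding continuous_on_iff by blast
    then show ?thesis by (intro exI[of _ d]) (auto simp: dist_real_def abs_less_iff)
  qed
  consider "n \<bullet> y r > c + \<eta>" | "n \<bullet> z r < c - \<eta>" using r(2) by linarith
  then show "\<exists>d>0. \<forall>r'\<in>{a..b}. r < r' \<and> r' < r + d \<longrightarrow> n \<bullet> y r' - n \<bullet> z r' \<le> n \<bullet> y r - n \<bullet> z r"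
  proof cases
    case 1
    from persist[OF cont(1) this] obtain d where d: "d > 0"
      "\<And>r'. r' \<in> {a..b} \<Longrightarrow> r < r' \<Longrightarrow> r' < r + d \<Longrightarrow> n \<bullet> y r' > c + \<eta>" by blast
    have "n \<bullet> y r' - n \<bullet> z r' \<le> n \<bullet> y r - n \<bullet> z r" if "r' \<in> {a..b}" "r < r'" "r' < r + d" for r'
    proof -
      have "y r' - y r = (r' - r) *\<^sub>R w"
        using that r(1) by (intro switching_curveD(3)[OF y] d(2)) auto
      then have "n \<bullet> (y r' - y r) = (r' - r) * (n \<bullet> w)" by simp
      moreover have "(r' - r) * (n \<bullet> w) \<le> n \<bullet> (z r' - z r)" using rng[OF z, of r r'] that r(1) by auto
      ultimately show ?thesis by (simp add: inner_diff_right)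
    qed
    then show ?thesis using d(1) by blast
  next
    case 2
    have "continuous_on {a..b} (\<lambda>t. - (n \<bullet> z t))" by (intro continuous_intros cont)
    from persist[OF this, of "- (c - \<eta>)"] 2 obtain d where d: "d > 0"
      "\<And>r'. r' \<in> {a..b} \<Longrightarrow> r < r' \<Longrightarrow> r' < r + d \<Longrightarrow> n \<bullet> z r' < c - \<eta>" by force
    have "n \<bullet> y r' - n \<bullet> z r' \<le> n \<bullet> y r - n \<bullet> z r" if "r' \<in> {a..b}" "r < r'" "r' < r + d" for r'
    proof -
      have "z r' - z r = (r' - r) *\<^sub>R u"
        using that r(1) by (intro switching_curveD(2)[OF z] d(2)) auto
      then have "n \<bullet> (z r' - z r) = (r' - r) * (n \<bullet> u)" by simp
      moreover have "n \<bullet> (y r' - y r) \<le> (r' - r) * (n \<bullet> u)" using rng[OF y, of r r'] that r(1) by auto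
      ultimately show ?thesis by (simp add: inner_diff_right)
    qed
    then show ?thesis using d(1) by blast
  qed
qed

text \<open>Over equal times the displacements differ by a multiple of u - w. This vector is
  transverse to the hyperplane, so control of the normal gap is control of the full gap.\<close>

lemma switching_stability_sliding:
  fixes n u w :: "'a::euclidean_space"
  assumes uw: "n \<bullet> w < n \<bullet> u"
  shows "\<exists>C\<ge>0. \<forall>c \<eta> a b y z t. 0 \<le> \<eta> \<longrightarrow> switching_curve n c u w \<eta> a b y \<longrightarrow> switching_curve n c u w \<eta> a b z \<longrightarrow>
    t \<in> {a..b} \<longrightarrow> norm (y t - z t) \<le> C * (norm (y a - z a) + \<eta>)"
proof -
  \<comment> \<open>The factor from the normal component of a multiple of u - w to its
    length.\<close>
  define k where "k = norm (u - w) / (n \<bullet> u - n \<bullet> w)"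
  have k: "k \<ge> 0" using uw by (simp add: k_def)
  define C where "C = 1 + k * (2 * norm n + 2)"
  have "norm (y t - z t) \<le> C * (norm (y a - z a) + \<eta>)"
    if "0 \<le> \<eta>" and y: "switching_curve n c u w \<eta> a b y" and z: "switching_curve n c u w \<eta> a b z"
      and t: "t \<in> {a..b}" for c \<eta> a b y z t
  proof -
    let ?d = "norm (y a - z a)"
    have na: "\<bar>n \<bullet> y a - n \<bullet> z a\<bar> \<le> norm n * ?d"
      using Cauchy_Schwarz_ineq2[of n "y a - z a"] by (simp add: inner_diff_right)
    have nt: "\<bar>n \<bullet> y t - n \<bullet> z t\<bar> \<le> norm n * ?d + 2 * \<eta>"
      using switching_curves_contract[OF y z less_imp_le[OF uw] t] switching_curves_contract[OF z y less_imp_le[OF uw] t]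
        na \<open>0 \<le> \<eta>\<close> mult_nonneg_nonneg[of "norm n" ?d] by (auto simp: abs_le_iff)
    obtain l where l: "y t - y a = l *\<^sub>R u + (t - a - l) *\<^sub>R w"
      using switching_curveD(1)[OF y, of a t] t by auto
    obtain m where m: "z t - z a = m *\<^sub>R u + (t - a - m) *\<^sub>R w"
      using switching_curveD(1)[OF z, of a t] t by auto
    have eq: "y t - z t - (y a - z a) = (l - m) *\<^sub>R (u - w)"
    proof -
      have "y t - z t - (y a - z a) = (y t - y a) - (z t - z a)" by simp
      also have "\<dots> = (l - m) *\<^sub>R (u - w)" unfolding l m by (simp add: algebra_simps)
      finally show ?thesis .
    qed
    from arg_cong[OF eq, of "\<lambda>x. n \<bullet> x"]
    have "(l - m) * (n \<bullet> u - n \<bullet> w) = (n \<bullet> y t - n \<bullet> z t) - (n \<bullet> y a - n \<bullet> z a)"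
      by (simp add: inner_diff_right)
    then have "\<bar>l - m\<bar> * (n \<bullet> u - n \<bullet> w) = \<bar>(n \<bullet> y t - n \<bullet> z t) - (n \<bullet> y a - n \<bullet> z a)\<bar>"
      using uw by (metis abs_mult abs_of_pos diff_gt_0_iff_gt)
    then have "\<bar>l - m\<bar> * (n \<bullet> u - n \<bullet> w) \<le> 2 * norm n * ?d + 2 * \<eta>"
      using nt na by linarith
    then have "\<bar>l - m\<bar> \<le> (2 * norm n * ?d + 2 * \<eta>) / (n \<bullet> u - n \<bullet> w)" using uw by (simp add: field_simps)
    then have "\<bar>l - m\<bar> * norm (u - w) \<le> (2 * norm n * ?d + 2 * \<eta>) / (n \<bullet> u - n \<bullet> w) * norm (u - w)"
      by (rule mult_right_mono) simp
    then have "norm (y t - z t - (y a - z a)) \<le> k * (2 * norm n * ?d + 2 * \<eta>)"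
      unfolding eq by (simp add: k_def mult.commute)
    then have "norm (y t - z t) \<le> ?d + k * (2 * norm n * ?d + 2 * \<eta>)"
      using norm_triangle_sub[of "y t - z t" "y a - z a"] by simp
    also have "\<dots> \<le> C * (?d + \<eta>)"
    proof -
      have "C * (?d + \<eta>) = (?d + k * (2 * norm n * ?d + 2 * \<eta>)) + (\<eta> + k * (2 * norm n * \<eta>) + k * (2 * ?d))"
        by (simp add: C_def algebra_simps)
      then show ?thesis using k \<open>0 \<le> \<eta>\<close> by simp
    qed
    finally show ?thesis .
  qed
  then show ?thesis using k by (intro exI[of _ C]) (auto simp: C_def)
qed

lemma lipschitz_bend:
  fixes n k :: "'a::euclidean_space"
  shows "norm ((x + max 0 (n \<bullet> x - c) *\<^sub>R k) - (y + max 0 (n \<bullet> y - c) *\<^sub>R k)) \<le> (1 + norm n * norm k) * norm (x - y)"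
proof -
  have "\<bar>max 0 (n \<bullet> x - c) - max 0 (n \<bullet> y - c)\<bar> \<le> \<bar>n \<bullet> (x - y)\<bar>" by (auto simp: inner_diff_right)
  also have "\<dots> \<le> norm n * norm (x - y)" by (rule Cauchy_Schwarz_ineq2)
  finally have "\<bar>max 0 (n \<bullet> x - c) - max 0 (n \<bullet> y - c)\<bar> * norm k \<le> norm n * norm (x - y) * norm k"
    by (rule mult_right_mono) simp
  moreover have "(x + max 0 (n \<bullet> x - c) *\<^sub>R k) - (y + max 0 (n \<bullet> y - c) *\<^sub>R k)
      = (x - y) + (max 0 (n \<bullet> x - c) - max 0 (n \<bullet> y - c)) *\<^sub>R k" by (simp add: algebra_simps)
  moreover have "norm ((x - y) + (max 0 (n \<bullet> x - c) - max 0 (n \<bullet> y - c)) *\<^sub>R k)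
      \<le> norm (x - y) + \<bar>max 0 (n \<bullet> x - c) - max 0 (n \<bullet> y - c)\<bar> * norm k"
    using norm_triangle_ineq[of "x - y" "(max 0 (n \<bullet> x - c) - max 0 (n \<bullet> y - c)) *\<^sub>R k"] by simp
  moreover have "(1 + norm n * norm k) * norm (x - y) = norm (x - y) + norm n * norm (x - y) * norm k"
    by (simp add: algebra_simps)
  ultimately show ?thesis by (simp only:)
qed

text \<open>For increasing g the point p ends the time spent below the level l; an endpoint stands
  in when g stays on one side of l.\<close>

lemma strict_mono_level_split:
  fixes g :: "real \<Rightarrow> real"
  assumes "continuous_on {a..b} g" "a \<le> b"
  shows "\<exists>p\<in>{a..b}. (p = a \<or> g p \<le> l) \<and> (p = b \<or> l \<le> g p)"
proof -
  consider "l \<le> g a" | "g b \<le> l" | "g a \<le> l" "l \<le> g b" by linarith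
  then show ?thesis
  proof cases
    case 3
    then obtain p where "a \<le> p" "p \<le> b" "g p = l" using IVT'[of g a l b] assms by auto
    then show ?thesis by auto
  qed (use assms(2) in auto)
qed

text \<open>The piecewise linear map \<open>x \<mapsto> x + max 0 (n \<bullet> x - c) k\<close> straightens a crossing: with
  \<open>k = (u - w) / (n \<bullet> w)\<close> it takes the velocity \<open>w\<close> above the hyperplane to \<open>u\<close>.\<close>

lemma switching_curve_straightened:
  fixes n u w :: "'a::euclidean_space"
  assumes y: "switching_curve n c u w \<eta> a b y" and "a \<le> b" "0 \<le> \<eta>"
    and m: "0 < m" "m \<le> n \<bullet> u" "m \<le> n \<bullet> w"
  defines "k \<equiv> (u - w) /\<^sub>R (n \<bullet> w)"
  defines "f \<equiv> (\<lambda>x. x + max 0 (n \<bullet> x - c) *\<^sub>R k)"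
  shows "norm (f (y b) - f (y a) - (b - a) *\<^sub>R u)
    \<le> 2 / m * ((1 + norm n * norm k) * (norm u + norm w) + norm u) * \<eta>"
proof -
  define g where "g t = n \<bullet> y t" for t
  have cont: "continuous_on {a..b} g" unfolding g_def
    by (intro continuous_intros switching_curve_continuous_on[OF y])
  have slope: "m * (t - s) \<le> g t - g s" if st: "a \<le> s" "s \<le> t" "t \<le> b" for s t
  proof -
    obtain l where l: "l \<in> {0..t - s}" "y t - y s = l *\<^sub>R u + (t - s - l) *\<^sub>R w"
      using switching_curveD(1)[OF y st] by blast
    have "g t - g s = l * (n \<bullet> u) + (t - s - l) * (n \<bullet> w)"
      unfolding g_def inner_diff_right[symmetric] l(2) by (simp add: inner_add_right)
    moreover have "l * m \<le> l * (n \<bullet> u)" "(t - s - l) * m \<le> (t - s - l) * (n \<bullet> w)"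
      using l(1) m by (auto intro: mult_left_mono)
    ultimately show ?thesis by (simp add: algebra_simps)
  qed
  have mono: "g s < g t" if "a \<le> s" "s < t" "t \<le> b" for s t
  proof -
    have "0 < m * (t - s)" using that m by simp
    then show ?thesis using slope[of s t] that by simp
  qed
  \<comment> \<open>p and q are the times of entering and leaving the band of half-width \<eta>
    about the hyperplane. Outside the band the bent curve has velocity u exactly.\<close>
  obtain p where p: "p \<in> {a..b}" "p = a \<or> g p \<le> c - \<eta>" "p = b \<or> c - \<eta> \<le> g p"
    using strict_mono_level_split[OF cont \<open>a \<le> b\<close>, of "c - \<eta>"] by blast
  have "continuous_on {p..b} g" using cont p(1) by (auto intro: continuous_on_subset)
  then obtain q where q: "q \<in> {p..b}" "q = p \<or> g q \<le> c + \<eta>" "q = b \<or> c + \<eta> \<le> g q"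
    using strict_mono_level_split[of p b g "c + \<eta>"] p(1) by auto
  have 1: "f (y p) - f (y a) = (p - a) *\<^sub>R u"
  proof (cases "p = a")
    case False
    then have gp: "g p \<le> c - \<eta>" "a < p" using p by auto
    have "y p - y a = (p - a) *\<^sub>R u"
    proof (rule switching_curveD(2)[OF y])
      show "n \<bullet> y r < c - \<eta>" if "a < r" "r < p" for r
        using mono[of r p] that p(1) gp by (auto simp: g_def)
    qed (use p in auto)
    moreover have "g a < g p" using mono[of a p] gp p(1) by auto
    then have "f (y p) = y p" "f (y a) = y a" using gp \<open>0 \<le> \<eta>\<close> by (auto simp: f_def g_def)
    ultimately show ?thesis by simp
  qed auto
  have 3: "f (y b) - f (y q) = (b - q) *\<^sub>R u"
  proof (cases "q = b")
    case False
    then have gq: "c + \<eta> \<le> g q" "q < b" using q by auto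
    have *: "y b - y q = (b - q) *\<^sub>R w"
    proof (rule switching_curveD(3)[OF y])
      show "n \<bullet> y r > c + \<eta>" if "q < r" "r < b" for r
        using mono[of q r] that p(1) q(1) gq by (auto simp: g_def)
    qed (use p q in auto)
    have gb: "g b - g q = (b - q) * (n \<bullet> w)"
      unfolding g_def inner_diff_right[symmetric] * by simp
    moreover have "g q < g b" using mono[of q b] gq p(1) q(1) by auto
    ultimately have "f (y b) - f (y q) = (y b - y q) + (g b - g q) *\<^sub>R k"
      using gq \<open>0 \<le> \<eta>\<close> by (simp add: f_def g_def algebra_simps)
    also have "\<dots> = (b - q) *\<^sub>R u"
      unfolding * gb k_def using m by (simp add: algebra_simps)
    finally show ?thesis .
  qed auto
  have 2: "norm (f (y q) - f (y p) - (q - p) *\<^sub>R u) \<le> (q - p) * ((1 + norm n * norm k) * (norm u + norm w) + norm u)"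
  proof -
    have "norm (y q - y p) \<le> (q - p) * (norm u + norm w)"
      using p(1) q(1) by (intro switching_curve_speed[OF y]) auto
    then have "(1 + norm n * norm k) * norm (y q - y p) \<le> (1 + norm n * norm k) * ((q - p) * (norm u + norm w))"
      by (rule mult_left_mono) simp
    moreover have "norm (f (y q) - f (y p)) \<le> (1 + norm n * norm k) * norm (y q - y p)"
      unfolding f_def by (rule lipschitz_bend)
    moreover have "norm ((q - p) *\<^sub>R u) = (q - p) * norm u" using q(1) by simp
    ultimately show ?thesis
      using norm_triangle_ineq4[of "f (y q) - f (y p)" "(q - p) *\<^sub>R u"] by (simp add: algebra_simps)
  qed
  \<comment> \<open>Normal speed at least m limits the stay in the band, which has width 2
    \<eta>.\<close>
  have "q - p \<le> 2 / m * \<eta>"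
  proof (cases "p = q")
    case False
    then have "c - \<eta> \<le> g p" "g q \<le> c + \<eta>" using p q by auto
    then have "m * (q - p) \<le> 2 * \<eta>" using slope[of p q] p(1) q(1) by auto
    then show ?thesis using m by (simp add: field_simps)
  qed (use m \<open>0 \<le> \<eta>\<close> in auto)
  then have "(q - p) * ((1 + norm n * norm k) * (norm u + norm w) + norm u)
      \<le> (2 / m * \<eta>) * ((1 + norm n * norm k) * (norm u + norm w) + norm u)"
    by (rule mult_right_mono) simp
  moreover have "f (y b) - f (y a) - (b - a) *\<^sub>R u = f (y q) - f (y p) - (q - p) *\<^sub>R u"
    using arg_cong2[OF 1 3, of "(+)"] by (simp add: algebra_simps)
  ultimately show ?thesis using 2 by (simp add: mult_ac)
qed

text \<open>Both bent curves have velocity u up to an error E \<eta>, so their gap grows by at most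
  2 E \<eta>. The bending map and its inverse are Lipschitz, which carries the bound over to the
  curves themselves.\<close>

lemma switching_stability_crossing:
  fixes n u w :: "'a::euclidean_space"
  assumes "0 < n \<bullet> u" "0 < n \<bullet> w"
  shows "\<exists>C\<ge>0. \<forall>c \<eta> a b y z t. 0 \<le> \<eta> \<longrightarrow> switching_curve n c u w \<eta> a b y \<longrightarrow> switching_curve n c u w \<eta> a b z \<longrightarrow>
    t \<in> {a..b} \<longrightarrow> norm (y t - z t) \<le> C * (norm (y a - z a) + \<eta>)"
proof -
  define m where "m = min (n \<bullet> u) (n \<bullet> w)"
  have m: "0 < m" "m \<le> n \<bullet> u" "m \<le> n \<bullet> w" using assms by (auto simp: m_def)
  define k where "k = (u - w) /\<^sub>R (n \<bullet> w)"
  \<comment> \<open>Above the hyperplane, bending by k multiplies n \<bullet> x - c by the positive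
    ratio (n \<bullet> u) / (n \<bullet> w), so the inverse is again a bending, with this
    k'.\<close>
  define k' where "k' = - ((u - w) /\<^sub>R (n \<bullet> u))"
  define E where "E = 2 / m * ((1 + norm n * norm k) * (norm u + norm w) + norm u)"
  have E: "E \<ge> 0" using m by (simp add: E_def)
  define P where "P = (1 + norm n * norm k)"
  define P' where "P' = (1 + norm n * norm k')"
  have P: "P \<ge> 0" "P' \<ge> 0" by (auto simp: P_def P'_def)
  define C where "C = P' * (P + 2 * E)"
  have "norm (y t - z t) \<le> C * (norm (y a - z a) + \<eta>)"
    if "0 \<le> \<eta>" and y: "switching_curve n c u w \<eta> a b y" and z: "switching_curve n c u w \<eta> a b z"
      and t: "t \<in> {a..b}" for c \<eta> a b y z t
  proof -
    define f where "f = (\<lambda>x. x + max 0 (n \<bullet> x - c) *\<^sub>R k)"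
    define f' where "f' = (\<lambda>x. x + max 0 (n \<bullet> x - c) *\<^sub>R k')"
    have inv: "f' (f x) = x" for x
    proof (cases "n \<bullet> x \<le> c")
      case False
      have "n \<bullet> f x - c = (n \<bullet> x - c) * ((n \<bullet> u) / (n \<bullet> w))"
        using False assms by (simp add: f_def k_def inner_add_right inner_diff_right field_simps)
      moreover have "(n \<bullet> x - c) * ((n \<bullet> u) / (n \<bullet> w)) > 0" using False assms by simp
      ultimately have "f' (f x) = x + (n \<bullet> x - c) *\<^sub>R k + ((n \<bullet> x - c) * ((n \<bullet> u) / (n \<bullet> w))) *\<^sub>R k'"
        using False by (simp add: f'_def) (simp add: f_def)
      also have "((n \<bullet> x - c) * ((n \<bullet> u) / (n \<bullet> w))) *\<^sub>R k' = - ((n \<bullet> x - c) *\<^sub>R k)"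
        using assms by (simp add: k_def k'_def) (simp add: field_simps)
      finally show ?thesis by simp
    qed (auto simp: f_def f'_def)
    have sub: "switching_curve n c u w \<eta> a t x" if "switching_curve n c u w \<eta> a b x" for x
      using that t unfolding switching_curve_def by auto
    have str: "norm (f (x t) - f (x a) - (t - a) *\<^sub>R u) \<le> E * \<eta>" if "switching_curve n c u w \<eta> a b x" for x
      using switching_curve_straightened[OF sub[OF that] _ \<open>0 \<le> \<eta>\<close> m] t
      unfolding E_def f_def k_def by simp
    have "norm (f (y t) - f (z t)) \<le> norm (f (y a) - f (z a)) + 2 * (E * \<eta>)"
    proof -
      have "f (y t) - f (z t) = (f (y a) - f (z a)) + ((f (y t) - f (y a) - (t - a) *\<^sub>R u) - (f (z t) - f (z a) - (t - a) *\<^sub>R u))"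
        by simp
      then show ?thesis using str[OF y] str[OF z]
          norm_triangle_ineq[of "f (y a) - f (z a)" "(f (y t) - f (y a) - (t - a) *\<^sub>R u) - (f (z t) - f (z a) - (t - a) *\<^sub>R u)"]
          norm_triangle_ineq4[of "f (y t) - f (y a) - (t - a) *\<^sub>R u" "f (z t) - f (z a) - (t - a) *\<^sub>R u"]
        by (simp only:)
    qed
    also have "norm (f (y a) - f (z a)) \<le> P * norm (y a - z a)"
      unfolding f_def P_def by (rule lipschitz_bend)
    finally have *: "norm (f (y t) - f (z t)) \<le> P * norm (y a - z a) + 2 * (E * \<eta>)" by simp
    have "norm (y t - z t) = norm (f' (f (y t)) - f' (f (z t)))" by (simp add: inv)
    also have "\<dots> \<le> P' * norm (f (y t) - f (z t))" unfolding f'_def P'_def by (rule lipschitz_bend)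
    also have "\<dots> \<le> P' * (P * norm (y a - z a) + 2 * (E * \<eta>))" by (rule mult_left_mono[OF * P(2)])
    also have "\<dots> \<le> P' * ((P + 2 * E) * (norm (y a - z a) + \<eta>))"
      using P E \<open>0 \<le> \<eta>\<close> by (intro mult_left_mono) (auto simp: algebra_simps)
    finally show ?thesis by (simp add: C_def mult_ac)
  qed
  then show ?thesis using P E by (intro exI[of _ C]) (auto simp: C_def)
qed

definition well_posed_switch :: "'a::euclidean_space \<Rightarrow> 'a \<Rightarrow> 'a \<Rightarrow> bool" where
  "well_posed_switch n u w \<longleftrightarrow> u = w \<or> \<not> (n \<bullet> u \<le> 0 \<and> 0 \<le> n \<bullet> w)"

text \<open>If u \<noteq> w and n \<bullet> u \<le> n \<bullet> w, well-posedness leaves both normal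
  speeds with the same strict sign, hence a crossing. C depends on the normal and the velocities
  alone and is uniform in c, \<eta> and the time interval.\<close>

lemma switching_stability:
  fixes n u w :: "'a::euclidean_space"
  assumes "well_posed_switch n u w"
  shows "\<exists>C\<ge>0. \<forall>c \<eta> a b y z t. 0 \<le> \<eta> \<longrightarrow> switching_curve n c u w \<eta> a b y \<longrightarrow> switching_curve n c u w \<eta> a b z \<longrightarrow>
    t \<in> {a..b} \<longrightarrow> norm (y t - z t) \<le> C * (norm (y a - z a) + \<eta>)"
proof -
  consider "u = w" | "n \<bullet> w < n \<bullet> u" | "0 < n \<bullet> u" "0 < n \<bullet> w" | "n \<bullet> u < 0" "n \<bullet> w < 0"
    using assms unfolding well_posed_switch_def by linarith
  then show ?thesis
  proof cases
    case 1
    have "norm (y t - z t) \<le> 1 * (norm (y a - z a) + \<eta>)"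
      if "0 \<le> \<eta>" and y: "switching_curve n c u w \<eta> a b y" and z: "switching_curve n c u w \<eta> a b z"
        and t: "t \<in> {a..b}" for c \<eta> a b y z t
    proof -
      have "x t - x a = (t - a) *\<^sub>R u" if x: "switching_curve n c u w \<eta> a b x" for x
      proof -
        obtain l where "x t - x a = l *\<^sub>R u + (t - a - l) *\<^sub>R w"
          using switching_curveD(1)[OF x, of a t] t by auto
        then show ?thesis using 1 by (simp add: algebra_simps)
      qed
      from this[OF y] this[OF z] have "(y t - y a) - (z t - z a) = 0" by simp
      then have "y t - z t = y a - z a" by (simp add: algebra_simps)
      then show ?thesis using \<open>0 \<le> \<eta>\<close> by simp
    qed
    then show ?thesis by (intro exI[of _ 1]) auto
  next
    case 2
    then show ?thesis by (rule switching_stability_sliding)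
  next
    case 3
    then show ?thesis by (rule switching_stability_crossing)
  next
    case 4
    then have "0 < - n \<bullet> w" "0 < - n \<bullet> u" by auto
    from switching_stability_crossing[OF this] show ?thesis by (meson switching_curve_flip)
  qed
qed

section \<open>Euler polygons and Filippov solutions near an interface\<close>

lemma convex_increments_combine:
  fixes y :: "real \<Rightarrow> 'a::real_vector"
  assumes "convex Q" "s < r" "r < t" and "q \<in> Q" "y r - y s = (r - s) *\<^sub>R q"
    and "q' \<in> Q" "y t - y r = (t - r) *\<^sub>R q'"
  shows "\<exists>p\<in>Q. y t - y s = (t - s) *\<^sub>R p"
proof
  let ?p = "((r - s) / (t - s)) *\<^sub>R q + ((t - r) / (t - s)) *\<^sub>R q'"
  have "(r - s) / (t - s) + (t - r) / (t - s) = 1"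
    using assms(2,3) by (simp add: add_divide_distrib[symmetric])
  then show "?p \<in> Q" using assms by (intro convexD) auto
  have "y t - y s = (y r - y s) + (y t - y r)" by simp
  also have "\<dots> = (t - s) *\<^sub>R ?p" using assms by (simp add: scaleR_right_distrib)
  finally show "y t - y s = (t - s) *\<^sub>R ?p" .
qed

lemma euler_interp_on_cell:
  assumes "\<epsilon> > 0" "real k * \<epsilon> \<le> t" "t \<le> real (Suc k) * \<epsilon>"
  shows "euler_interp v \<epsilon> x0 t = euler_iterate v \<epsilon> x0 k + (t - real k * \<epsilon>) *\<^sub>R v (euler_iterate v \<epsilon> x0 k)"
proof (cases "t = real (Suc k) * \<epsilon>")
  \<comment> \<open>At the right end the floor already selects the next cell; the two formulas agree
    there.\<close>
  case True
  have "t - real k * \<epsilon> = \<epsilon>" using True by (simp add: algebra_simps)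
  then show ?thesis using euler_interp_grid[OF assms(1), of v x0 "Suc k"] True by simp
next
  case False
  then have "real k \<le> t / \<epsilon>" "t / \<epsilon> < real k + 1"
    using assms by (auto simp: field_simps)
  then have "nat \<lfloor>t / \<epsilon>\<rfloor> = k" by linarith
  moreover have "(t / \<epsilon> - real k) * \<epsilon> = t - real k * \<epsilon>" using assms(1) by (simp add: field_simps)
  ultimately show ?thesis by (simp add: euler_interp_def Let_def)
qed

text \<open>The polygon's counterpart of the mean value property: a secant slope is an average of
  the velocities of the cells that the interval meets, each evaluated at the left end of its
  cell.\<close>

lemma euler_interp_increment:
  fixes v :: "'a::euclidean_space \<Rightarrow> 'a"
  assumes "\<epsilon> > 0" "0 \<le> s" "s < t" "convex Q"
    and Q: "\<And>k. real k * \<epsilon> < t \<Longrightarrow> s < real (Suc k) * \<epsilon> \<Longrightarrow> v (euler_iterate v \<epsilon> x0 k) \<in> Q"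
  shows "\<exists>q\<in>Q. euler_interp v \<epsilon> x0 t - euler_interp v \<epsilon> x0 s = (t - s) *\<^sub>R q"
proof -
  let ?y = "euler_interp v \<epsilon> x0"
  define k0 where "k0 = nat \<lfloor>s / \<epsilon>\<rfloor>"
  have "real k0 \<le> s / \<epsilon>" "s / \<epsilon> < real k0 + 1"
    using assms(1,2) unfolding k0_def by (auto simp: of_nat_nat zero_le_floor)
  then have k0: "real k0 * \<epsilon> \<le> s" "s < real (Suc k0) * \<epsilon>" using assms(1) by (auto simp: field_simps)
  have cell: "?y t - ?y s = (t - s) *\<^sub>R v (euler_iterate v \<epsilon> x0 k)"
    if "real k * \<epsilon> \<le> s" "s \<le> t" "t \<le> real (Suc k) * \<epsilon>" for k s t
    using euler_interp_on_cell[OF assms(1), of k t v x0] euler_interp_on_cell[OF assms(1), of k s v x0] that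
    by (simp add: scaleR_left_diff_distrib)
  have "\<exists>q\<in>Q. ?y r - ?y s = (r - s) *\<^sub>R q"
    if "s < r" "r \<le> real (Suc (k0 + m)) * \<epsilon>" "r \<le> t" for r m
    using that
  proof (induction m arbitrary: r)
    case 0
    then show ?case using cell[of k0 s r] k0 Q[of k0] by auto
  next
    case (Suc m)
    let ?r = "real (Suc (k0 + m)) * \<epsilon>"
    show ?case
    proof (cases "r \<le> ?r")
      case True
      then show ?thesis using Suc by blast
    next
      case False
      have "real (Suc k0) * \<epsilon> \<le> ?r" using assms(1) by (intro mult_right_mono) auto
      then have r: "s < ?r" "?r < r" using False k0 by auto
      obtain q where "q \<in> Q" "?y ?r - ?y s = (?r - s) *\<^sub>R q" using Suc.IH[of ?r] r Suc.prems by auto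
      moreover have "?y r - ?y ?r = (r - ?r) *\<^sub>R v (euler_iterate v \<epsilon> x0 (Suc (k0 + m)))"
        using r Suc.prems by (intro cell) auto
      moreover have "v (euler_iterate v \<epsilon> x0 (Suc (k0 + m))) \<in> Q"
        using r Suc.prems by (intro Q) auto
      ultimately show ?thesis using r by (intro convex_increments_combine[OF assms(4)]) auto
    qed
  qed
  note * = this
  obtain m where "t / \<epsilon> \<le> real m" using real_arch_simple by blast
  then have "t \<le> real m * \<epsilon>" using assms(1) by (simp add: field_simps)
  also have "\<dots> \<le> real (Suc (k0 + m)) * \<epsilon>" using assms(1) by (intro mult_right_mono) auto
  finally show ?thesis using *[of t m] \<open>s < t\<close> by simp
qed

lemma euler_interp_speed:
  fixes v :: "'a::euclidean_space \<Rightarrow> 'a"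
  assumes "\<epsilon> > 0" "0 \<le> s" "s \<le> t" and M: "\<And>x. norm (v x) \<le> M"
  shows "norm (euler_interp v \<epsilon> x0 t - euler_interp v \<epsilon> x0 s) \<le> M * (t - s)"
proof (cases "s = t")
  case False
  then have "\<exists>q\<in>cball 0 M. euler_interp v \<epsilon> x0 t - euler_interp v \<epsilon> x0 s = (t - s) *\<^sub>R q"
    using assms by (intro euler_interp_increment) auto
  then show ?thesis using \<open>s \<le> t\<close> by (auto simp: mult.commute[of _ "t - s"] intro!: mult_left_mono)
qed auto

text \<open>The premises all ask for a slope in a closed convex set, a segment or a singleton, so
  that one increment lemma per kind of curve delivers the three of them.\<close>

lemma switching_curveI:
  assumes gen: "\<And>s t. a \<le> s \<Longrightarrow> s < t \<Longrightarrow> t \<le> b \<Longrightarrow> \<exists>q\<in>closed_segment u w. y t - y s = (t - s) *\<^sub>R q"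
    and lo: "\<And>s t. a \<le> s \<Longrightarrow> s < t \<Longrightarrow> t \<le> b \<Longrightarrow> (\<And>r. s < r \<Longrightarrow> r < t \<Longrightarrow> n \<bullet> y r < c - \<eta>) \<Longrightarrow>
      \<exists>q\<in>{u}. y t - y s = (t - s) *\<^sub>R q"
    and hi: "\<And>s t. a \<le> s \<Longrightarrow> s < t \<Longrightarrow> t \<le> b \<Longrightarrow> (\<And>r. s < r \<Longrightarrow> r < t \<Longrightarrow> n \<bullet> y r > c + \<eta>) \<Longrightarrow>
      \<exists>q\<in>{w}. y t - y s = (t - s) *\<^sub>R q"
  shows "switching_curve n c u w \<eta> a b y"
  unfolding switching_curve_def
proof (intro allI impI, elim conjE, intro conjI impI)
  fix s t assume st: "a \<le> s" "s \<le> t" "t \<le> b"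
  show "y t - y s = (t - s) *\<^sub>R u" if "\<forall>r. s < r \<and> r < t \<longrightarrow> n \<bullet> y r < c - \<eta>"
    using lo[of s t] that st by (cases "s = t") auto
  show "y t - y s = (t - s) *\<^sub>R w" if "\<forall>r. s < r \<and> r < t \<longrightarrow> n \<bullet> y r > c + \<eta>"
    using hi[of s t] that st by (cases "s = t") auto
  show "\<exists>l\<in>{0..t - s}. y t - y s = l *\<^sub>R u + (t - s - l) *\<^sub>R w"
  proof (cases "s = t")
    case False
    then obtain q where "q \<in> closed_segment u w" "y t - y s = (t - s) *\<^sub>R q" using gen[of s t] st by auto
    then obtain \<mu> where \<mu>: "0 \<le> \<mu>" "\<mu> \<le> 1" "y t - y s = (t - s) *\<^sub>R ((1 - \<mu>) *\<^sub>R u + \<mu> *\<^sub>R w)"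
      by (auto simp: closed_segment_def)
    show ?thesis
    proof (rule bexI[of _ "(t - s) * (1 - \<mu>)"])
      show "y t - y s = ((t - s) * (1 - \<mu>)) *\<^sub>R u + (t - s - (t - s) * (1 - \<mu>)) *\<^sub>R w"
        unfolding \<mu>(3) by (simp add: algebra_simps)
      show "(t - s) * (1 - \<mu>) \<in> {0..t - s}"
        using \<mu> st mult_left_mono[of "1 - \<mu>" 1 "t - s"] by simp
    qed
  qed auto
qed

text \<open>On the hyperplane either value may occur, because the projections choose arbitrarily
  among nearest points.\<close>

definition two_cell_field ::
    "('a::euclidean_space \<Rightarrow> 'a) \<Rightarrow> 'a set \<Rightarrow> 'a \<Rightarrow> real \<Rightarrow> 'a \<Rightarrow> 'a \<Rightarrow> bool" where
  "two_cell_field v S n c u w \<longleftrightarrow> (\<forall>x\<in>S. v x \<in> {u, w} \<and> (n \<bullet> x < c \<longrightarrow> v x = u) \<and> (n \<bullet> x > c \<longrightarrow> v x = w))"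

text \<open>The velocity on a cell is decided at its left grid point, up to M \<epsilon> away from
  the current point; hence the half-width norm n * (M * \<epsilon>). That grid point may precede
  time a, so the field must be known on a ball larger by M \<epsilon>.\<close>

lemma euler_interp_switching_curve:
  fixes v :: "'a::euclidean_space \<Rightarrow> 'a"
  assumes v: "two_cell_field v (ball z R) n c u w" and M: "\<And>x. norm (v x) \<le> M"
    and "\<epsilon> > 0" "0 \<le> a" "M * \<epsilon> + \<rho> \<le> R" and near: "euler_interp v \<epsilon> x0 ` {a..b} \<subseteq> ball z \<rho>"
  shows "switching_curve n c u w (norm n * (M * \<epsilon>)) a b (euler_interp v \<epsilon> x0)"
proof -
  let ?y = "euler_interp v \<epsilon> x0" and ?x = "euler_iterate v \<epsilon> x0"
  \<comment> \<open>A cell that overlaps the interval contains a time r strictly inside both, at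
    which a hypothesis about the interior of the interval can be evaluated.\<close>
  have cell: "\<exists>r. s < r \<and> r < t \<and> norm (?x k - ?y r) \<le> M * \<epsilon> \<and> ?x k \<in> ball z R"
    if st: "a \<le> s" "s < t" "t \<le> b" and k: "real k * \<epsilon> < t" "s < real (Suc k) * \<epsilon>" for s t k
  proof -
    have "real k * \<epsilon> < real (Suc k) * \<epsilon>" using \<open>\<epsilon> > 0\<close> by simp
    then obtain r where r: "max s (real k * \<epsilon>) < r" "r < min t (real (Suc k) * \<epsilon>)"
      using dense[of "max s (real k * \<epsilon>)" "min t (real (Suc k) * \<epsilon>)"] st k by auto
    have "?y r - ?x k = (r - real k * \<epsilon>) *\<^sub>R v (?x k)"
      using euler_interp_on_cell[OF \<open>\<epsilon> > 0\<close>, of k r v x0] r by simp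
    then have "norm (?y r - ?x k) = (r - real k * \<epsilon>) * norm (v (?x k))" using r by simp
    also have "\<dots> \<le> \<epsilon> * M" using r M \<open>\<epsilon> > 0\<close> by (intro mult_mono) (auto simp: algebra_simps)
    finally have 1: "norm (?x k - ?y r) \<le> M * \<epsilon>" by (simp add: norm_minus_commute mult.commute)
    have "r \<in> {a..b}" using r st by simp
    then have "?y r \<in> ball z \<rho>" using near by blast
    then have "?x k \<in> ball z R" using 1 \<open>M * \<epsilon> + \<rho> \<le> R\<close> dist_triangle[of z "?x k" "?y r"]
      by (simp add: dist_norm norm_minus_commute)
    then show ?thesis using 1 r by auto
  qed
  have inn: "\<bar>n \<bullet> ?x k - n \<bullet> ?y r\<bar> \<le> norm n * (M * \<epsilon>)" if "norm (?x k - ?y r) \<le> M * \<epsilon>" for k r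
    using Cauchy_Schwarz_ineq2[of n "?x k - ?y r"] mult_left_mono[OF that, of "norm n"]
    by (simp add: inner_diff_right)
  show ?thesis
  proof (rule switching_curveI)
    fix s t assume st: "a \<le> s" "s < t" "t \<le> b"
    have s: "0 \<le> s" using st \<open>0 \<le> a\<close> by simp
    show "\<exists>q\<in>closed_segment u w. ?y t - ?y s = (t - s) *\<^sub>R q"
    proof (rule euler_interp_increment[OF \<open>\<epsilon> > 0\<close> s st(2)])
      fix k assume k: "real k * \<epsilon> < t" "s < real (Suc k) * \<epsilon>"
      then obtain r where "?x k \<in> ball z R" using cell[OF st k] by blast
      then have "v (?x k) = u \<or> v (?x k) = w" using v by (simp add: two_cell_field_def)
      then show "v (?x k) \<in> closed_segment u w" by auto
    qed simp
    show "\<exists>q\<in>{u}. ?y t - ?y s = (t - s) *\<^sub>R q"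
      if *: "\<And>r. s < r \<Longrightarrow> r < t \<Longrightarrow> n \<bullet> ?y r < c - norm n * (M * \<epsilon>)"
    proof (rule euler_interp_increment[OF \<open>\<epsilon> > 0\<close> s st(2)])
      fix k assume k: "real k * \<epsilon> < t" "s < real (Suc k) * \<epsilon>"
      then obtain r where r: "s < r" "r < t" "norm (?x k - ?y r) \<le> M * \<epsilon>" "?x k \<in> ball z R"
        using cell[OF st k] by blast
      have "n \<bullet> ?x k < c" using inn[OF r(3)] *[OF r(1,2)] by linarith
      then show "v (?x k) \<in> {u}" using v r(4) by (simp add: two_cell_field_def)
    qed simp
    show "\<exists>q\<in>{w}. ?y t - ?y s = (t - s) *\<^sub>R q"
      if *: "\<And>r. s < r \<Longrightarrow> r < t \<Longrightarrow> n \<bullet> ?y r > c + norm n * (M * \<epsilon>)"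
    proof (rule euler_interp_increment[OF \<open>\<epsilon> > 0\<close> s st(2)])
      fix k assume k: "real k * \<epsilon> < t" "s < real (Suc k) * \<epsilon>"
      then obtain r where r: "s < r" "r < t" "norm (?x k - ?y r) \<le> M * \<epsilon>" "?x k \<in> ball z R"
        using cell[OF st k] by blast
      have "n \<bullet> ?x k > c" using inn[OF r(3)] *[OF r(1,2)] by linarith
      then show "v (?x k) \<in> {w}" using v r(4) by (simp add: two_cell_field_def)
    qed simp
  qed
qed

section \<open>Filippov sets and increments of Filippov solutions\<close>

text \<open>Finiteness acts twice: V is closed, so values off V are not essential, and its hull is
  compact, so the closure in \<open>filippov_map\<close> adds no points.\<close>

lemma filippov_map_subset:
  fixes v :: "'a::euclidean_space \<Rightarrow> 'a"
  assumes "open S" "x \<in> S" "finite V" "\<And>y. y \<in> S \<Longrightarrow> v y \<in> V"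
  shows "filippov_map v x \<subseteq> convex hull V"
proof -
  have "essential_values v x \<subseteq> V"
  proof
    fix w assume w: "w \<in> essential_values v x"
    show "w \<in> V"
    proof (rule ccontr)
      assume "w \<notin> V"
      moreover have "open (- V)" using finite_imp_closed[OF assms(3)] by (rule open_Compl)
      ultimately obtain \<eta> where \<eta>: "\<eta> > 0" "ball w \<eta> \<subseteq> - V"
        using open_contains_ball by (metis ComplI)
      obtain \<delta> where \<delta>: "\<delta> > 0" "ball x \<delta> \<subseteq> S" using assms(1,2) open_contains_ball by blast
      have "{y \<in> ball x \<delta>. v y \<in> ball w \<eta>} = {}" using \<eta> \<delta> assms(4) by blast
      then have "negligible {y \<in> ball x \<delta>. v y \<in> ball w \<eta>}" by (simp only: negligible_empty)
      then show False using w \<eta>(1) \<delta>(1) unfolding essential_values_def by blast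
    qed
  qed
  then have "convex hull (essential_values v x) \<subseteq> convex hull V" by (rule hull_mono)
  then show ?thesis unfolding filippov_map_def
    by (rule closure_minimal) (simp add: assms(3) compact_imp_closed finite_imp_compact compact_convex_hull)
qed

lemma filippov_solution_increment:
  fixes v :: "'a::euclidean_space \<Rightarrow> 'a"
  assumes y: "filippov_solution v T x0 y" and "0 \<le> s" "s < t" "t \<le> T" "convex Q" "closed Q"
    and Q: "\<And>r. s < r \<Longrightarrow> r < t \<Longrightarrow> filippov_map v (y r) \<subseteq> Q"
  shows "\<exists>q\<in>Q. y t - y s = (t - s) *\<^sub>R q"
proof (rule abs_continuous_on_increment[where a=0 and b=T])
  have "AE r in lebesgue. r \<in> {0..T} \<longrightarrow> (\<exists>w \<in> filippov_map v (y r). (y has_vector_derivative w) (at r within {0..T}))"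
    using y by (simp add: filippov_solution_def)
  then show "AE r in lebesgue. s < r \<and> r < t \<longrightarrow> (\<exists>d\<in>Q. (y has_vector_derivative d) (at r within {0..T}))"
  proof eventually_elim
    case (elim r)
    show ?case
    proof
      assume r: "s < r \<and> r < t"
      then obtain d where "d \<in> filippov_map v (y r)" "(y has_vector_derivative d) (at r within {0..T})"
        using elim assms(2,4) by auto
      then show "\<exists>d\<in>Q. (y has_vector_derivative d) (at r within {0..T})" using Q r by blast
    qed
  qed
qed (use assms in \<open>auto simp: filippov_solution_def\<close>)

lemma filippov_solution_speed:
  fixes v :: "'a::euclidean_space \<Rightarrow> 'a"
  assumes y: "filippov_solution v T x0 y" and "0 \<le> s" "s \<le> t" "t \<le> T"
    and fin: "finite (range v)" and M: "\<And>x. norm (v x) \<le> M"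
  shows "norm (y t - y s) \<le> M * (t - s)"
proof (cases "s = t")
  case False
  have "\<exists>q\<in>cball 0 M. y t - y s = (t - s) *\<^sub>R q"
  proof (rule filippov_solution_increment[OF y])
    fix r
    have "filippov_map v (y r) \<subseteq> convex hull (range v)"
      using fin by (intro filippov_map_subset[of UNIV]) auto
    also have "\<dots> \<subseteq> cball 0 M" using M by (intro hull_minimal) auto
    finally show "filippov_map v (y r) \<subseteq> cball 0 M" .
  qed (use assms False in auto)
  then show ?thesis using \<open>s \<le> t\<close> by (auto simp: mult.commute[of _ "t - s"] intro!: mult_left_mono)
qed auto

lemma filippov_solution_switching_curve:
  fixes v :: "'a::euclidean_space \<Rightarrow> 'a"
  assumes y: "filippov_solution v T x0 y" and v: "two_cell_field v (ball z \<rho>) n c u w"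
    and "0 \<le> a" "b \<le> T" and near: "y ` {a..b} \<subseteq> ball z \<rho>"
  shows "switching_curve n c u w 0 a b y"
proof (rule switching_curveI)
  fix s t assume st: "a \<le> s" "s < t" "t \<le> b"
  then have s: "0 \<le> s" "t \<le> T" using assms by auto
  have yr: "y r \<in> ball z \<rho>" if "s < r" "r < t" for r
  proof -
    have "r \<in> {a..b}" using that st by simp
    then show ?thesis using near by blast
  qed
  show "\<exists>q\<in>closed_segment u w. y t - y s = (t - s) *\<^sub>R q"
  proof (rule filippov_solution_increment[OF y s(1) st(2) s(2)])
    show "filippov_map v (y r) \<subseteq> closed_segment u w" if "s < r" "r < t" for r
      unfolding segment_convex_hull using v yr[OF that]
      by (intro filippov_map_subset[of "ball z \<rho>"]) (auto simp: two_cell_field_def)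
  qed auto
  show "\<exists>q\<in>{u}. y t - y s = (t - s) *\<^sub>R q" if *: "\<And>r. s < r \<Longrightarrow> r < t \<Longrightarrow> n \<bullet> y r < c - 0"
  proof (rule filippov_solution_increment[OF y s(1) st(2) s(2)])
    show "filippov_map v (y r) \<subseteq> {u}" if "s < r" "r < t" for r
    proof -
      \<comment> \<open>Intersecting the ball with the open half-space removes the hyperplane, where
        the values are mixed.\<close>
      have "filippov_map v (y r) \<subseteq> convex hull {u}"
        using v yr[OF that] *[OF that] open_halfspace_lt[of n c]
        by (intro filippov_map_subset[of "ball z \<rho> \<inter> {x. n \<bullet> x < c}"]) (auto simp: two_cell_field_def)
      then show ?thesis by simp
    qed
  qed auto
  show "\<exists>q\<in>{w}. y t - y s = (t - s) *\<^sub>R q" if *: "\<And>r. s < r \<Longrightarrow> r < t \<Longrightarrow> n \<bullet> y r > c + 0"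
  proof (rule filippov_solution_increment[OF y s(1) st(2) s(2)])
    show "filippov_map v (y r) \<subseteq> {w}" if "s < r" "r < t" for r
    proof -
      have "filippov_map v (y r) \<subseteq> convex hull {w}"
        using v yr[OF that] *[OF that] open_halfspace_gt[of c n]
        by (intro filippov_map_subset[of "ball z \<rho> \<inter> {x. n \<bullet> x > c}"]) (auto simp: two_cell_field_def)
      then show ?thesis by simp
    qed
  qed auto
qed

section \<open>Propagation of stability along a trajectory\<close>

text \<open>What Filippov solutions (\<eta> = 0) and Euler polygons (\<eta> = M \<epsilon>) have in
  common near a reference trajectory X. The local data are indexed by the time \<tau> at which X is
  the centre of the ball, while the arc {a..b} may belong to other times.\<close>

definition switching_near ::
    "(real \<Rightarrow> 'a::euclidean_space) \<Rightarrow> real \<Rightarrow> real \<Rightarrow> real \<Rightarrow> (real \<Rightarrow> 'a) \<Rightarrow> (real \<Rightarrow> real) \<Rightarrow> (real \<Rightarrow> 'a) \<Rightarrow> (real \<Rightarrow> 'a) \<Rightarrow>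
      real \<Rightarrow> (real \<Rightarrow> 'a) \<Rightarrow> bool" where
  "switching_near X \<rho> M T n c u w \<eta> y \<longleftrightarrow>
     (\<forall>s t. 0 \<le> s \<and> s \<le> t \<and> t \<le> T \<longrightarrow> norm (y t - y s) \<le> M * (t - s)) \<and>
     (\<forall>\<tau>\<in>{0..T}. \<forall>a b. 0 \<le> a \<and> a \<le> b \<and> b \<le> T \<and> y ` {a..b} \<subseteq> ball (X \<tau>) \<rho> \<longrightarrow>
        switching_curve (n \<tau>) (c \<tau>) (u \<tau>) (w \<tau>) (norm (n \<tau>) * \<eta>) a b y)"

lemma switching_near_mono:
  assumes "switching_near X \<rho> M T n c u w \<eta> y" "\<eta> \<le> \<eta>'"
  shows "switching_near X \<rho> M T n c u w \<eta>' y"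
  unfolding switching_near_def
proof (intro conjI ballI allI impI, goal_cases)
  case 1
  then show ?case using assms(1) by (simp add: switching_near_def)
next
  case (2 \<tau> a b)
  then have "switching_curve (n \<tau>) (c \<tau>) (u \<tau>) (w \<tau>) (norm (n \<tau>) * \<eta>) a b y"
    using assms(1) by (simp add: switching_near_def)
  then show ?case by (rule switching_curve_mono) (simp add: assms(2) mult_left_mono)
qed

text \<open>Local stability constants multiply along a fixed finite subdivision of \<open>[0, T]\<close>, fine enough
  for the curves to stay in one ball on each piece.\<close>

lemma switching_near_stability:
  fixes X :: "real \<Rightarrow> 'a::euclidean_space"
  assumes "T > 0" "\<rho> > 0" "M \<ge> 0" and X: "switching_near X \<rho> M T n c u w 0 X"
    and wp: "\<And>\<tau>. \<tau> \<in> {0..T} \<Longrightarrow> well_posed_switch (n \<tau>) (u \<tau>) (w \<tau>)"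
  shows "\<exists>K\<ge>0. \<forall>\<eta> y z. 0 \<le> \<eta> \<longrightarrow> switching_near X \<rho> M T n c u w \<eta> y \<longrightarrow> switching_near X \<rho> M T n c u w \<eta> z \<longrightarrow>
    K * (norm (y 0 - X 0) + \<eta>) < \<rho> / 2 \<longrightarrow> K * (norm (z 0 - X 0) + \<eta>) < \<rho> / 2 \<longrightarrow>
    (\<forall>t\<in>{0..T}. norm (y t - z t) \<le> K * (norm (y 0 - z 0) + \<eta>))"
proof -
  \<comment> \<open>In a time T / N a curve moves less than \<rho> / 2; the other half of \<rho> is
    left for its distance from X at the start of the piece.\<close>
  obtain N :: nat where N: "M * T / (\<rho> / 2) < real N" using reals_Archimedean2 by blast
  have "0 \<le> M * T / (\<rho> / 2)" using assms by simp
  then have "N > 0" using N by (metis le_less_trans of_nat_0_less_iff)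
  define h where "h = T / real N"
  have h: "h > 0" "real N * h = T" using \<open>N > 0\<close> \<open>T > 0\<close> by (auto simp: h_def)
  have Mh: "M * h < \<rho> / 2" using N \<open>N > 0\<close> \<open>\<rho> > 0\<close> by (simp add: h_def field_simps)
  let ?near = "switching_near X \<rho> M T n c u w"
  define stable where "stable K r \<longleftrightarrow> (\<forall>\<eta> y z. 0 \<le> \<eta> \<longrightarrow> ?near \<eta> y \<longrightarrow> ?near \<eta> z \<longrightarrow>
    K * (norm (y 0 - X 0) + \<eta>) < \<rho> / 2 \<longrightarrow> K * (norm (z 0 - X 0) + \<eta>) < \<rho> / 2 \<longrightarrow>
    (\<forall>t\<in>{0..r}. norm (y t - z t) \<le> K * (norm (y 0 - z 0) + \<eta>)))" for K r
  have "\<exists>K\<ge>0. stable K (real j * h)" if "j \<le> N" for j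
    using that
  proof (induction j)
    case 0
    show ?case unfolding stable_def by (intro exI[of _ 1]) auto
  next
    case (Suc j)
    then obtain K where K0: "K \<ge> 0" "stable K (real j * h)" by (meson Suc_leD)
    note K = K0(1) K0(2)[unfolded stable_def, rule_format]
    let ?s = "real j * h" and ?t = "real (Suc j) * h"
    have "real (Suc j) * h \<le> real N * h" using Suc.prems h by (intro mult_right_mono) auto
    then have st: "0 \<le> ?s" "?s \<le> ?t" "?t \<le> T" "?t - ?s = h" using h by (auto simp: algebra_simps)
    then have sT: "?s \<in> {0..T}" by simp
    from switching_stability[OF wp[OF sT]] obtain C where C0: "C \<ge> 0" "\<forall>c' \<eta> a b y z t. 0 \<le> \<eta> \<longrightarrow>
       switching_curve (n ?s) c' (u ?s) (w ?s) \<eta> a b y \<longrightarrow> switching_curve (n ?s) c' (u ?s) (w ?s) \<eta> a b z \<longrightarrow>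
       t \<in> {a..b} \<longrightarrow> norm (y t - z t) \<le> C * (norm (y a - z a) + \<eta>)" by (elim exE conjE)
    note C = C0(1) C0(2)[rule_format]
    \<comment> \<open>The new piece starts with a gap of K times the initial data and has a band of
      norm (n ?s) times \<eta>, both multiplied by C; the summand K keeps the bound valid on earlier
      pieces.\<close>
    define K' where "K' = K + C * (K + norm (n ?s))"
    have K': "K \<le> K'" "C * (K + norm (n ?s)) \<le> K'" using K(1) C(1) by (auto simp: K'_def)
    have "norm (y t - z t) \<le> K' * (norm (y 0 - z 0) + \<eta>)"
      if \<eta>: "0 \<le> \<eta>" and y: "?near \<eta> y" and z: "?near \<eta> z"
        and ys: "K' * (norm (y 0 - X 0) + \<eta>) < \<rho> / 2" and zs: "K' * (norm (z 0 - X 0) + \<eta>) < \<rho> / 2"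
        and t: "t \<in> {0..?t}" for \<eta> y z t
    proof -
      have small: "K * (norm (x 0 - X 0) + \<eta>) < \<rho> / 2" if "K' * (norm (x 0 - X 0) + \<eta>) < \<rho> / 2" for x
        using mult_right_mono[OF K'(1), of "norm (x 0 - X 0) + \<eta>"] \<eta> that by simp
      have before: "norm (y t - z t) \<le> K * (norm (y 0 - z 0) + \<eta>)" if "t \<in> {0..?s}" for t
        by (rule K(2)[OF \<eta> y z small[of y, OF ys] small[of z, OF zs] that])
      show ?thesis
      proof (cases "t \<le> ?s")
        case True
        then have "norm (y t - z t) \<le> K * (norm (y 0 - z 0) + \<eta>)" using before t by simp
        also have "\<dots> \<le> K' * (norm (y 0 - z 0) + \<eta>)" using K'(1) \<eta> by (intro mult_right_mono) auto
        finally show ?thesis .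
      next
        case False
        have sw: "switching_curve (n ?s) (c ?s) (u ?s) (w ?s) (norm (n ?s) * \<eta>) ?s ?t x"
          if x: "?near \<eta> x" and xs: "K' * (norm (x 0 - X 0) + \<eta>) < \<rho> / 2" for x
        proof -
          have "K * (norm (X 0 - X 0) + \<eta>) \<le> K * (norm (x 0 - X 0) + \<eta>)"
            using K(1) by (intro mult_left_mono) auto
          then have "K * (norm (X 0 - X 0) + \<eta>) < \<rho> / 2" using small[of x, OF xs] by simp
          \<comment> \<open>The induction hypothesis is applied to x and X itself, to see that x is
            still close to the centre of the next ball.\<close>
          then have "norm (x ?s - X ?s) \<le> K * (norm (x 0 - X 0) + \<eta>)"
            using st by (intro K(2)[OF \<eta> x switching_near_mono[OF X \<eta>] small[of x, OF xs]]) auto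
          then have 1: "norm (x ?s - X ?s) < \<rho> / 2" using small[of x, OF xs] by simp
          have "x ` {?s..?t} \<subseteq> ball (X ?s) \<rho>"
          proof clarify
            fix r assume r: "r \<in> {?s..?t}"
            then have "norm (x r - x ?s) \<le> M * (r - ?s)" using x st unfolding switching_near_def by auto
            also have "\<dots> \<le> M * h" using r st(4) \<open>M \<ge> 0\<close> by (intro mult_left_mono) auto
            finally have "norm (x r - x ?s) < \<rho> / 2" using Mh by simp
            then show "x r \<in> ball (X ?s) \<rho>" using 1 norm_triangle_ineq[of "x r - x ?s" "x ?s - X ?s"]
              by (simp add: dist_norm norm_minus_commute)
          qed
          then show ?thesis using x st sT by (simp add: switching_near_def)
        qed
        have "norm (y t - z t) \<le> C * (norm (y ?s - z ?s) + norm (n ?s) * \<eta>)"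
          using \<eta> t False by (intro C(2)[OF _ sw[OF y ys] sw[OF z zs]]) auto
        also have "\<dots> \<le> C * (K * (norm (y 0 - z 0) + \<eta>) + norm (n ?s) * (norm (y 0 - z 0) + \<eta>))"
          using before[of ?s] st C(1) by (intro mult_left_mono add_mono) auto
        also have "\<dots> = C * (K + norm (n ?s)) * (norm (y 0 - z 0) + \<eta>)" by (simp add: algebra_simps)
        also have "\<dots> \<le> K' * (norm (y 0 - z 0) + \<eta>)" using K'(2) \<eta> by (intro mult_right_mono) auto
        finally show ?thesis .
      qed
    qed
    then have "stable K' (real (Suc j) * h)" unfolding stable_def by blast
    then show ?case using K(1) K'(1) by (intro exI[of _ K']) auto
  qed
  from this[of N] h(2) show ?thesis unfolding stable_def by simp
qed

section \<open>Existence of Filippov solutions of piecewise constant fields\<close>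

text \<open>Kakutani's theorem for the set-valued map that sends x to the hull of those d i with x
  in C i. Brouwer's theorem is applied to averages of the d i, weighted by a partition of unity on
  the e-neighbourhoods of the C i; then e tends to 0 along a convergent subsequence.\<close>

lemma finite_closed_cover_fixed_point:
  fixes d :: "'i \<Rightarrow> 'a::euclidean_space" and C :: "'i \<Rightarrow> 'a set"
  assumes fin: "finite I" "I \<noteq> {}" and cl: "\<And>i. i \<in> I \<Longrightarrow> closed (C i)"
    and cover: "convex hull (d ` I) \<subseteq> (\<Union>i\<in>I. C i)"
  shows "\<exists>x\<in>convex hull (d ` I). x \<in> convex hull (d ` {i \<in> I. x \<in> C i})"
proof -
  define S where "S = convex hull (d ` I)"
  \<comment> \<open>\<open>infdist\<close> to the empty set is 0, so an empty C i would count as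
    close to every point.\<close>
  define I' where "I' = {i \<in> I. C i \<noteq> {}}"
  have I': "finite I'" "I' \<subseteq> I" using fin by (auto simp: I'_def)
  have S: "compact S" "convex S" "S \<noteq> {}" using fin by (auto simp: S_def finite_imp_compact compact_convex_hull)
  have approx: "\<exists>x\<in>S. x \<in> convex hull (d ` {i \<in> I'. infdist x (C i) < e})" if "e > 0" for e
  proof -
    define \<phi> where "\<phi> i x = max 0 (e - infdist x (C i))" for i x
    define \<Phi> where "\<Phi> x = (\<Sum>i\<in>I'. \<phi> i x)" for x
    define f where "f x = (\<Sum>i\<in>I'. (\<phi> i x / \<Phi> x) *\<^sub>R d i)" for x
    have \<phi>: "\<phi> i x \<ge> 0" for i x by (simp add: \<phi>_def)
    have \<Phi>: "\<Phi> x > 0" if x: "x \<in> S" for x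
    proof -
      obtain i where "i \<in> I" "x \<in> C i" using cover x unfolding S_def by blast
      then have "i \<in> I'" "\<phi> i x > 0" using \<open>e > 0\<close> by (auto simp: I'_def \<phi>_def)
      then show ?thesis unfolding \<Phi>_def using I'(1) \<phi> by (intro sum_pos2[of I' i]) auto
    qed
    have hull: "f x \<in> convex hull (d ` {i \<in> I'. infdist x (C i) < e})" if x: "x \<in> S" for x
    proof -
      let ?J = "{i \<in> I'. infdist x (C i) < e}"
      have z: "\<phi> i x = 0" if "i \<in> I' - ?J" for i using that by (auto simp: \<phi>_def)
      have "f x = (\<Sum>i\<in>?J. (\<phi> i x / \<Phi> x) *\<^sub>R d i)"
        unfolding f_def using I'(1) z by (intro sum.mono_neutral_right) auto
      also have "\<dots> \<in> convex hull (d ` ?J)"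
      proof (rule convex_sum)
        have "(\<Sum>i\<in>?J. \<phi> i x) = \<Phi> x"
          unfolding \<Phi>_def using I'(1) z by (intro sum.mono_neutral_left) auto
        then show "(\<Sum>i\<in>?J. \<phi> i x / \<Phi> x) = 1"
          using \<Phi>[OF x] by (simp add: sum_divide_distrib[symmetric])
      qed (use I'(1) \<phi> \<Phi>[OF x] in \<open>auto intro: hull_inc\<close>)
      finally show ?thesis .
    qed
    have "continuous_on S f"
    proof -
      have c\<phi>: "continuous_on S (\<phi> i)" for i unfolding \<phi>_def by (intro continuous_intros)
      have c\<Phi>: "continuous_on S \<Phi>" unfolding \<Phi>_def by (intro continuous_on_sum c\<phi>)
      have "\<forall>x\<in>S. \<Phi> x \<noteq> 0" using \<Phi> by force
      then show ?thesis unfolding f_def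
        by (intro continuous_on_sum continuous_on_scaleR continuous_on_divide c\<phi> c\<Phi> continuous_on_const)
    qed
    moreover have "f \<in> S \<rightarrow> S"
    proof
      fix x assume "x \<in> S"
      have "convex hull (d ` {i \<in> I'. infdist x (C i) < e}) \<subseteq> S"
        unfolding S_def using I'(2) by (intro hull_mono) auto
      then show "f x \<in> S" using hull[OF \<open>x \<in> S\<close>] by blast
    qed
    ultimately obtain x where "x \<in> S" "f x = x" using brouwer[OF S] by blast
    then show ?thesis using hull[of x] by auto
  qed
  have "\<forall>m. \<exists>x. x \<in> S \<and> x \<in> convex hull (d ` {i \<in> I'. infdist x (C i) < 1 / real (Suc m)})"
  proof
    fix m
    have "1 / real (Suc m) > 0" by simp
    from approx[OF this] show "\<exists>x. x \<in> S \<and> x \<in> convex hull (d ` {i \<in> I'. infdist x (C i) < 1 / real (Suc m)})"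
      by blast
  qed
  from choice[OF this] obtain x where
    x0: "\<forall>m. x m \<in> S \<and> x m \<in> convex hull (d ` {i \<in> I'. infdist (x m) (C i) < 1 / real (Suc m)})" ..
  then have x: "\<And>m. x m \<in> S"
    "\<And>m. x m \<in> convex hull (d ` {i \<in> I'. infdist (x m) (C i) < 1 / real (Suc m)})" by auto
  obtain l r where l: "l \<in> S" "strict_mono r" "(x \<circ> r) \<longlonglongrightarrow> l"
    using compact_imp_seq_compact[OF S(1)] x(1) by (meson seq_compactE)
  let ?J = "{i \<in> I. l \<in> C i}"
  \<comment> \<open>A closed set that misses the limit l keeps a positive distance from it, so its
    index is eventually inactive.\<close>
  have "eventually (\<lambda>m. infdist ((x \<circ> r) m) (C i) \<ge> 1 / real (Suc (r m))) sequentially"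
    if i: "i \<in> I' - ?J" for i
  proof -
    have "infdist l (C i) > 0" using i cl[of i] in_closed_iff_infdist_zero[of "C i" l] infdist_nonneg[of l "C i"]
      by (auto simp: I'_def less_le)
    moreover have "(\<lambda>m. infdist ((x \<circ> r) m) (C i)) \<longlonglongrightarrow> infdist l (C i)" by (intro tendsto_infdist l(3))
    moreover have "(\<lambda>m. 1 / real (Suc (r m))) \<longlonglongrightarrow> 0"
      using LIMSEQ_subseq_LIMSEQ[OF LIMSEQ_Suc[OF lim_const_over_n[of "1::real"]] l(2)] by (simp add: o_def)
    ultimately have "(\<lambda>m. infdist ((x \<circ> r) m) (C i) - 1 / real (Suc (r m))) \<longlonglongrightarrow> infdist l (C i) - 0"
      by (intro tendsto_diff)
    then have "eventually (\<lambda>m. infdist ((x \<circ> r) m) (C i) - 1 / real (Suc (r m)) > 0) sequentially"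
      using \<open>infdist l (C i) > 0\<close> by (intro order_tendstoD(1)) auto
    then show ?thesis by eventually_elim simp
  qed
  then have "eventually (\<lambda>m. \<forall>i\<in>I' - ?J. infdist ((x \<circ> r) m) (C i) \<ge> 1 / real (Suc (r m))) sequentially"
    using I'(1) by (intro eventually_ball_finite) auto
  then have "eventually (\<lambda>m. (x \<circ> r) m \<in> convex hull (d ` ?J)) sequentially"
  proof eventually_elim
    case (elim m)
    have "{i \<in> I'. infdist (x (r m)) (C i) < 1 / real (Suc (r m))} \<subseteq> ?J"
    proof
      fix i assume i: "i \<in> {i \<in> I'. infdist (x (r m)) (C i) < 1 / real (Suc (r m))}"
      show "i \<in> ?J"
      proof (rule ccontr)
        assume "i \<notin> ?J"
        then have "i \<in> I' - ?J" using i by blast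
        from bspec[OF elim this] i show False by simp
      qed
    qed
    then have "convex hull (d ` {i \<in> I'. infdist (x (r m)) (C i) < 1 / real (Suc (r m))}) \<subseteq> convex hull (d ` ?J)"
      by (intro hull_mono image_mono)
    then show ?case using x(2)[of "r m"] by auto
  qed
  moreover have "closed (convex hull (d ` ?J))"
    using fin(1) by (intro compact_imp_closed compact_convex_hull finite_imp_compact) auto
  ultimately have "l \<in> convex hull (d ` ?J)"
    using l(3) by (intro Lim_in_closed_set[of "convex hull (d ` ?J)" "x \<circ> r" sequentially]) auto
  then show ?thesis using l(1) unfolding S_def by blast
qed

section \<open>Admissible rays of polyhedral fields\<close>

text \<open>If x is on the boundary hyperplane, membership along a ray is decided by the sign of n
  \<bullet> e; otherwise short rays of bounded speed do not reach the hyperplane. The bound \<delta>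
  is uniform in e, because e is found only afterwards, by a fixed point argument that refers to
  \<delta>.\<close>

lemma halfspaces_along_rays:
  fixes H :: "('a::euclidean_space \<times> real) set"
  assumes "finite H" "M \<ge> 0"
  shows "\<exists>\<delta>>0. \<forall>(n, c)\<in>H. \<forall>e s s'. norm e \<le> M \<longrightarrow> 0 < s \<longrightarrow> s < \<delta> \<longrightarrow> 0 < s' \<longrightarrow> s' < \<delta> \<longrightarrow>
    n \<bullet> (x + s *\<^sub>R e) \<le> c \<longrightarrow> n \<bullet> (x + s' *\<^sub>R e) \<le> c"
proof -
  have "\<exists>\<delta>>0. \<forall>e s s'. norm e \<le> M \<longrightarrow> 0 < s \<longrightarrow> s < \<delta> \<longrightarrow> 0 < s' \<longrightarrow> s' < \<delta> \<longrightarrow>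
    fst h \<bullet> (x + s *\<^sub>R e) \<le> snd h \<longrightarrow> fst h \<bullet> (x + s' *\<^sub>R e) \<le> snd h" for h :: "'a \<times> real"
  proof (cases "fst h \<bullet> x = snd h")
    case True
    have "fst h \<bullet> (x + s' *\<^sub>R e) \<le> snd h" if "0 < s" "0 < s'" "fst h \<bullet> (x + s *\<^sub>R e) \<le> snd h" for e s s'
    proof -
      have "s * (fst h \<bullet> e) \<le> 0" using that(3) True by (simp add: inner_add_right)
      then have "fst h \<bullet> e \<le> 0" using that(1) by (simp add: mult_le_0_iff)
      then have "s' * (fst h \<bullet> e) \<le> 0" using that(2) by (simp add: mult_le_0_iff)
      then show ?thesis using True by (simp add: inner_add_right)
    qed
    then have "\<forall>e s s'. norm e \<le> M \<longrightarrow> 0 < s \<longrightarrow> s < 1 \<longrightarrow> 0 < s' \<longrightarrow> s' < 1 \<longrightarrow>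
      fst h \<bullet> (x + s *\<^sub>R e) \<le> snd h \<longrightarrow> fst h \<bullet> (x + s' *\<^sub>R e) \<le> snd h" by (intro allI impI)
    with zero_less_one show ?thesis by (intro exI conjI)
  next
    case False
    define g where "g = \<bar>fst h \<bullet> x - snd h\<bar>"
    define \<delta> where "\<delta> = g / (norm (fst h) * M + 1)"
    have den: "norm (fst h) * M + 1 > 0" using \<open>M \<ge> 0\<close> by (intro add_nonneg_pos) auto
    have "\<delta> > 0" using False den by (simp add: \<delta>_def g_def)
    have bd: "\<bar>s * (fst h \<bullet> e)\<bar> < g" if "norm e \<le> M" "0 < s" "s < \<delta>" for e s
    proof -
      have "\<bar>fst h \<bullet> e\<bar> \<le> norm (fst h) * norm e" by (rule Cauchy_Schwarz_ineq2)
      also have "\<dots> \<le> norm (fst h) * M" using that by (intro mult_left_mono) auto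
      finally have "s * \<bar>fst h \<bullet> e\<bar> \<le> s * (norm (fst h) * M + 1)" using that by (intro mult_left_mono) auto
      also have "\<dots> < \<delta> * (norm (fst h) * M + 1)" using that den by (intro mult_strict_right_mono) auto
      also have "\<dots> = g" using den by (simp add: \<delta>_def)
      finally show ?thesis using that by (simp add: abs_mult)
    qed
    have "fst h \<bullet> (x + s' *\<^sub>R e) \<le> snd h"
      if "norm e \<le> M" "0 < s" "s < \<delta>" "0 < s'" "s' < \<delta>" "fst h \<bullet> (x + s *\<^sub>R e) \<le> snd h" for e s s'
      using bd[OF that(1-3)] bd[OF that(1,4,5)] that(6)
      unfolding g_def inner_add_right inner_scaleR_right by linarith
    then have "\<forall>e s s'. norm e \<le> M \<longrightarrow> 0 < s \<longrightarrow> s < \<delta> \<longrightarrow> 0 < s' \<longrightarrow> s' < \<delta> \<longrightarrow>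
      fst h \<bullet> (x + s *\<^sub>R e) \<le> snd h \<longrightarrow> fst h \<bullet> (x + s' *\<^sub>R e) \<le> snd h" by (intro allI impI)
    with \<open>\<delta> > 0\<close> show ?thesis by (intro exI conjI)
  qed
  then have "\<forall>h. \<exists>\<delta>. \<delta> > 0 \<and> (\<forall>e s s'. norm e \<le> M \<longrightarrow> 0 < s \<longrightarrow> s < \<delta> \<longrightarrow> 0 < s' \<longrightarrow> s' < \<delta> \<longrightarrow>
    fst h \<bullet> (x + s *\<^sub>R e) \<le> snd h \<longrightarrow> fst h \<bullet> (x + s' *\<^sub>R e) \<le> snd h)" by (rule allI)
  from choice[OF this] obtain \<delta> where \<delta>0: "\<forall>h. \<delta> h > 0 \<and> (\<forall>e s s'. norm e \<le> M \<longrightarrow> 0 < s \<longrightarrow> s < \<delta> h \<longrightarrow>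
    0 < s' \<longrightarrow> s' < \<delta> h \<longrightarrow> fst h \<bullet> (x + s *\<^sub>R e) \<le> snd h \<longrightarrow> fst h \<bullet> (x + s' *\<^sub>R e) \<le> snd h)" ..
  note \<delta> = \<delta>0[rule_format, THEN conjunct1] \<delta>0[rule_format, THEN conjunct2, rule_format]
  define \<delta>' where "\<delta>' = Min (insert 1 (\<delta> ` H))"
  have "\<delta>' > 0" using \<delta>(1) \<open>finite H\<close> by (auto simp: \<delta>'_def)
  have le: "\<delta>' \<le> \<delta> h" if "h \<in> H" for h using that \<open>finite H\<close> by (auto simp: \<delta>'_def)
  have *: "n \<bullet> (x + s' *\<^sub>R e) \<le> c" if "(n, c) \<in> H" "norm e \<le> M" "0 < s" "s < \<delta>'" "0 < s'" "s' < \<delta>'"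
      "n \<bullet> (x + s *\<^sub>R e) \<le> c" for n c e s s'
    using \<delta>(2)[of e s "(n, c)" s'] le[OF that(1)] that by simp
  show ?thesis
  proof (intro exI[of _ \<delta>'] conjI \<open>\<delta>' > 0\<close>)
    show "\<forall>(n, c)\<in>H. \<forall>e s s'. norm e \<le> M \<longrightarrow> 0 < s \<longrightarrow> s < \<delta>' \<longrightarrow> 0 < s' \<longrightarrow> s' < \<delta>' \<longrightarrow>
      n \<bullet> (x + s *\<^sub>R e) \<le> c \<longrightarrow> n \<bullet> (x + s' *\<^sub>R e) \<le> c"
    proof clarify
      fix n c e s s' assume h: "(n, c) \<in> H" "norm e \<le> M" "0 < s" "s < \<delta>'" "0 < s'" "s' < \<delta>'"
        "n \<bullet> (x + s *\<^sub>R e) \<le> c"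
      show "n \<bullet> (x + s' *\<^sub>R e) \<le> c" by (rule *[OF h])
    qed
  qed
qed

definition polyhedral_field :: "'i set \<Rightarrow> ('i \<Rightarrow> ('a::euclidean_space \<times> real) set) \<Rightarrow> ('i \<Rightarrow> 'a) \<Rightarrow> ('a \<Rightarrow> 'a) \<Rightarrow> bool" where
  "polyhedral_field I H d v \<longleftrightarrow> finite I \<and> (\<forall>i\<in>I. finite (H i)) \<and>
     (\<forall>x. \<exists>i\<in>I. \<forall>(n, c)\<in>H i. n \<bullet> x \<le> c) \<and>
     (\<forall>i\<in>I. \<forall>x\<in>interior {x. \<forall>(n, c)\<in>H i. n \<bullet> x \<le> c}. v x = d i)"

lemma essential_valueI:
  fixes v :: "'a::euclidean_space \<Rightarrow> 'a"
  assumes "open S" "x \<in> closure S" "\<And>y. y \<in> S \<Longrightarrow> v y = w"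
  shows "w \<in> essential_values v x"
  unfolding essential_values_def
proof clarify
  fix \<delta> \<eta> :: real assume pos: "0 < \<delta>" "0 < \<eta>" and neg: "negligible {y \<in> ball x \<delta>. v y \<in> ball w \<eta>}"
  have "S \<inter> ball x \<delta> \<noteq> {}"
  proof -
    obtain y where "y \<in> S" "dist y x < \<delta>" using assms(2) pos(1) unfolding closure_approachable by blast
    then have "y \<in> S \<inter> ball x \<delta>" by (simp add: dist_commute)
    then show ?thesis by blast
  qed
  moreover have "open (S \<inter> ball x \<delta>)" using assms(1) by auto
  moreover have "negligible (S \<inter> ball x \<delta>)"
    by (rule negligible_subset[OF neg]) (use assms(3) pos in auto)
  ultimately show False using open_not_negligible by blast
qed

lemma convex_hull_subset_filippov_map:
  assumes "V \<subseteq> essential_values v x"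
  shows "convex hull V \<subseteq> filippov_map v x"
  using hull_mono[OF assms] closure_subset unfolding filippov_map_def by fast

text \<open>The direction must be a convex combination of the velocities of the polyhedra that the
  ray itself enters, which is a fixed point condition on e. Near x the polyhedra containing x + s e
  are the same for all s, so one sample point per ray decides.\<close>

lemma polyhedral_field_ray:
  fixes v :: "'a::euclidean_space \<Rightarrow> 'a"
  assumes pf: "polyhedral_field I H d v" and M: "\<And>i. i \<in> I \<Longrightarrow> norm (d i) \<le> M"
  shows "\<exists>e \<delta>. \<delta> > 0 \<and> norm e \<le> M \<and> (\<forall>s\<in>{0<..<\<delta>}. e \<in> filippov_map v (x + s *\<^sub>R e))"
proof -
  define P where "P i = {x. \<forall>(n, c)\<in>H i. n \<bullet> x \<le> c}" for i
  define J where "J = {i \<in> I. interior (P i) \<noteq> {}}"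
  have fin: "finite I" "finite J" "J \<subseteq> I" "\<And>i. i \<in> I \<Longrightarrow> finite (H i)"
    using pf by (auto simp: polyhedral_field_def J_def)
  have P_eq: "P i = \<Inter> ((\<lambda>(n, c). {x. n \<bullet> x \<le> c}) ` H i)" for i by (auto simp: P_def)
  have P: "closed (P i)" "convex (P i)" for i
    unfolding P_eq by (auto intro!: closed_INT convex_INT closed_halfspace_le convex_halfspace_le)
  have cov: "(\<Union>i\<in>J. P i) = UNIV"
  \<comment> \<open>The flat polyhedra are negligible, while the complement of the others is open;
    it is therefore empty.\<close>
  proof -
    have "negligible (\<Union>i\<in>I - J. P i)"
      using fin(1) P(2) by (intro negligible_Union) (auto simp: J_def negligible_convex_interior)
    moreover have "- (\<Union>i\<in>J. P i) \<subseteq> (\<Union>i\<in>I - J. P i)"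
    proof
      fix y assume "y \<in> - (\<Union>i\<in>J. P i)"
      moreover obtain i where "i \<in> I" "y \<in> P i" using pf unfolding polyhedral_field_def P_def by blast
      ultimately show "y \<in> (\<Union>i\<in>I - J. P i)" by blast
    qed
    ultimately have "negligible (- (\<Union>i\<in>J. P i))" by (rule negligible_subset)
    moreover have "open (- (\<Union>i\<in>J. P i))" using fin(2) P(1) by (intro open_Compl closed_UN) auto
    ultimately have "- (\<Union>i\<in>J. P i) = {}" using open_not_negligible by blast
    then show ?thesis by blast
  qed
  then have "J \<noteq> {}" by blast
  have ess: "d i \<in> essential_values v y" if "i \<in> J" "y \<in> P i" for i y
  proof (rule essential_valueI[of "interior (P i)"])
    show "y \<in> closure (interior (P i))"
      using convex_closure_interior[OF P(2)] that closure_subset by (fastforce simp: J_def)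
    show "v z = d i" if "z \<in> interior (P i)" for z
      using pf that \<open>i \<in> J\<close> unfolding polyhedral_field_def P_def J_def by blast
  qed simp
  obtain j where "j \<in> J" using \<open>J \<noteq> {}\<close> by blast
  then have "M \<ge> 0" using M[of j] fin(3) norm_ge_zero[of "d j"] by (meson order_trans subsetD)
  have "finite (\<Union>i\<in>J. H i)" using fin by auto
  from halfspaces_along_rays[OF this \<open>M \<ge> 0\<close>, of x] obtain \<delta> where \<delta>0: "\<delta> > 0"
    "\<forall>(n, c)\<in>(\<Union>i\<in>J. H i). \<forall>e s s'. norm e \<le> M \<longrightarrow> 0 < s \<longrightarrow> s < \<delta> \<longrightarrow> 0 < s' \<longrightarrow> s' < \<delta> \<longrightarrow>
      n \<bullet> (x + s *\<^sub>R e) \<le> c \<longrightarrow> n \<bullet> (x + s' *\<^sub>R e) \<le> c" by (elim exE conjE)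
  have \<delta>: "\<delta> > 0" "\<And>i n c e s s'. i \<in> J \<Longrightarrow> (n, c) \<in> H i \<Longrightarrow> norm e \<le> M \<Longrightarrow> 0 < s \<Longrightarrow> s < \<delta> \<Longrightarrow> 0 < s' \<Longrightarrow> s' < \<delta> \<Longrightarrow>
      n \<bullet> (x + s *\<^sub>R e) \<le> c \<Longrightarrow> n \<bullet> (x + s' *\<^sub>R e) \<le> c"
    using \<delta>0 by blast+
  \<comment> \<open>\<delta> / 2 serves as the sample parameter; any other value between 0 and
    \<delta> gives the same polyhedra.\<close>
  define C where "C i = (\<lambda>e. x + (\<delta> / 2) *\<^sub>R e) -` P i" for i
  have "\<exists>e\<in>convex hull (d ` J). e \<in> convex hull (d ` {i \<in> J. e \<in> C i})"
  proof (rule finite_closed_cover_fixed_point[OF fin(2) \<open>J \<noteq> {}\<close>])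
    show "closed (C i)" for i unfolding C_def
      by (intro continuous_closed_vimage P continuous_intros)
    show "convex hull (d ` J) \<subseteq> (\<Union>i\<in>J. C i)" 
    proof
      fix e
      have "x + (\<delta> / 2) *\<^sub>R e \<in> (\<Union>i\<in>J. P i)" using cov by blast
      then show "e \<in> (\<Union>i\<in>J. C i)" by (simp add: C_def)
    qed
  qed
  then obtain e where e: "e \<in> convex hull (d ` J)" "e \<in> convex hull (d ` {i \<in> J. e \<in> C i})" by blast
  have "convex hull (d ` J) \<subseteq> cball 0 M" using M fin(3) by (intro hull_minimal) auto
  then have "norm e \<le> M" using e(1) by auto
  have "e \<in> filippov_map v (x + s *\<^sub>R e)" if s: "s \<in> {0<..<\<delta>}" for s
  proof -
    have "d ` {i \<in> J. e \<in> C i} \<subseteq> essential_values v (x + s *\<^sub>R e)"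
    proof clarify
      fix i assume i: "i \<in> J" "e \<in> C i"
      have "n \<bullet> (x + s *\<^sub>R e) \<le> c" if "(n, c) \<in> H i" for n c
        using i(2) that \<delta>(1) s by (intro \<delta>(2)[OF i(1) that \<open>norm e \<le> M\<close>, of "\<delta> / 2" s]) (auto simp: C_def P_def)
      then have "x + s *\<^sub>R e \<in> P i" by (auto simp: P_def)
      then show "d i \<in> essential_values v (x + s *\<^sub>R e)" by (rule ess[OF i(1)])
    qed
    then show ?thesis using convex_hull_subset_filippov_map e(2) by blast
  qed
  then show ?thesis using \<delta>(1) \<open>norm e \<le> M\<close> by blast
qed

text \<open>Curves that are affine with an admissible velocity to the right of each time. This
  property is pointwise, so it passes to unions of chains even when the break points accumulate.\<close>

definition ray_curve :: "('a::euclidean_space \<Rightarrow> 'a set) \<Rightarrow> real \<Rightarrow> real \<Rightarrow> (real \<Rightarrow> 'a) \<Rightarrow> bool" where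
  "ray_curve F M \<tau> y \<longleftrightarrow> M-lipschitz_on {0..<\<tau>} y \<and> (\<forall>t\<in>{0..<\<tau>}. \<exists>e \<delta>. \<delta> > 0 \<and> t + \<delta> \<le> \<tau> \<and>
     (\<forall>s\<in>{0<..<\<delta>}. y (t + s) = y t + s *\<^sub>R e \<and> e \<in> F (y (t + s))))"

section \<open>Continuation of ray curves to the whole interval\<close>

text \<open>The Lipschitz bound provides a limit at \<tau>, from which an admissible ray continues
  the curve.\<close>

lemma ray_curve_extend:
  fixes F :: "'a::euclidean_space \<Rightarrow> 'a set"
  assumes y: "ray_curve F M \<tau> y" and \<tau>: "0 < \<tau>" "\<tau> < T"
    and ray: "\<And>x. \<exists>e \<delta>. \<delta> > 0 \<and> norm e \<le> M \<and> (\<forall>s\<in>{0<..<\<delta>}. e \<in> F (x + s *\<^sub>R e))"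
  shows "\<exists>\<tau>' y'. \<tau> < \<tau>' \<and> \<tau>' \<le> T \<and> ray_curve F M \<tau>' y' \<and> (\<forall>t\<in>{0..<\<tau>}. y' t = y t)"
proof -
  have "closure {0..<\<tau>} = {0..\<tau>}" using \<tau> by simp
  then obtain g where g: "M-lipschitz_on {0..\<tau>} g" "\<And>t. t \<in> {0..<\<tau>} \<Longrightarrow> g t = y t"
    using lipschitz_extend_closure[of M "{0..<\<tau>}" y] y unfolding ray_curve_def by auto
  obtain e \<delta>0 where e: "\<delta>0 > 0" "norm e \<le> M" "\<And>s. s \<in> {0<..<\<delta>0} \<Longrightarrow> e \<in> F (g \<tau> + s *\<^sub>R e)"
    using ray[of "g \<tau>"] by blast
  define \<delta> where "\<delta> = min \<delta>0 (T - \<tau>)"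
  have \<delta>: "\<delta> > 0" "\<delta> \<le> \<delta>0" "\<tau> + \<delta> \<le> T" using e(1) \<tau> by (auto simp: \<delta>_def)
  define y' where "y' = (\<lambda>t. if t \<le> \<tau> then g t else g \<tau> + (t - \<tau>) *\<^sub>R e)"
  have "M-lipschitz_on {\<tau>..\<tau> + \<delta>} (\<lambda>t. g \<tau> + (t - \<tau>) *\<^sub>R e)"
  proof (rule lipschitz_onI)
    fix s t :: real
    have "g \<tau> + (s - \<tau>) *\<^sub>R e - (g \<tau> + (t - \<tau>) *\<^sub>R e) = (s - t) *\<^sub>R e" by (simp add: algebra_simps)
    then show "dist (g \<tau> + (s - \<tau>) *\<^sub>R e) (g \<tau> + (t - \<tau>) *\<^sub>R e) \<le> M * dist s t"
      using e(2) by (simp add: dist_norm mult.commute[of _ "norm e"] mult_right_mono)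
  qed (use e(2) norm_ge_zero[of e] in linarith)
  then have "M-lipschitz_on {0..\<tau> + \<delta>} y'"
    unfolding y'_def by (intro lipschitz_on_concat g(1)) auto
  then have lip: "M-lipschitz_on {0..<\<tau> + \<delta>} y'" by (rule lipschitz_on_subset) auto
  have "\<exists>e \<delta>'. \<delta>' > 0 \<and> t + \<delta>' \<le> \<tau> + \<delta> \<and> (\<forall>s\<in>{0<..<\<delta>'}. y' (t + s) = y' t + s *\<^sub>R e \<and> e \<in> F (y' (t + s)))"
    if t: "t \<in> {0..<\<tau> + \<delta>}" for t
  proof (cases "t < \<tau>")
    case True
    then obtain e' \<delta>' where *: "\<delta>' > 0" "t + \<delta>' \<le> \<tau>"
      "\<And>s. s \<in> {0<..<\<delta>'} \<Longrightarrow> y (t + s) = y t + s *\<^sub>R e' \<and> e' \<in> F (y (t + s))"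
    proof -
      have "t \<in> {0..<\<tau>}" using t True by simp
      then show ?thesis using y that unfolding ray_curve_def by blast
    qed
    have "y' r = y r" if "0 \<le> r" "r < \<tau>" for r using that g(2)[of r] by (simp add: y'_def)
    then have "y' (t + s) = y' t + s *\<^sub>R e' \<and> e' \<in> F (y' (t + s))" if "s \<in> {0<..<\<delta>'}" for s
      using *(2) *(3)[OF that] t True that by auto
    then have "\<forall>s\<in>{0<..<\<delta>'}. y' (t + s) = y' t + s *\<^sub>R e' \<and> e' \<in> F (y' (t + s))" by (rule ballI)
    moreover have "t + \<delta>' \<le> \<tau> + \<delta>" using *(2) \<delta>(1) by simp
    ultimately show ?thesis using *(1) by (intro exI conjI)
  next
    case False
    have r: "y' r = g \<tau> + (r - \<tau>) *\<^sub>R e" if "r \<ge> \<tau>" for r using that by (auto simp: y'_def)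
    have "y' (t + s) = y' t + s *\<^sub>R e \<and> e \<in> F (y' (t + s))" if s: "s \<in> {0<..<\<tau> + \<delta> - t}" for s
    proof
      show "y' (t + s) = y' t + s *\<^sub>R e" 
      proof -
        have eq: "y' (t + s) = g \<tau> + (t + s - \<tau>) *\<^sub>R e" "y' t = g \<tau> + (t - \<tau>) *\<^sub>R e"
          using r[of t] r[of "t + s"] False s by simp_all
        show ?thesis unfolding eq by (simp add: algebra_simps)
      qed
      have "t + s - \<tau> \<in> {0<..<\<delta>0}" using s False \<delta>(2) by auto
      then show "e \<in> F (y' (t + s))" using r[of "t + s"] e(3)[of "t + s - \<tau>"] False s by simp
    qed
    then have "\<forall>s\<in>{0<..<\<tau> + \<delta> - t}. y' (t + s) = y' t + s *\<^sub>R e \<and> e \<in> F (y' (t + s))" by (rule ballI)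
    moreover have "\<tau> + \<delta> - t > 0" "t + (\<tau> + \<delta> - t) \<le> \<tau> + \<delta>" using t by auto
    ultimately show ?thesis by (intro exI conjI)
  qed
  then have "ray_curve F M (\<tau> + \<delta>) y'" using lip unfolding ray_curve_def by blast
  moreover have "y' t = y t" if "t \<in> {0..<\<tau>}" for t using that g(2)[OF that] by (simp add: y'_def)
  ultimately show ?thesis using \<delta> by (intro exI[of _ "\<tau> + \<delta>"] exI[of _ y']) auto
qed

text \<open>Step by step continuation could stall at an accumulation point of break points, hence
  Zorn's lemma. The prescribed initial ray allows two different solutions to be built from the same
  point.\<close>

lemma ray_curve_exists:
  fixes F :: "'a::euclidean_space \<Rightarrow> 'a set"
  assumes ray: "\<And>x. \<exists>e \<delta>. \<delta> > 0 \<and> norm e \<le> M \<and> (\<forall>s\<in>{0<..<\<delta>}. e \<in> F (x + s *\<^sub>R e))"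
    and e0: "norm e0 \<le> M" "\<And>s. s \<in> {0<..<\<tau>0} \<Longrightarrow> e0 \<in> F (x0 + s *\<^sub>R e0)" and \<tau>0: "0 < \<tau>0" "\<tau>0 \<le> T"
  shows "\<exists>y. ray_curve F M T y \<and> (\<forall>s\<in>{0..<\<tau>0}. y s = x0 + s *\<^sub>R e0)"
proof -
  \<comment> \<open>Passing to graphs turns extension into inclusion; with half-open domains the
    union of a chain is again such a graph.\<close>
  define graph where "graph \<tau> y = (\<lambda>t. (t, y t)) ` {0..<\<tau>}" for \<tau> and y :: "real \<Rightarrow> 'a"
  define good where "good \<tau> y \<longleftrightarrow> \<tau>0 \<le> \<tau> \<and> \<tau> \<le> T \<and> ray_curve F M \<tau> y \<and> (\<forall>s\<in>{0..<\<tau>0}. y s = x0 + s *\<^sub>R e0)" for \<tau> y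
  define \<A> where "\<A> = {graph \<tau> y |\<tau> y. good \<tau> y}"
  have graph_le: "\<tau> \<le> \<tau>'" "\<And>t. t \<in> {0..<\<tau>} \<Longrightarrow> y' t = y t" if "graph \<tau> y \<subseteq> graph \<tau>' y'" "0 < \<tau>" for \<tau> \<tau>' y y'
  proof -
    have *: "t < \<tau>' \<and> y' t = y t" if "t \<in> {0..<\<tau>}" for t
    proof -
      have "(t, y t) \<in> graph \<tau>' y'" using \<open>graph \<tau> y \<subseteq> graph \<tau>' y'\<close> that by (auto simp: graph_def)
      then show ?thesis by (auto simp: graph_def)
    qed
    then show "\<And>t. t \<in> {0..<\<tau>} \<Longrightarrow> y' t = y t" by blast
    show "\<tau> \<le> \<tau>'"
    proof (rule ccontr)
      assume "\<not> \<tau> \<le> \<tau>'"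
      then have "max 0 \<tau>' \<in> {0..<\<tau>}" using \<open>0 < \<tau>\<close> by auto
      from *[OF this] show False by simp
    qed
  qed
  have "\<A> \<noteq> {}"
  proof -
    define y where "y = (\<lambda>s. x0 + s *\<^sub>R e0)"
    have "M-lipschitz_on {0..<\<tau>0} y"
    proof (rule lipschitz_onI)
      fix s t :: real
      have "y s - y t = (s - t) *\<^sub>R e0" by (simp add: y_def algebra_simps)
      then show "dist (y s) (y t) \<le> M * dist s t"
        using e0(1) by (simp add: dist_norm mult.commute[of _ "norm e0"] mult_right_mono)
    qed (use e0(1) norm_ge_zero[of e0] in linarith)
    moreover have "\<exists>e \<delta>. \<delta> > 0 \<and> t + \<delta> \<le> \<tau>0 \<and> (\<forall>s\<in>{0<..<\<delta>}. y (t + s) = y t + s *\<^sub>R e \<and> e \<in> F (y (t + s)))"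
      if "t \<in> {0..<\<tau>0}" for t
    proof -
      have "y (t + s) = y t + s *\<^sub>R e0 \<and> e0 \<in> F (y (t + s))" if s: "s \<in> {0<..<\<tau>0 - t}" for s
      proof
        show "y (t + s) = y t + s *\<^sub>R e0" by (simp add: y_def algebra_simps)
        show "e0 \<in> F (y (t + s))" unfolding y_def by (rule e0(2)) (use s \<open>t \<in> {0..<\<tau>0}\<close> in auto)
      qed
      then have "\<forall>s\<in>{0<..<\<tau>0 - t}. y (t + s) = y t + s *\<^sub>R e0 \<and> e0 \<in> F (y (t + s))" by (rule ballI)
      moreover have "\<tau>0 - t > 0" "t + (\<tau>0 - t) \<le> \<tau>0" using that by auto
      ultimately show ?thesis by (intro exI conjI)
    qed
    ultimately have "good \<tau>0 y" using \<tau>0 by (auto simp: good_def ray_curve_def y_def)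
    then show ?thesis unfolding \<A>_def by blast
  qed
  moreover have "\<Union>\<C> \<in> \<A>" if "\<C> \<noteq> {}" and ch: "subset.chain \<A> \<C>" for \<C>
  proof -
    have "\<forall>G\<in>\<C>. \<exists>\<tau> y. G = graph \<tau> y \<and> good \<tau> y" using ch unfolding subset_chain_def \<A>_def by blast
    then obtain \<tau> y where ty: "\<And>G. G \<in> \<C> \<Longrightarrow> G = graph (\<tau> G) (y G)" "\<And>G. G \<in> \<C> \<Longrightarrow> good (\<tau> G) (y G)"
      by metis
    have pos: "0 < \<tau> G" "\<tau>0 \<le> \<tau> G" "\<tau> G \<le> T" if "G \<in> \<C>" for G using ty(2)[OF that] \<tau>0 by (auto simp: good_def)
    define \<tau>s where "\<tau>s = Sup (\<tau> ` \<C>)"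
    have bdd: "bdd_above (\<tau> ` \<C>)" using pos by (intro bdd_aboveI2[of _ _ T]) auto
    have le: "\<tau> G \<le> \<tau>s" if "G \<in> \<C>" for G unfolding \<tau>s_def using that bdd by (intro cSup_upper) auto
    have "\<tau>s \<le> T" unfolding \<tau>s_def using pos \<open>\<C> \<noteq> {}\<close> by (intro cSup_least) auto
    have ex: "\<exists>G\<in>\<C>. t < \<tau> G" if "t < \<tau>s" for t
      using that less_cSup_iff[of "\<tau> ` \<C>" t] bdd \<open>\<C> \<noteq> {}\<close> by (auto simp: \<tau>s_def)
    have agree: "y G t = y G' t" if G: "G \<in> \<C>" "G' \<in> \<C>" "0 \<le> t" "t < \<tau> G" "t < \<tau> G'" for G G' t
    proof -
      have "G \<subseteq> G' \<or> G' \<subseteq> G" using ch G unfolding subset_chain_def by blast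
      then show ?thesis
        using graph_le(2)[of "\<tau> G" "y G" "\<tau> G'" "y G'" t] graph_le(2)[of "\<tau> G'" "y G'" "\<tau> G" "y G" t]
          ty(1)[OF G(1)] ty(1)[OF G(2)] pos[OF G(1)] pos[OF G(2)] G by auto
    qed
    \<comment> \<open>Members of a chain agree at common times, so any one that is defined at t may
      be chosen.\<close>
    define ys where "ys t = y (SOME G. G \<in> \<C> \<and> t < \<tau> G) t" for t
    have ys: "ys t = y G t" if "G \<in> \<C>" "0 \<le> t" "t < \<tau> G" for G t
    proof -
      have "(SOME G. G \<in> \<C> \<and> t < \<tau> G) \<in> \<C> \<and> t < \<tau> (SOME G. G \<in> \<C> \<and> t < \<tau> G)"
        by (rule someI[of _ G]) (use that in auto)
      then show ?thesis unfolding ys_def using that by (intro agree) auto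
    qed
    have rc: "ray_curve F M (\<tau> G) (y G)" if "G \<in> \<C>" for G using ty(2)[OF that] by (simp add: good_def)
    have "ray_curve F M \<tau>s ys"
      unfolding ray_curve_def
    proof
      show "M-lipschitz_on {0..<\<tau>s} ys"
      proof (rule lipschitz_onI)
        fix s t assume st: "s \<in> {0..<\<tau>s}" "t \<in> {0..<\<tau>s}"
        then obtain G where G: "G \<in> \<C>" "max s t < \<tau> G" using ex[of "max s t"] by auto
        have "M-lipschitz_on {0..<\<tau> G} (y G)" using rc[OF G(1)] by (simp add: ray_curve_def)
        then have "dist (y G s) (y G t) \<le> M * dist s t" using st G(2) by (intro lipschitz_onD) auto
        then show "dist (ys s) (ys t) \<le> M * dist s t" using ys[OF G(1), of s] ys[OF G(1), of t] st G(2) by simp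
      qed (use e0(1) norm_ge_zero[of e0] in linarith)
      show "\<forall>t\<in>{0..<\<tau>s}. \<exists>e \<delta>. \<delta> > 0 \<and> t + \<delta> \<le> \<tau>s \<and>
          (\<forall>s\<in>{0<..<\<delta>}. ys (t + s) = ys t + s *\<^sub>R e \<and> e \<in> F (ys (t + s)))"
      proof
        fix t assume t: "t \<in> {0..<\<tau>s}"
        then obtain G where G: "G \<in> \<C>" "t < \<tau> G" using ex[of t] by auto
        then have "t \<in> {0..<\<tau> G}" using t by simp
        then obtain e \<delta> where *: "\<delta> > 0" "t + \<delta> \<le> \<tau> G"
          "\<And>s. s \<in> {0<..<\<delta>} \<Longrightarrow> y G (t + s) = y G t + s *\<^sub>R e \<and> e \<in> F (y G (t + s))"
          using rc[OF G(1)] unfolding ray_curve_def by blast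
        have "ys (t + s) = ys t + s *\<^sub>R e \<and> e \<in> F (ys (t + s))" if "s \<in> {0<..<\<delta>}" for s
          using *(2) *(3)[OF that] ys[OF G(1), of t] ys[OF G(1), of "t + s"] t that by auto
        then have "\<forall>s\<in>{0<..<\<delta>}. ys (t + s) = ys t + s *\<^sub>R e \<and> e \<in> F (ys (t + s))" by (rule ballI)
        moreover have "t + \<delta> \<le> \<tau>s" using *(2) le[OF G(1)] by simp
        ultimately show "\<exists>e \<delta>. \<delta> > 0 \<and> t + \<delta> \<le> \<tau>s \<and>
            (\<forall>s\<in>{0<..<\<delta>}. ys (t + s) = ys t + s *\<^sub>R e \<and> e \<in> F (ys (t + s)))"
          using *(1) by (intro exI conjI)
      qed
    qed
    moreover obtain G0 where G0: "G0 \<in> \<C>" using \<open>\<C> \<noteq> {}\<close> by blast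
    have "\<tau>0 \<le> \<tau>s" using pos(2)[OF G0] le[OF G0] by simp
    moreover have "\<forall>s\<in>{0..<\<tau>0}. ys s = x0 + s *\<^sub>R e0"
      using ys[OF G0] ty(2)[OF G0] pos(2)[OF G0] by (auto simp: good_def)
    ultimately have "good \<tau>s ys" using \<open>\<tau>s \<le> T\<close> by (simp add: good_def)
    moreover have "\<Union>\<C> = graph \<tau>s ys"
    proof (rule set_eqI)
      fix p :: "real \<times> 'a"
      obtain t z where p: "p = (t, z)" by (cases p)
      have mem: "(t, z) \<in> G \<longleftrightarrow> 0 \<le> t \<and> t < \<tau> G \<and> z = y G t" if "G \<in> \<C>" for G
        by (subst ty(1)[OF that]) (auto simp: graph_def)
      show "p \<in> \<Union>\<C> \<longleftrightarrow> p \<in> graph \<tau>s ys"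
      proof
        assume "p \<in> \<Union>\<C>"
        then obtain G where G: "G \<in> \<C>" "(t, z) \<in> G" using p by blast
        then show "p \<in> graph \<tau>s ys" using mem[OF G(1)] le[OF G(1)] ys[OF G(1), of t] p by (auto simp: graph_def)
      next
        assume "p \<in> graph \<tau>s ys"
        then have t: "0 \<le> t" "t < \<tau>s" "z = ys t" using p by (auto simp: graph_def)
        then obtain G where G: "G \<in> \<C>" "t < \<tau> G" using ex by blast
        then show "p \<in> \<Union>\<C>" using mem[OF G(1)] ys[OF G(1), of t] t p by auto
      qed
    qed
    ultimately show ?thesis unfolding \<A>_def by blast
  qed
  ultimately obtain G where G: "G \<in> \<A>" "\<And>G'. G' \<in> \<A> \<Longrightarrow> G \<subseteq> G' \<Longrightarrow> G' = G"
    using subset_Zorn_nonempty[of \<A>] by blast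
  then obtain \<tau> y where ty: "G = graph \<tau> y" "good \<tau> y" unfolding \<A>_def by blast
  have "\<tau> = T"
  proof (rule ccontr)
    assume "\<tau> \<noteq> T"
    then have "0 < \<tau>" "\<tau> < T" "ray_curve F M \<tau> y" using ty(2) \<tau>0 by (auto simp: good_def)
    from ray_curve_extend[OF this(3,1,2) ray] obtain \<tau>' y' where e:
      "\<tau> < \<tau>'" "\<tau>' \<le> T" "ray_curve F M \<tau>' y'" "\<forall>t\<in>{0..<\<tau>}. y' t = y t" by blast
    have "good \<tau>' y'" using e ty(2) by (auto simp: good_def)
    then have "graph \<tau>' y' \<in> \<A>" unfolding \<A>_def by blast
    moreover have "G \<subseteq> graph \<tau>' y'" using e ty(1) by (auto simp: graph_def)
    ultimately have "graph \<tau>' y' = graph \<tau> y" using G(2) ty(1) by blast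
    moreover have "(\<tau>, y' \<tau>) \<in> graph \<tau>' y'" using e \<open>0 < \<tau>\<close> by (auto simp: graph_def)
    ultimately show False by (auto simp: graph_def)
  qed
  then show ?thesis using ty(2) by (auto simp: good_def)
qed

text \<open>The curve is differentiable with an admissible velocity at every time strictly inside
  one of the affine intervals. The remaining times are countably many, hence negligible.\<close>

lemma ray_curve_filippov_solution:
  fixes v :: "'a::euclidean_space \<Rightarrow> 'a"
  assumes y: "ray_curve (filippov_map v) M T y" and "T > 0" and "y 0 = x0"
  shows "\<exists>g. filippov_solution v T x0 g \<and> (\<forall>t\<in>{0..<T}. g t = y t)"
proof -
  have "closure {0..<T} = {0..T}" using \<open>T > 0\<close> by simp
  then obtain g where g: "M-lipschitz_on {0..T} g" "\<And>t. t \<in> {0..<T} \<Longrightarrow> g t = y t"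
    using lipschitz_extend_closure[of M "{0..<T}" y] y unfolding ray_curve_def by auto
  obtain e \<delta> where e: "\<And>t. t \<in> {0..<T} \<Longrightarrow> \<delta> t > 0" "\<And>t. t \<in> {0..<T} \<Longrightarrow> t + \<delta> t \<le> T"
    "\<And>t s. t \<in> {0..<T} \<Longrightarrow> s \<in> {0<..<\<delta> t} \<Longrightarrow> y (t + s) = y t + s *\<^sub>R e t"
    "\<And>t s. t \<in> {0..<T} \<Longrightarrow> s \<in> {0<..<\<delta> t} \<Longrightarrow> e t \<in> filippov_map v (y (t + s))"
  proof -
    have "\<forall>t\<in>{0..<T}. \<exists>p. snd p > 0 \<and> t + snd p \<le> T \<and>
        (\<forall>s\<in>{0<..<snd p}. y (t + s) = y t + s *\<^sub>R fst p \<and> fst p \<in> filippov_map v (y (t + s)))"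
      using y unfolding ray_curve_def by simp
    from bchoice[OF this] obtain p where p: "\<forall>t\<in>{0..<T}. snd (p t) > 0 \<and> t + snd (p t) \<le> T \<and>
        (\<forall>s\<in>{0<..<snd (p t)}. y (t + s) = y t + s *\<^sub>R fst (p t) \<and> fst (p t) \<in> filippov_map v (y (t + s)))" ..
    show ?thesis by (rule that[of "\<lambda>t. snd (p t)" "\<lambda>t. fst (p t)"]) (use p in blast)+
  qed
  \<comment> \<open>The intervals that start at points of N are open, nonempty and pairwise
    disjoint, since no point of N lies inside another's interval.\<close>
  define N where "N = {t \<in> {0..<T}. \<forall>r\<in>{0..<T}. \<not> (r < t \<and> t < r + \<delta> r)}"
  have "countable N"
  proof -
    let ?I = "\<lambda>t. {t<..<t + \<delta> t}"
    have disj: "?I s \<inter> ?I t = {}" if "s \<in> N" "t \<in> N" "s < t" for s t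
    proof -
      have "s + \<delta> s \<le> t" using that by (force simp: N_def)
      then show ?thesis by auto
    qed
    have disj': "?I s \<inter> ?I t = {}" if "s \<in> N" "t \<in> N" "s \<noteq> t" for s t
      using disj[of s t] disj[of t s] that by (cases "s < t") auto
    have ne: "?I t \<noteq> {}" if "t \<in> N" for t using that e(1)[of t] by (auto simp: N_def)
    have "inj_on ?I N"
    proof (rule inj_onI)
      fix s t assume st: "s \<in> N" "t \<in> N" "?I s = ?I t"
      then show "s = t" using disj'[OF st(1,2)] ne[OF st(1)] by (metis inf.idem)
    qed
    moreover have "countable (?I ` N)"
    proof (rule countable_disjoint_open_subsets)
      show "pairwise disjnt (?I ` N)" using disj' by (auto simp: pairwise_def disjnt_def)
    qed auto
    ultimately show ?thesis using countable_image_inj_on by blast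
  qed
  then have "insert T N \<in> null_sets lebesgue"
    by (intro null_sets_completionI countable_imp_null_set_lborel) simp
  then have "AE t in lebesgue. t \<notin> insert T N" by (rule AE_not_in)
  then have "AE t in lebesgue. t \<in> {0..T} \<longrightarrow>
      (\<exists>w \<in> filippov_map v (g t). (g has_vector_derivative w) (at t within {0..T}))"
  proof eventually_elim
    case (elim t)
    show ?case
    proof
      assume t: "t \<in> {0..T}"
      then have tT: "t \<in> {0..<T}" using elim by auto
      then obtain r where r: "r \<in> {0..<T}" "r < t" "t < r + \<delta> r" using elim by (auto simp: N_def)
      have eq: "g s = y r + (s - r) *\<^sub>R e r" if "s \<in> {r<..<r + \<delta> r}" for s
      proof -
        have "s - r \<in> {0<..<\<delta> r}" "s \<in> {0..<T}" using that r(1) e(2)[OF r(1)] by auto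
        then show ?thesis using e(3)[OF r(1), of "s - r"] g(2)[of s] by simp
      qed
      have "((\<lambda>s. y r + (s - r) *\<^sub>R e r) has_vector_derivative e r) (at t)"
        by (auto intro!: derivative_eq_intros)
      then have "(g has_vector_derivative e r) (at t)"
        by (rule has_vector_derivative_transform_within_open[where S = "{r<..<r + \<delta> r}"]) (use r eq in auto)
      then have "(g has_vector_derivative e r) (at t within {0..T})" by (rule has_vector_derivative_at_within)
      moreover have "e r \<in> filippov_map v (g t)"
        using e(4)[OF r(1), of "t - r"] r g(2)[OF tT] by simp
      ultimately show "\<exists>w \<in> filippov_map v (g t). (g has_vector_derivative w) (at t within {0..T})" by blast
    qed
  qed
  moreover have "g 0 = x0" using g(2)[of 0] assms by simp
  ultimately have "filippov_solution v T x0 g"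
    using lipschitz_on_imp_abs_continuous_on[OF g(1)] by (simp add: filippov_solution_def)
  then show ?thesis using g(2) by blast
qed

text \<open>Each of the two rays is continued to a solution on all of [0, T]; uniqueness makes both
  agree with X, hence with each other, while the rays separate at once.\<close>

lemma polyhedral_field_not_unique:
  fixes v :: "'a::euclidean_space \<Rightarrow> 'a"
  assumes pf: "polyhedral_field I H d v" and "T > 0" and \<tau>: "\<tau> > 0" and "u \<noteq> w"
    and u: "\<And>s. s \<in> {0<..<\<tau>} \<Longrightarrow> u \<in> filippov_map v (x0 + s *\<^sub>R u)"
    and w: "\<And>s. s \<in> {0<..<\<tau>} \<Longrightarrow> w \<in> filippov_map v (x0 + s *\<^sub>R w)"
  shows "\<not> the_filippov_solution v T x0 X"
proof
  assume X: "the_filippov_solution v T x0 X"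
  define M where "M = Max (insert (norm u) (insert (norm w) ((\<lambda>i. norm (d i)) ` I)))"
  have fin: "finite I" using pf by (simp add: polyhedral_field_def)
  have M: "norm u \<le> M" "norm w \<le> M" "\<And>i. i \<in> I \<Longrightarrow> norm (d i) \<le> M"
    unfolding M_def using fin by (intro Max_ge; simp)+
  define \<tau>0 where "\<tau>0 = min \<tau> T"
  have \<tau>0: "0 < \<tau>0" "\<tau>0 \<le> T" "\<tau>0 \<le> \<tau>" using \<tau> \<open>T > 0\<close> by (auto simp: \<tau>0_def)
  have X_eq: "X s = x0 + s *\<^sub>R e"
    if e: "norm e \<le> M" "\<And>s. s \<in> {0<..<\<tau>} \<Longrightarrow> e \<in> filippov_map v (x0 + s *\<^sub>R e)" and s: "s \<in> {0..<\<tau>0}" for e s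
  proof -
    obtain y where y: "ray_curve (filippov_map v) M T y" "\<forall>s\<in>{0..<\<tau>0}. y s = x0 + s *\<^sub>R e"
      using ray_curve_exists[OF polyhedral_field_ray[OF pf M(3)] e(1) _ \<tau>0(1,2)] e(2) \<tau>0(3) by force
    have "y 0 = x0" using y(2) \<tau>0(1) by force
    then obtain g where g: "filippov_solution v T x0 g" "\<forall>t\<in>{0..<T}. g t = y t"
      using ray_curve_filippov_solution[OF y(1) \<open>T > 0\<close>] by blast
    have "s \<in> {0..<T}" "s \<in> {0..T}" using s \<tau>0(2) by auto
    then show ?thesis using g y(2) s X unfolding the_filippov_solution_def by metis
  qed
  have "\<tau>0 / 2 \<in> {0..<\<tau>0}" using \<tau>0(1) by simp
  then have "x0 + (\<tau>0 / 2) *\<^sub>R u = x0 + (\<tau>0 / 2) *\<^sub>R w" using X_eq[OF M(1) u] X_eq[OF M(2) w] by metis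
  then show False using \<open>u \<noteq> w\<close> \<tau>0(1) by simp
qed

section \<open>The finite case\<close>

text \<open>The W-domains of two pairs lie on different sides of one hyperplane: that of the ties between
  the two points of \<open>A\<close> or, if these coincide, the reflected one of the ties between the points of \<open>B\<close>.\<close>

definition separator :: "'a::euclidean_space \<times> 'a \<Rightarrow> 'a \<times> 'a \<Rightarrow> 'a \<times> real" where
  "separator q q' = (if fst q \<noteq> fst q'
     then (fst q' - fst q, (fst q' \<bullet> fst q' - fst q \<bullet> fst q) / 2)
     else (snd q - snd q', (snd q' \<bullet> snd q' - snd q \<bullet> snd q) / 2 - 2 * (fst q \<bullet> (snd q' - snd q))))"

lemma separator_swap: "separator q' q = (- fst (separator q q'), - snd (separator q q'))"
  by (auto simp: separator_def inner_diff_right field_simps)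

lemma separator_nonzero: "q \<noteq> q' \<Longrightarrow> fst (separator q q') \<noteq> 0"
  by (auto simp: separator_def prod_eq_iff)

lemma dist_le_iff_halfspace:
  fixes x a a' :: "'a::euclidean_space"
  shows "dist x a \<le> dist x a' \<longleftrightarrow> (a' - a) \<bullet> x \<le> (a' \<bullet> a' - a \<bullet> a) / 2"
  unfolding dist_norm norm_le
  by (simp add: inner_diff_left inner_diff_right inner_commute field_simps)

lemma dist_reflect_le_iff_halfspace:
  fixes x a b b' :: "'a::euclidean_space"
  shows "dist (2 *\<^sub>R a - x) b \<le> dist (2 *\<^sub>R a - x) b' \<longleftrightarrow>
    (b - b') \<bullet> x \<le> (b' \<bullet> b' - b \<bullet> b) / 2 - 2 * (a \<bullet> (b' - b))"
proof -
  have "(b' - b) \<bullet> (2 *\<^sub>R a - x) = 2 * (a \<bullet> (b' - b)) + (b - b') \<bullet> x"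
    by (simp add: inner_diff_left inner_diff_right inner_commute)
  then show ?thesis unfolding dist_le_iff_halfspace by linarith
qed

definition displacement :: "'a::euclidean_space \<times> 'a \<Rightarrow> 'a" where
  "displacement q = snd q - fst q"

section \<open>Cells of finite sets as polyhedra\<close>

locale finite_rrr =
  fixes A B :: "'a::euclidean_space set" and pA pB :: "'a \<Rightarrow> 'a"
  assumes finite_A: "finite A" and finite_B: "finite B"
    and proj_A: "metric_projection A pA" and proj_B: "metric_projection B pB"
begin

abbreviation "v \<equiv> rrr_field pA pB"
abbreviation "W \<equiv> W_domain pA pB"
abbreviation "J \<equiv> junctions A B pA pB"

definition cell :: "'a \<Rightarrow> 'a \<times> 'a" where
  "cell x = (pA x, pB (reflector pA x))"

lemma mem_W_iff: "x \<in> W q \<longleftrightarrow> cell x = q"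
  by (cases q) (auto simp: W_domain_def cell_def)

lemma pA: "pA x \<in> A" "a \<in> A \<Longrightarrow> dist x (pA x) \<le> dist x a"
  using proj_A by (auto simp: metric_projection_def nearest_points_def)

lemma pB: "pB x \<in> B" "b \<in> B \<Longrightarrow> dist x (pB x) \<le> dist x b"
  using proj_B by (auto simp: metric_projection_def nearest_points_def)

lemma cell_mem: "cell x \<in> A \<times> B"
  using pA(1) pB(1) by (simp add: cell_def)

lemma field_eq_displacement: "v x = displacement (cell x)"
  by (simp add: rrr_field_def displacement_def cell_def)

lemma finite_range_field: "finite (range v)"
proof -
  have "range v \<subseteq> displacement ` (A \<times> B)" using field_eq_displacement cell_mem by auto
  then show ?thesis using finite_A finite_B by (meson finite_SigmaI finite_imageI finite_subset)
qed

lemma W_subset_halfspace: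
  assumes "q' \<in> A \<times> B" "x \<in> W q"
  shows "fst (separator q q') \<bullet> x \<le> snd (separator q q')"
proof (cases "fst q = fst q'")
  case True
  have "dist (2 *\<^sub>R fst q - x) (snd q) \<le> dist (2 *\<^sub>R fst q - x) (snd q')"
    using assms pB(2)[of "snd q'" "reflector pA x"] by (auto simp: mem_W_iff cell_def reflector_def)
  then show ?thesis unfolding dist_reflect_le_iff_halfspace using True by (simp add: separator_def)
next
  case False
  have "dist x (fst q) \<le> dist x (fst q')"
    using assms pA(2)[of "fst q'" x] by (auto simp: mem_W_iff cell_def)
  then show ?thesis unfolding dist_le_iff_halfspace using False by (simp add: separator_def)
qed

lemma W_subset_halfspace':
  assumes "q \<in> A \<times> B" "x \<in> W q'"
  shows "fst (separator q q') \<bullet> x \<ge> snd (separator q q')"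
  using W_subset_halfspace[OF assms] by (simp add: separator_swap[of q' q])

text \<open>The closed polyhedron of points for which q is a possible choice. The reflection is
  taken at the fixed point \<open>fst q\<close> instead of \<open>pA x\<close>, which makes the
  conditions on the second component affine in x.\<close>

definition cell_halfspaces :: "'a \<times> 'a \<Rightarrow> ('a \<times> real) set" where
  "cell_halfspaces q = (\<lambda>a'. (a' - fst q, (a' \<bullet> a' - fst q \<bullet> fst q) / 2)) ` A \<union>
     (\<lambda>b'. (snd q - b', (b' \<bullet> b' - snd q \<bullet> snd q) / 2 - 2 * (fst q \<bullet> (b' - snd q)))) ` B"

lemma mem_cell_halfspaces:
  "(\<forall>(n, c)\<in>cell_halfspaces q. n \<bullet> x \<le> c) \<longleftrightarrow>
     (\<forall>a'\<in>A. dist x (fst q) \<le> dist x a') \<and> (\<forall>b'\<in>B. dist (2 *\<^sub>R fst q - x) (snd q) \<le> dist (2 *\<^sub>R fst q - x) b')"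
  unfolding dist_reflect_le_iff_halfspace
  unfolding dist_le_iff_halfspace cell_halfspaces_def by (simp add: ball_Un)

text \<open>At an interior point the inequalities with nonzero normal are strict, so no ties are
  left and both projections are forced.\<close>

lemma polyhedral_field_rrr: "polyhedral_field (A \<times> B) cell_halfspaces displacement v"
  unfolding polyhedral_field_def
proof (intro conjI ballI allI)
  show "finite (A \<times> B)" using finite_A finite_B by simp
  show "finite (cell_halfspaces q)" for q using finite_A finite_B by (simp add: cell_halfspaces_def)
  show "\<exists>q\<in>A \<times> B. \<forall>(n, c)\<in>cell_halfspaces q. n \<bullet> x \<le> c" for x
    unfolding mem_cell_halfspaces using cell_mem[of x] pA(2)[of _ x] pB(2)[of _ "reflector pA x"]
    by (intro bexI[of _ "cell x"]) (auto simp: cell_def reflector_def)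
  fix q x assume q: "q \<in> A \<times> B" and x: "x \<in> interior {x. \<forall>(n, c)\<in>cell_halfspaces q. n \<bullet> x \<le> c}"
  \<comment> \<open>The candidate equal to the chosen point contributes the trivial inequality with
    normal 0, which is never strict.\<close>
  have strict: "n \<bullet> x < c" if "(n, c) \<in> cell_halfspaces q" "n \<noteq> 0" for n c
  proof -
    have "{x. \<forall>(n, c)\<in>cell_halfspaces q. n \<bullet> x \<le> c} \<subseteq> {x. n \<bullet> x \<le> c}" using that(1) by blast
    then have "x \<in> interior {x. n \<bullet> x \<le> c}" using x interior_mono by blast
    then show ?thesis using that(2) by (simp add: interior_halfspace_le)
  qed
  have a: "pA x = fst q"
  proof (rule ccontr)
    assume ne: "pA x \<noteq> fst q"
    have "(pA x - fst q) \<bullet> x < (pA x \<bullet> pA x - fst q \<bullet> fst q) / 2"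
      using ne pA(1)[of x] by (intro strict) (auto simp: cell_halfspaces_def)
    moreover have "(fst q - pA x) \<bullet> x \<le> (fst q \<bullet> fst q - pA x \<bullet> pA x) / 2"
      using pA(2)[of "fst q" x] q unfolding dist_le_iff_halfspace by auto
    ultimately show False by (simp add: inner_diff_left field_simps)
  qed
  have b: "pB (2 *\<^sub>R fst q - x) = snd q" (is "?b = _")
  proof (rule ccontr)
    assume ne: "?b \<noteq> snd q"
    have "(snd q - ?b) \<bullet> x < (?b \<bullet> ?b - snd q \<bullet> snd q) / 2 - 2 * (fst q \<bullet> (?b - snd q))"
      using ne pB(1)[of "2 *\<^sub>R fst q - x"] by (intro strict) (auto simp: cell_halfspaces_def)
    moreover have "(?b - snd q) \<bullet> x \<le> (snd q \<bullet> snd q - ?b \<bullet> ?b) / 2 - 2 * (fst q \<bullet> (snd q - ?b))"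
      using pB(2)[of "snd q" "2 *\<^sub>R fst q - x"] q unfolding dist_reflect_le_iff_halfspace by auto
    ultimately show False by (simp add: inner_diff_left inner_diff_right field_simps)
  qed
  show "v x = displacement q"
    using a b by (simp add: field_eq_displacement cell_def reflector_def)
qed

section \<open>Local structure of the field away from junctions\<close>

definition meeting :: "'a \<Rightarrow> ('a \<times> 'a) set" where
  "meeting z = {q \<in> A \<times> B. z \<in> closure (W q)}"

lemma finite_meeting: "finite (meeting z)"
  unfolding meeting_def by (rule finite_subset[of _ "A \<times> B"]) (use finite_A finite_B in auto)

lemma not_junction_iff: "z \<notin> J \<longleftrightarrow> card (meeting z) \<le> 2"
  unfolding junctions_def meeting_def mem_Collect_eq by linarith

lemma cell_in_meeting: "cell z \<in> meeting z"
proof -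
  have "z \<in> closure (W (cell z))" by (rule subsetD[OF closure_subset]) (simp add: mem_W_iff)
  then show ?thesis using cell_mem by (simp add: meeting_def)
qed

text \<open>The closures of the finitely many other domains form a closed set that misses z.\<close>

lemma locally_only_meeting: "\<exists>r>0. \<forall>x\<in>ball z r. cell x \<in> meeting z"
proof -
  let ?U = "- (\<Union>q\<in>A \<times> B - meeting z. closure (W q))"
  have "open ?U" using finite_A finite_B by (intro open_Compl closed_UN) auto
  moreover have "z \<in> ?U"
  proof
    assume "z \<in> (\<Union>q\<in>A \<times> B - meeting z. closure (W q))"
    then obtain q where "q \<in> A \<times> B - meeting z" "z \<in> closure (W q)" by (rule UN_E)
    then show False by (simp add: meeting_def)
  qed
  ultimately obtain r where r: "r > 0" "ball z r \<subseteq> ?U" by (rule openE)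
  have "cell x \<in> meeting z" if "x \<in> ball z r" for x
  proof (rule ccontr)
    assume "cell x \<notin> meeting z"
    moreover have "x \<in> closure (W (cell x))" by (rule subsetD[OF closure_subset]) (simp add: mem_W_iff)
    ultimately have 1: "x \<in> (\<Union>q\<in>A \<times> B - meeting z. closure (W q))"
      using cell_mem[of x] by (intro UN_I[of "cell x"] DiffI)
    have "x \<in> ?U" using r(2) that by (rule subsetD)
    from ComplD[OF this] 1 show False by (rule notE)
  qed
  then show ?thesis using r(1) by blast
qed

lemma two_cell_field_pair:
  assumes "meeting z = {q, q'}" and ball: "\<forall>x\<in>ball z r. cell x \<in> meeting z"
  shows "two_cell_field v (ball z r) (fst (separator q q')) (snd (separator q q')) (displacement q) (displacement q')"
  unfolding two_cell_field_def
proof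
  fix x assume "x \<in> ball z r"
  then have x: "cell x = q \<or> cell x = q'" using assms by blast
  have "q \<in> A \<times> B" "q' \<in> A \<times> B" using assms(1) unfolding meeting_def by blast+
  then have 1: "cell x = q \<Longrightarrow> fst (separator q q') \<bullet> x \<le> snd (separator q q')"
    "cell x = q' \<Longrightarrow> fst (separator q q') \<bullet> x \<ge> snd (separator q q')"
    using W_subset_halfspace[of q' x q] W_subset_halfspace'[of q x q'] by (simp_all only: mem_W_iff)
  show "v x \<in> {displacement q, displacement q'} \<and>
      (fst (separator q q') \<bullet> x < snd (separator q q') \<longrightarrow> v x = displacement q) \<and>
      (snd (separator q q') < fst (separator q q') \<bullet> x \<longrightarrow> v x = displacement q')"
    unfolding field_eq_displacement
  proof (intro conjI impI)
    show "displacement (cell x) \<in> {displacement q, displacement q'}" using x by blast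
    show "displacement (cell x) = displacement q" if "fst (separator q q') \<bullet> x < snd (separator q q')"
      using x 1(2) that by (metis not_less)
    show "displacement (cell x) = displacement q'" if "snd (separator q q') < fst (separator q q') \<bullet> x"
      using x 1(1) that by (metis not_less)
  qed
qed

section \<open>Branching interfaces and failure of uniqueness\<close>

text \<open>Formed with closures so that the set is closed: a solution that meets it then has a
  first time of doing so.\<close>

definition branching :: "'a set" where
  "branching = (\<Union>q\<in>A \<times> B. \<Union>q'\<in>{q' \<in> A \<times> B. \<not> well_posed_switch (fst (separator q q')) (displacement q) (displacement q')}.
     closure (W q) \<inter> closure (W q'))"

lemma closed_branching: "closed branching"
proof -
  have "finite (A \<times> B)" using finite_A finite_B by simp
  then show ?thesis unfolding branching_def
    by (intro closed_UN ballI closed_Int closed_closure) (auto intro: finite_subset[of _ "A \<times> B"])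
qed

lemma well_posed_locally:
  assumes "z \<notin> J" "z \<notin> branching"
  shows "\<exists>r n c u w. r > 0 \<and> two_cell_field v (ball z r) n c u w \<and> well_posed_switch n u w"
proof -
  obtain r where r: "r > 0" "\<forall>x\<in>ball z r. cell x \<in> meeting z" using locally_only_meeting by blast
  have "card (meeting z) \<noteq> 0" using finite_meeting cell_in_meeting[of z] by auto
  moreover have "card (meeting z) \<le> 2" using assms(1) by (simp add: not_junction_iff)
  ultimately consider "card (meeting z) = 1" | "card (meeting z) = 2" by linarith
  then have "\<exists>q q'. meeting z = {q, q'}"
  proof cases
    case 1
    then obtain q where "meeting z = {q}" by (rule card_1_singletonE)
    \<comment> \<open>A single domain counts as a degenerate pair, with separator (0, 0) and equal
      velocities, which is well-posed.\<close>
    then have "meeting z = {q, q}" by simp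
    then show ?thesis by (intro exI)
  next
    case 2
    then show ?thesis by (auto simp: card_2_iff)
  qed
  then obtain q q' where q: "meeting z = {q, q'}" by (elim exE)
  have "well_posed_switch (fst (separator q q')) (displacement q) (displacement q')"
  proof (rule ccontr)
    assume "\<not> ?thesis"
    moreover have "q \<in> A \<times> B" "q' \<in> A \<times> B" "z \<in> closure (W q) \<inter> closure (W q')"
      using q unfolding meeting_def by blast+
    ultimately have "z \<in> branching" unfolding branching_def by blast
    then show False using assms(2) by simp
  qed
  then show ?thesis using r(1) two_cell_field_pair[OF q r(2)] by blast
qed

lemma half_ball_closure:
  fixes n :: 'a
  assumes "open S" "x \<in> S" "n \<noteq> 0" "n \<bullet> x \<le> c"
  shows "x \<in> closure (S \<inter> {y. n \<bullet> y < c})"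
  using open_Int_closure_subset[OF assms(1), of "{y. n \<bullet> y < c}"] assms
  by (auto simp: closure_halfspace_lt)

text \<open>Away from junctions only q and q' meet at z, so they fill the two open half-balls cut
  off by their separator. Every point of the hyperplane inside the ball is then in both closures;
  this last conjunct later turns being on the hyperplane into membership in
  \<open>branching\<close>.\<close>

lemma branching_locally:
  assumes "z \<notin> J" "z \<in> branching"
  shows "\<exists>r n c u w. r > 0 \<and> n \<noteq> 0 \<and> n \<bullet> z = c \<and> u \<noteq> w \<and> n \<bullet> u \<le> 0 \<and> 0 \<le> n \<bullet> w \<and>
    two_cell_field v (ball z r) n c u w \<and> (\<forall>x\<in>ball z r. n \<bullet> x = c \<longrightarrow> x \<in> branching)"
proof -
  obtain q q' where q: "q \<in> meeting z" "q' \<in> meeting z"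
    "\<not> well_posed_switch (fst (separator q q')) (displacement q) (displacement q')"
    using assms(2) unfolding branching_def meeting_def by blast
  define n where "n = fst (separator q q')"
  define c where "c = snd (separator q q')"
  let ?u = "displacement q" and ?w = "displacement q'"
  have uw: "?u \<noteq> ?w" "n \<bullet> ?u \<le> 0" "0 \<le> n \<bullet> ?w" using q(3) by (auto simp: well_posed_switch_def n_def)
  then have "q \<noteq> q'" by auto
  then have "n \<noteq> 0" unfolding n_def by (rule separator_nonzero)
  have AB: "q \<in> A \<times> B" "q' \<in> A \<times> B" using q by (auto simp: meeting_def)
  have "W q \<subseteq> {x. n \<bullet> x \<le> c}" using W_subset_halfspace[OF AB(2)] unfolding n_def c_def by blast
  then have "closure (W q) \<subseteq> {x. n \<bullet> x \<le> c}" by (intro closure_minimal closed_halfspace_le)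
  moreover have "W q' \<subseteq> {x. n \<bullet> x \<ge> c}" using W_subset_halfspace'[OF AB(1)] unfolding n_def c_def by blast
  then have "closure (W q') \<subseteq> {x. n \<bullet> x \<ge> c}" by (intro closure_minimal closed_halfspace_ge)
  moreover have "z \<in> closure (W q)" "z \<in> closure (W q')" using q(1,2) by (simp_all add: meeting_def)
  ultimately have "n \<bullet> z \<le> c" "n \<bullet> z \<ge> c" by blast+
  then have nz: "n \<bullet> z = c" by simp
  have sub: "{q, q'} \<subseteq> meeting z" using q by simp
  have "card (meeting z) \<le> card {q, q'}" using assms(1) \<open>q \<noteq> q'\<close> by (simp add: not_junction_iff)
  then have eq: "meeting z = {q, q'}" using card_seteq[OF finite_meeting sub] by simp
  obtain r where r: "r > 0" "\<forall>x\<in>ball z r. cell x \<in> meeting z" using locally_only_meeting by blast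
  have br: "x \<in> branching" if x: "x \<in> ball z r" "n \<bullet> x = c" for x
  proof -
    have "ball z r \<inter> {y. n \<bullet> y < c} \<subseteq> W q"
    proof
      fix y assume y: "y \<in> ball z r \<inter> {y. n \<bullet> y < c}"
      then have "cell y = q \<or> cell y = q'" using r(2) eq by blast
      then show "y \<in> W q" using y W_subset_halfspace'[OF AB(1), of y q'] by (auto simp: mem_W_iff n_def c_def)
    qed
    from subsetD[OF closure_mono[OF this]] have 1: "x \<in> closure (W q)"
      using half_ball_closure[OF open_ball x(1) \<open>n \<noteq> 0\<close>, of c] x(2) by simp
    have "ball z r \<inter> {y. - n \<bullet> y < - c} \<subseteq> W q'"
    proof
      fix y assume y: "y \<in> ball z r \<inter> {y. - n \<bullet> y < - c}"
      then have "cell y = q \<or> cell y = q'" using r(2) eq by blast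
      then show "y \<in> W q'" using y W_subset_halfspace[OF AB(2), of y q] by (auto simp: mem_W_iff n_def c_def)
    qed
    from subsetD[OF closure_mono[OF this]] have "x \<in> closure (W q')"
      using half_ball_closure[OF open_ball x(1), of "- n" "- c"] \<open>n \<noteq> 0\<close> x(2) by simp
    then show ?thesis using 1 AB q(3) unfolding branching_def by blast
  qed
  have "two_cell_field v (ball z r) n c ?u ?w"
    unfolding n_def c_def by (rule two_cell_field_pair[OF eq r(2)])
  with r(1) \<open>n \<noteq> 0\<close> nz uw br show ?thesis
    by (intro exI[of _ r] exI[of _ n] exI[of _ c] exI[of _ ?u] exI[of _ ?w]) simp
qed

text \<open>As n \<bullet> u \<le> 0, the ray with velocity u stays in the closed lower half-ball,
  at all of whose points u is an essential value; a tangential u is included. The same holds for w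
  on the upper side.\<close>

lemma not_unique_from_branching:
  assumes "x0 \<notin> J" "x0 \<in> branching" "T > 0"
  shows "\<not> the_filippov_solution v T x0 X"
proof -
  obtain r n c u w where r: "r > 0" and n: "n \<noteq> 0" "n \<bullet> x0 = c" and uw: "u \<noteq> w" "n \<bullet> u \<le> 0" "0 \<le> n \<bullet> w"
    and v: "two_cell_field v (ball x0 r) n c u w"
    using branching_locally[OF assms(1,2)] by blast
  \<comment> \<open>Rays with velocity u or w stay in the ball up to this time.\<close>
  define \<tau> where "\<tau> = r / (norm u + norm w + 1)"
  have den: "norm u + norm w + 1 > 0" by (simp add: add_nonneg_pos)
  have "\<tau> > 0" using r den by (simp add: \<tau>_def)
  have near: "x0 + s *\<^sub>R e \<in> ball x0 r" if "s \<in> {0<..<\<tau>}" "norm e \<le> norm u + norm w" for s e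
  proof -
    have "s * norm e \<le> s * (norm u + norm w + 1)" using that by (intro mult_left_mono) auto
    also have "\<dots> < \<tau> * (norm u + norm w + 1)" using that den by (intro mult_strict_right_mono) auto
    also have "\<dots> = r" using den by (simp add: \<tau>_def)
    finally show ?thesis using that by (simp add: dist_norm)
  qed
  have in_F: "e \<in> filippov_map v x" if "e \<in> essential_values v x" for e x
    using convex_hull_subset_filippov_map[of "{e}" v x] that by simp
  show ?thesis
  proof (rule polyhedral_field_not_unique[OF polyhedral_field_rrr \<open>T > 0\<close> \<open>\<tau> > 0\<close> uw(1)])
    fix s assume s: "s \<in> {0<..<\<tau>}"
    show "u \<in> filippov_map v (x0 + s *\<^sub>R u)"
    proof (rule in_F, rule essential_valueI)
      show "open (ball x0 r \<inter> {y. n \<bullet> y < c})" by (intro open_Int open_halfspace_lt) simp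
      show "x0 + s *\<^sub>R u \<in> closure (ball x0 r \<inter> {y. n \<bullet> y < c})"
        using s n uw near[OF s, of u]
        by (intro half_ball_closure) (auto simp: inner_add_right mult_nonneg_nonpos)
      show "v y = u" if "y \<in> ball x0 r \<inter> {y. n \<bullet> y < c}" for y
        using v that unfolding two_cell_field_def by blast
    qed
    show "w \<in> filippov_map v (x0 + s *\<^sub>R w)"
    proof (rule in_F, rule essential_valueI)
      show "open (ball x0 r \<inter> {y. - n \<bullet> y < - c})" by (intro open_Int open_halfspace_lt) simp
      show "x0 + s *\<^sub>R w \<in> closure (ball x0 r \<inter> {y. - n \<bullet> y < - c})"
        using s n uw near[OF s, of w]
        by (intro half_ball_closure) (auto simp: inner_add_right)
      show "v y = w" if "y \<in> ball x0 r \<inter> {y. - n \<bullet> y < - c}" for y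
        using v that unfolding two_cell_field_def by auto
    qed
  qed
qed

end

lemma two_cell_field_subset:
  "two_cell_field f S n c u w \<Longrightarrow> S' \<subseteq> S \<Longrightarrow> two_cell_field f S' n c u w"
  unfolding two_cell_field_def by blast

text \<open>Until the first time at level c the velocity is u, which does not raise n \<bullet>
  y.\<close>

lemma switching_curve_stays_below:
  assumes y: "switching_curve n c u w 0 a b y" and "a \<le> b" "n \<bullet> u \<le> 0" "n \<bullet> y a < c"
  shows "n \<bullet> y b < c"
proof (rule ccontr)
  assume *: "\<not> n \<bullet> y b < c"
  define S where "S = {t \<in> {a..b}. c \<le> n \<bullet> y t}"
  have "closed S" unfolding S_def
    by (intro continuous_on_closed_Collect_le continuous_intros switching_curve_continuous_on[OF y])
  then have "compact S"
    by (metis (no_types, lifting) S_def bounded_closed_interval bounded_subset compact_eq_bounded_closed mem_Collect_eq subsetI)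
  moreover have "b \<in> S" using * \<open>a \<le> b\<close> by (simp add: S_def)
  ultimately obtain t where t: "t \<in> S" "\<And>s. s \<in> S \<Longrightarrow> t \<le> s" using compact_attains_inf[of S] by blast
  have "y t - y a = (t - a) *\<^sub>R u"
  proof (rule switching_curveD(2)[OF y])
    fix r assume "a < r" "r < t"
    then have "r \<notin> S" "r \<in> {a..b}" using t(1) t(2)[of r] by (auto simp: S_def)
    then show "n \<bullet> y r < c - 0" by (auto simp: S_def)
  qed (use t(1) in \<open>auto simp: S_def\<close>)
  then have "n \<bullet> y t - n \<bullet> y a = (t - a) * (n \<bullet> u)" unfolding inner_diff_right[symmetric] by simp
  moreover have "(t - a) * (n \<bullet> u) \<le> 0" using t(1) assms(3) by (intro mult_nonneg_nonpos) (auto simp: S_def)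
  ultimately show False using t(1) assms(4) by (auto simp: S_def)
qed

context finite_rrr begin

text \<open>On a branching interface the field does not point towards the interface, so a solution that
  meets it away from the junctions has been on it since time 0.\<close>

lemma filippov_solution_branching_from_start:
  assumes y: "filippov_solution v T x0 y" and avoid: "\<And>t. t \<in> {0..T} \<Longrightarrow> y t \<notin> J"
    and t: "t \<in> {0..T}" "y t \<in> branching"
  shows "x0 \<in> branching"
proof -
  have cont: "continuous_on {0..T} y"
    using y abs_continuous_on_imp_continuous_on by (auto simp: filippov_solution_def)
  define S where "S = {0..T} \<inter> y -` branching"
  have "closed S" unfolding S_def using continuous_closed_preimage[OF cont closed_atLeastAtMost closed_branching] .
  then have "compact S" unfolding S_def
    by (metis bounded_Int bounded_closed_interval compact_eq_bounded_closed)
  moreover have "S \<noteq> {}" using t by (auto simp: S_def)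
  ultimately obtain t0 where t0: "t0 \<in> S" "\<And>s. s \<in> S \<Longrightarrow> t0 \<le> s" using compact_attains_inf[of S] by blast
  have "t0 = 0"
  proof (rule ccontr)
    assume "t0 \<noteq> 0"
    then have t0T: "0 < t0" "t0 \<le> T" "y t0 \<in> branching" using t0(1) by (auto simp: S_def)
    then obtain r n c u w where r: "r > 0" and n: "n \<noteq> 0" "n \<bullet> y t0 = c" and uw: "n \<bullet> u \<le> 0" "0 \<le> n \<bullet> w"
      and v: "two_cell_field v (ball (y t0) r) n c u w" and br: "\<And>x. x \<in> ball (y t0) r \<Longrightarrow> n \<bullet> x = c \<Longrightarrow> x \<in> branching"
      using branching_locally[OF avoid[of t0]] by force
    have "t0 \<in> {0..T}" using t0T by simp
    then obtain d where d: "d > 0" "\<And>s. s \<in> {0..T} \<Longrightarrow> dist s t0 < d \<Longrightarrow> dist (y s) (y t0) < r"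
      using cont r unfolding continuous_on_iff by blast
    define t1 where "t1 = max 0 (t0 - d / 2)"
    have t1: "0 \<le> t1" "t1 < t0" "t0 - t1 < d" using t0T d(1) by (auto simp: t1_def)
    have near: "y ` {t1..t0} \<subseteq> ball (y t0) r"
    proof clarify
      fix s assume "s \<in> {t1..t0}"
      then show "y s \<in> ball (y t0) r" using d(2)[of s] t1 t0T by (auto simp: dist_real_def dist_commute)
    qed
    have sw: "switching_curve n c u w 0 t1 t0 y"
      by (rule filippov_solution_switching_curve[OF y v t1(1) t0T(2) near])
    \<comment> \<open>Being strictly on either side at t1 would persist up to t0, where the curve is
      on the hyperplane. So it is on the hyperplane at t1 already, against the minimality of
      t0.\<close>
    have "\<not> n \<bullet> y t1 < c"
      using switching_curve_stays_below[OF sw less_imp_le[OF t1(2)] uw(1)] n(2) by auto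
    moreover have "\<not> - n \<bullet> y t1 < - c"
      using switching_curve_stays_below[OF switching_curve_flip[OF sw] less_imp_le[OF t1(2)]] uw(2) n(2) by auto
    ultimately have "n \<bullet> y t1 = c" by simp
    moreover have "y t1 \<in> ball (y t0) r" using near t1(2) by (meson atLeastAtMost_iff image_subset_iff less_imp_le order_refl)
    ultimately have "t1 \<in> S" using br t1 t0T by (auto simp: S_def)
    then show False using t0(2) t1(2) by force
  qed
  then show ?thesis using t0(1) y by (auto simp: S_def filippov_solution_def)
qed

section \<open>Tube of good neighbourhoods and the error estimate\<close>

text \<open>Uniqueness excludes a start in \<open>branching\<close>, hence any visit to it, so balls
  with well-posed switches cover the trajectory. A Lebesgue number of this cover is the common
  radius R.\<close>

lemma the_filippov_solution_tube:
  assumes X: "the_filippov_solution v T x0 x" and "T > 0" and avoid: "\<And>t. t \<in> {0..T} \<Longrightarrow> x t \<notin> J"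
  shows "\<exists>R>0. \<forall>t\<in>{0..T}. \<exists>n c u w. two_cell_field v (ball (x t) R) n c u w \<and> well_posed_switch n u w"
proof -
  have x: "filippov_solution v T x0 x" using X by (simp add: the_filippov_solution_def)
  have "x 0 = x0" using x by (simp add: filippov_solution_def)
  then have "x0 \<notin> J" using avoid[of 0] \<open>T > 0\<close> by simp
  then have "x0 \<notin> branching" using not_unique_from_branching[OF _ _ \<open>T > 0\<close>] X by blast
  then have nb: "x t \<notin> branching" if "t \<in> {0..T}" for t
    using filippov_solution_branching_from_start[OF x avoid that] by blast
  let ?S = "x ` {0..T}"
  have comp: "compact ?S"
    using x abs_continuous_on_imp_continuous_on by (auto simp: filippov_solution_def intro!: compact_continuous_image)
  have "\<forall>z\<in>?S. \<exists>r. r > 0 \<and> (\<exists>n c u w. two_cell_field v (ball z r) n c u w \<and> well_posed_switch n u w)"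
  proof
    fix z assume "z \<in> ?S"
    then obtain t where "t \<in> {0..T}" "z = x t" by blast
    then show "\<exists>r. r > 0 \<and> (\<exists>n c u w. two_cell_field v (ball z r) n c u w \<and> well_posed_switch n u w)"
      using well_posed_locally[OF avoid[of t] nb[of t]] by simp
  qed
  from bchoice[OF this] obtain r where r0: "\<forall>z\<in>?S. r z > 0 \<and>
    (\<exists>n c u w. two_cell_field v (ball z (r z)) n c u w \<and> well_posed_switch n u w)" ..
  note r = r0[rule_format, THEN conjunct1] r0[rule_format, THEN conjunct2]
  let ?C = "(\<lambda>z. ball z (r z)) ` ?S"
  have cov: "?S \<subseteq> \<Union>?C"
  proof
    fix z assume z: "z \<in> ?S"
    then have "z \<in> ball z (r z)" using r(1) by simp
    then show "z \<in> \<Union>?C" using z by (rule UN_I[rotated])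
  qed
  have op: "open G" if "G \<in> ?C" for G using that by (elim imageE) simp
  obtain R where R: "0 < R" "\<And>z. z \<in> ?S \<Longrightarrow> \<exists>G\<in>?C. ball z R \<subseteq> G"
  proof (rule Heine_Borel_lemma[OF comp cov])
    show "open G" if "G \<in> ?C" for G using that by (rule op)
    fix \<epsilon> :: real assume "0 < \<epsilon>" "\<And>z. z \<in> ?S \<Longrightarrow> \<exists>G\<in>?C. ball z \<epsilon> \<subseteq> G"
    then show thesis by (rule that)
  qed
  have "\<exists>n c u w. two_cell_field v (ball (x t) R) n c u w \<and> well_posed_switch n u w" if "t \<in> {0..T}" for t
  proof -
    have "x t \<in> ?S" using that by (rule imageI)
    from R(2)[OF this] obtain z where z: "z \<in> ?S" "ball (x t) R \<subseteq> ball z (r z)" by (elim bexE imageE) blast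
    from r(2)[OF z(1)] obtain n c u w where
      "two_cell_field v (ball z (r z)) n c u w" "well_posed_switch n u w" by (elim exE conjE)
    then show ?thesis using two_cell_field_subset[OF _ z(2)] by (intro exI conjI)
  qed
  with R(1) show ?thesis by (intro exI[of _ R] conjI ballI)
qed

text \<open>The solution from x0 supplies the local data and the constant, but the comparison is
  between the polygon and the solution from the same nearby point y.\<close>

lemma euler_interp_linear_error_finite:
  assumes "compact K" "T > 0" and X: "\<And>x0. x0 \<in> K \<Longrightarrow> the_filippov_solution v T x0 (X x0)"
    and avoid: "\<And>x0 t. x0 \<in> K \<Longrightarrow> t \<in> {0..T} \<Longrightarrow> X x0 t \<notin> J"
  shows "\<exists>\<epsilon>0>0. \<exists>C>0. \<forall>x0\<in>K. \<forall>\<epsilon>. 0 < \<epsilon> \<and> \<epsilon> \<le> \<epsilon>0 \<longrightarrow>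
           (\<forall>t\<in>{0..T}. norm (euler_interp v \<epsilon> x0 t - X x0 t) \<le> C * \<epsilon>)"
proof (rule compact_uniform_linear_bound[OF \<open>compact K\<close>])
  fix x0 assume x0: "x0 \<in> K"
  obtain M where M: "M > 0" "\<And>x. norm (v x) \<le> M"
    using finite_imp_bounded[OF finite_range_field] unfolding bounded_pos by auto
  have sol: "filippov_solution v T y (X y)" "X y 0 = y" if "y \<in> K" for y
    using X[OF that] by (auto simp: the_filippov_solution_def filippov_solution_def)
  obtain R where R: "R > 0" "\<And>t. t \<in> {0..T} \<Longrightarrow> \<exists>n c u w. two_cell_field v (ball (X x0 t) R) n c u w \<and> well_posed_switch n u w"
    using the_filippov_solution_tube[OF X[OF x0] \<open>T > 0\<close> avoid[OF x0]] by blast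
  have "\<forall>t\<in>{0..T}. \<exists>p. two_cell_field v (ball (X x0 t) R) (fst p) (fst (snd p)) (fst (snd (snd p))) (snd (snd (snd p)))
      \<and> well_posed_switch (fst p) (fst (snd (snd p))) (snd (snd (snd p)))"
    using R(2) by force
  from bchoice[OF this] obtain p where p: "\<forall>t\<in>{0..T}. two_cell_field v (ball (X x0 t) R)
      (fst (p t)) (fst (snd (p t))) (fst (snd (snd (p t)))) (snd (snd (snd (p t))))
      \<and> well_posed_switch (fst (p t)) (fst (snd (snd (p t)))) (snd (snd (snd (p t))))" ..
  define n where "n t = fst (p t)" for t
  define c where "c t = fst (snd (p t))" for t
  define u where "u t = fst (snd (snd (p t)))" for t
  define w where "w t = snd (snd (snd (p t)))" for t
  have tc: "two_cell_field v (ball (X x0 t) R) (n t) (c t) (u t) (w t)" "well_posed_switch (n t) (u t) (w t)"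
    if "t \<in> {0..T}" for t using p that by (auto simp: n_def c_def u_def w_def)
  \<comment> \<open>The other half of R is the margin for grid points, which may lie M \<epsilon>
    outside the smaller ball.\<close>
  define \<rho> where "\<rho> = R / 2"
  have \<rho>: "\<rho> > 0" using R(1) by (simp add: \<rho>_def)
  let ?near = "switching_near (X x0) \<rho> M T n c u w"
  have sub: "two_cell_field v (ball (X x0 t) \<rho>) (n t) (c t) (u t) (w t)" if "t \<in> {0..T}" for t
    using tc(1)[OF that] R(1) unfolding two_cell_field_def \<rho>_def by auto
  have near_sol: "?near 0 (X y)" if "y \<in> K" for y
    unfolding switching_near_def
  proof (intro conjI allI ballI impI; (elim conjE)?)
    show "norm (X y t - X y s) \<le> M * (t - s)" if "0 \<le> s" "s \<le> t" "t \<le> T" for s t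
      by (rule filippov_solution_speed[OF sol(1)[OF \<open>y \<in> K\<close>] that finite_range_field M(2)])
    show "switching_curve (n \<tau>) (c \<tau>) (u \<tau>) (w \<tau>) (norm (n \<tau>) * 0) a b (X y)"
      if "\<tau> \<in> {0..T}" "0 \<le> a" "a \<le> b" "b \<le> T" "X y ` {a..b} \<subseteq> ball (X x0 \<tau>) \<rho>" for \<tau> a b
      using filippov_solution_switching_curve[OF sol(1)[OF \<open>y \<in> K\<close>] sub[OF that(1)] that(2,4,5)] by simp
  qed
  have near_euler: "?near (M * \<epsilon>) (euler_interp v \<epsilon> y)" if \<epsilon>: "\<epsilon> > 0" "M * \<epsilon> \<le> \<rho>" for \<epsilon> y
    unfolding switching_near_def
  proof (intro conjI allI ballI impI; (elim conjE)?)
    show "norm (euler_interp v \<epsilon> y t - euler_interp v \<epsilon> y s) \<le> M * (t - s)" if "0 \<le> s" "s \<le> t" "t \<le> T" for s t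
      by (rule euler_interp_speed[OF \<epsilon>(1) that(1,2) M(2)])
    show "switching_curve (n \<tau>) (c \<tau>) (u \<tau>) (w \<tau>) (norm (n \<tau>) * (M * \<epsilon>)) a b (euler_interp v \<epsilon> y)"
      if "\<tau> \<in> {0..T}" "0 \<le> a" "a \<le> b" "b \<le> T" "euler_interp v \<epsilon> y ` {a..b} \<subseteq> ball (X x0 \<tau>) \<rho>" for \<tau> a b
      using \<epsilon>(2) by (intro euler_interp_switching_curve[OF tc(1)[OF that(1)] M(2) \<epsilon>(1) that(2) _ that(5)]) (simp add: \<rho>_def)
  qed
  have "\<exists>L\<ge>0. \<forall>\<eta> y z. 0 \<le> \<eta> \<longrightarrow> ?near \<eta> y \<longrightarrow> ?near \<eta> z \<longrightarrow>
      L * (norm (y 0 - X x0 0) + \<eta>) < \<rho> / 2 \<longrightarrow> L * (norm (z 0 - X x0 0) + \<eta>) < \<rho> / 2 \<longrightarrow>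
      (\<forall>t\<in>{0..T}. norm (y t - z t) \<le> L * (norm (y 0 - z 0) + \<eta>))"
    by (rule switching_near_stability[OF \<open>T > 0\<close> \<rho> less_imp_le[OF M(1)] near_sol[OF x0]]) (rule tc(2))
  then obtain L where L: "L \<ge> 0" and stab: "\<forall>\<eta> y z. 0 \<le> \<eta> \<longrightarrow> ?near \<eta> y \<longrightarrow> ?near \<eta> z \<longrightarrow>
      L * (norm (y 0 - X x0 0) + \<eta>) < \<rho> / 2 \<longrightarrow> L * (norm (z 0 - X x0 0) + \<eta>) < \<rho> / 2 \<longrightarrow>
      (\<forall>t\<in>{0..T}. norm (y t - z t) \<le> L * (norm (y 0 - z 0) + \<eta>))"
    by (elim exE conjE)
  \<comment> \<open>If the initial distance from x0 and \<eta> are both at most r, then L times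
    their sum is below \<rho> / 2, as \<open>stab\<close> demands.\<close>
  define r where "r = \<rho> / (4 * (L + 1))"
  \<comment> \<open>The first quotient secures the margin M \<epsilon> \<le> \<rho> of the polygon,
    the second makes \<eta> = M \<epsilon> at most r.\<close>
  define e where "e = min (\<rho> / M) (r / M)"
  have r: "r > 0" and e: "e > 0" using \<rho> L M(1) by (auto simp: r_def e_def)
  have small: "L * (a + b) < \<rho> / 2" if "a \<le> r" "b \<le> r" for a b
  proof -
    have "L * (a + b) \<le> L * (2 * r)" using that L by (intro mult_left_mono) auto
    also have "\<dots> < (L + 1) * (2 * r)" using r by simp
    also have "\<dots> = \<rho> / 2" using L by (simp add: r_def field_simps)
    finally show ?thesis .
  qed
  have "norm (euler_interp v \<epsilon> y t - X y t) \<le> (L * M) * \<epsilon>"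
    if y: "y \<in> K" "dist x0 y < r" and \<epsilon>: "0 < \<epsilon>" "\<epsilon> \<le> e" and t: "t \<in> {0..T}" for y \<epsilon> t
  proof -
    have M\<epsilon>: "M * \<epsilon> \<le> \<rho>" "M * \<epsilon> \<le> r" "0 \<le> M * \<epsilon>"
      using \<epsilon> M(1) by (auto simp: e_def pos_le_divide_eq mult.commute)
    have start: "euler_interp v \<epsilon> y 0 = y" using euler_interp_grid[OF \<epsilon>(1), of v y 0] by simp
    have d: "norm (y - X x0 0) \<le> r" using y(2) sol(2)[OF x0] by (simp add: dist_norm norm_minus_commute)
    have "L * (norm (euler_interp v \<epsilon> y 0 - X x0 0) + M * \<epsilon>) < \<rho> / 2"
      "L * (norm (X y 0 - X x0 0) + M * \<epsilon>) < \<rho> / 2"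
      using small[OF d M\<epsilon>(2)] unfolding start sol(2)[OF y(1)] by assumption+
    from stab[rule_format, OF M\<epsilon>(3) near_euler[OF \<epsilon>(1) M\<epsilon>(1)] switching_near_mono[OF near_sol[OF y(1)] M\<epsilon>(3)] this t]
    have "norm (euler_interp v \<epsilon> y t - X y t) \<le> L * (norm (euler_interp v \<epsilon> y 0 - X y 0) + M * \<epsilon>)" .
    \<comment> \<open>Polygon and solution both start at y, so only the term \<eta> = M \<epsilon>
      survives.\<close>
    then show ?thesis using start sol(2)[OF y(1)] by simp
  qed
  then show "\<exists>r>0. \<exists>e>0. \<exists>C. \<forall>y\<in>K. dist x0 y < r \<longrightarrow> (\<forall>\<epsilon>. 0 < \<epsilon> \<and> \<epsilon> \<le> e \<longrightarrow>
      (\<forall>t\<in>{0..T}. norm (euler_interp v \<epsilon> y t - X y t) \<le> C * \<epsilon>))"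
    using r e by blast
qed

end

theorem theorem3p3:
  fixes A B K :: "'a::euclidean_space set"
    and T \<delta>0 :: real
    and pA pB :: "'a \<Rightarrow> 'a"
    and X :: "'a \<Rightarrow> real \<Rightarrow> 'a"
  assumes "closed A" and "closed B" and "compact K" and "T > 0"
    and "metric_projection A pA" and "metric_projection B pB"
    and "(\<exists>p U. smooth_transverse_on A B pA pB p U \<and> K \<subseteq> U \<and>
            (\<forall>x0\<in>K. caratheodory_solution U (rrr_field pA pB) T x0 (X x0)))
       \<or> (finite A \<and> finite B \<and> \<delta>0 > 0 \<and>
            (\<forall>x0\<in>K. the_filippov_solution (rrr_field pA pB) T x0 (X x0) \<and>
               finite {S \<in> two_cell_interfaces A B pA pB. \<exists>t\<in>{0..T}. X x0 t \<in> S} \<and>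
               (\<forall>t\<in>{0..T}. \<forall>y \<in> junctions A B pA pB. dist (X x0 t) y \<ge> \<delta>0)))"
  shows "\<exists>\<epsilon>0>0. \<exists>C>0. \<forall>x0\<in>K. \<forall>\<epsilon>. 0 < \<epsilon> \<and> \<epsilon> \<le> \<epsilon>0 \<longrightarrow>
           (\<forall>t\<in>{0..T}. norm (euler_interp (rrr_field pA pB) \<epsilon> x0 t - X x0 t) \<le> C * \<epsilon>)"
  using assms(7)
proof
  assume "\<exists>p U. smooth_transverse_on A B pA pB p U \<and> K \<subseteq> U \<and>
    (\<forall>x0\<in>K. caratheodory_solution U (rrr_field pA pB) T x0 (X x0))"
  then obtain p U where U: "smooth_transverse_on A B pA pB p U"
    and X: "\<And>x0. x0 \<in> K \<Longrightarrow> caratheodory_solution U (rrr_field pA pB) T x0 (X x0)" by blast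
  from U obtain V where "open U" "C1_on pA U" "reflector pA ` U \<subseteq> V" "C1_on pB V"
    unfolding smooth_transverse_on_def by blast
  then show ?thesis
    using euler_interp_linear_error_smooth[OF C1_on_rrr_field _ \<open>compact K\<close> \<open>T > 0\<close> X] by blast
next
  assume *: "finite A \<and> finite B \<and> \<delta>0 > 0 \<and>
    (\<forall>x0\<in>K. the_filippov_solution (rrr_field pA pB) T x0 (X x0) \<and>
       finite {S \<in> two_cell_interfaces A B pA pB. \<exists>t\<in>{0..T}. X x0 t \<in> S} \<and>
       (\<forall>t\<in>{0..T}. \<forall>y \<in> junctions A B pA pB. dist (X x0 t) y \<ge> \<delta>0))"
  then interpret finite_rrr A B pA pB using assms(5,6) by unfold_locales auto
  have "X x0 t \<notin> junctions A B pA pB" if "x0 \<in> K" "t \<in> {0..T}" for x0 t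
  proof
    assume "X x0 t \<in> junctions A B pA pB"
    \<comment> \<open>A point of the trajectory that is a junction would itself compete in the
      distance bound.\<close>
    then have "dist (X x0 t) (X x0 t) \<ge> \<delta>0" using * that by blast
    then show False using * by simp
  qed
  then show ?thesis using * by (intro euler_interp_linear_error_finite[OF \<open>compact K\<close> \<open>T > 0\<close>]) auto
qed

end
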